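(* The following Absolute Leader Selection problem is NP-hard: in an absolute leader system, given a strongly connected directed graph $\mathcal{G}=(\mathcal{V},\mathcal{E},w)$ with edge weight function $w:\mathcal{E}\to\mathbb{R}^+$, an opinion-$0$ absolute leader set $S_0\neq\emptyset$, a specified value $\alpha\in[0,1]$, a candidate set $Q\subseteq\mathcal{V}\setminus S_0$ with $|Q|=q$, and an integer $1\le k\le q$, find a node set $S_1\subseteq Q$ with $|S_1|\le k$ such that $$S_1\in\arg\min_{P\subseteq Q,\ |P|\le k}\ |\mu(P)-\alpha| .$$
   Context: For a weighted directed graph, $A_{u,v}=w(u,v)$ if $(u,v)\in\mathcal{E}$ and $0$ otherwise, $D$ is the diagonal out-degree matrix $D_{u,u}=\sum_vA_{u,v}$, and $L=D-A$. An undirected graph is regarded as a directed graph with symmetric $A$. Absolute leader system with disjoint leader sets $S_0$ (opinion $0$) and $P$ (opinion $1$): with $S=S_0\cup P$, $F=\mathcal{V}\setminus S$, the leaders hold their opinions constant and the followers follow $\dot x_F=-L_{F,F}x_F-L_{F,S}x_S$; the steady state is $\hat x_v=0$ on $S_0$, $\hat x_v=1$ on $P$, $\hat x_F=-(L_{F,F})^{-1}L_{F,S}\hat x_S$. The average opinion (over all nodes, leaders and followers) is $\mu(P)=\frac1n\sum_{v\in\mathcal{V}}\hat x_v$, $n=|\mathcal{V}|$. *)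

theory Defs
  imports
    "HOL-Analysis.Analysis"
    "HOL-Computational_Algebra.Polynomial"
    "Graph_Theory.Graph_Theory"
begin

section \<open>Absolute leader systems\<close>

definition adjacency :: "'v pair_pre_digraph \<Rightarrow> ('v \<times> 'v \<Rightarrow> real) \<Rightarrow> 'v \<Rightarrow> 'v \<Rightarrow> real" where
  "adjacency G w u v = (if (u, v) \<in> parcs G then w (u, v) else 0)"

definition degree_matrix :: "'v pair_pre_digraph \<Rightarrow> ('v \<times> 'v \<Rightarrow> real) \<Rightarrow> 'v \<Rightarrow> 'v \<Rightarrow> real" where
  "degree_matrix G w u v = (if u = v then \<Sum>z\<in>pverts G. adjacency G w u z else 0)"

definition laplacian :: "'v pair_pre_digraph \<Rightarrow> ('v \<times> 'v \<Rightarrow> real) \<Rightarrow> 'v \<Rightarrow> 'v \<Rightarrow> real" where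
  "laplacian G w u v = degree_matrix G w u v - adjacency G w u v"

text \<open>
  Matrices are indexed by vertices, so the block \<open>M\<^sub>F\<^sub>,\<^sub>F\<close> is the restriction of \<open>M\<close> to indices
  in \<open>F\<close>. The entries of the inverse block are determined on \<open>F \<times> F\<close> whenever the block is
  invertible; only these entries are used below.
\<close>

definition is_block_inverse :: "'v set \<Rightarrow> ('v \<Rightarrow> 'v \<Rightarrow> real) \<Rightarrow> ('v \<Rightarrow> 'v \<Rightarrow> real) \<Rightarrow> bool" where
  "is_block_inverse F M N \<longleftrightarrow>
     (\<forall>u\<in>F. \<forall>v\<in>F. (\<Sum>z\<in>F. M u z * N z v) = (if u = v then 1 else 0)) \<and>
     (\<forall>u\<in>F. \<forall>v\<in>F. (\<Sum>z\<in>F. N u z * M z v) = (if u = v then 1 else 0))"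

definition block_inverse :: "'v set \<Rightarrow> ('v \<Rightarrow> 'v \<Rightarrow> real) \<Rightarrow> 'v \<Rightarrow> 'v \<Rightarrow> real" where
  "block_inverse F M = (SOME N. is_block_inverse F M N)"

definition leader_opinion :: "'v set \<Rightarrow> 'v \<Rightarrow> real" where
  "leader_opinion P s = (if s \<in> P then 1 else 0)"

definition steady_state ::
  "'v pair_pre_digraph \<Rightarrow> ('v \<times> 'v \<Rightarrow> real) \<Rightarrow> 'v set \<Rightarrow> 'v set \<Rightarrow> 'v \<Rightarrow> real" where
  "steady_state G w S0 P v =
     (let S = S0 \<union> P; F = pverts G - S; L = laplacian G w in
      if v \<in> S then leader_opinion P v
      else - (\<Sum>u\<in>F. block_inverse F L v u * (\<Sum>s\<in>S. L u s * leader_opinion P s)))"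

definition average_opinion ::
  "'v pair_pre_digraph \<Rightarrow> ('v \<times> 'v \<Rightarrow> real) \<Rightarrow> 'v set \<Rightarrow> 'v set \<Rightarrow> real" where
  "average_opinion G w S0 P =
     (\<Sum>v\<in>pverts G. steady_state G w S0 P v) / real (card (pverts G))"


section \<open>Absolute leader selection\<close>

definition leader_selection_instance ::
  "'v pair_pre_digraph \<Rightarrow> ('v \<times> 'v \<Rightarrow> real) \<Rightarrow> 'v set \<Rightarrow> real \<Rightarrow> 'v set \<Rightarrow> nat \<Rightarrow> bool" where
  "leader_selection_instance G w S0 \<alpha> Q k \<longleftrightarrow>
     pair_fin_digraph G \<and> strongly_connected (with_proj G) \<and>
     (\<forall>e\<in>parcs G. w e > 0) \<and>
     S0 \<subseteq> pverts G \<and> S0 \<noteq> {} \<and>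
     0 \<le> \<alpha> \<and> \<alpha> \<le> 1 \<and>
     Q \<subseteq> pverts G - S0 \<and> 1 \<le> k \<and> k \<le> card Q"

definition leader_selection_solution ::
  "'v pair_pre_digraph \<Rightarrow> ('v \<times> 'v \<Rightarrow> real) \<Rightarrow> 'v set \<Rightarrow> real \<Rightarrow> 'v set \<Rightarrow> nat \<Rightarrow> 'v set \<Rightarrow> bool" where
  "leader_selection_solution G w S0 \<alpha> Q k S1 \<longleftrightarrow>
     is_arg_min (\<lambda>P. \<bar>average_opinion G w S0 P - \<alpha>\<bar>) (\<lambda>P. P \<subseteq> Q \<and> card P \<le> k) S1"


section \<open>Turing machines\<close>

text \<open>
  Deterministic multi-tape machines with two-way infinite tapes. States and tape symbols are
  initial segments of the natural numbers. Symbol \<open>0\<close> is the blank, symbols \<open>1\<close> and \<open>2\<close> stand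
  for the bits \<open>False\<close> and \<open>True\<close>; further work symbols are allowed. As \<open>tm_delta\<close> is only
  ever applied to states below \<open>tm_states\<close> and to tuples of symbols below \<open>tm_symbols\<close>, a
  well-formed machine is a finite object.
\<close>

datatype move = Move_Left | Stay | Move_Right

type_synonym tape = "(int \<Rightarrow> nat) \<times> int"
type_synonym config = "nat \<times> tape list"

record tm =
  tm_tapes :: nat
  tm_symbols :: nat
  tm_states :: nat
  tm_start :: nat
  tm_accept :: nat
  tm_reject :: nat
  tm_delta :: "nat \<Rightarrow> nat list \<Rightarrow> nat \<times> (nat \<times> move) list"

record oracle_tm = tm +
  tm_query :: nat
  tm_response :: nat

definition tm_wf :: "'a tm_scheme \<Rightarrow> bool" where
  "tm_wf M \<longleftrightarrow>
     2 \<le> tm_tapes M \<and> 3 \<le> tm_symbols M \<and>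
     tm_start M < tm_states M \<and> tm_accept M < tm_states M \<and> tm_reject M < tm_states M \<and>
     tm_accept M \<noteq> tm_reject M \<and>
     (\<forall>q ss q' as. q < tm_states M \<longrightarrow> length ss = tm_tapes M \<longrightarrow> set ss \<subseteq> {..<tm_symbols M} \<longrightarrow>
        tm_delta M q ss = (q', as) \<longrightarrow>
        q' < tm_states M \<and> length as = tm_tapes M \<and> fst ` set as \<subseteq> {..<tm_symbols M})"

definition oracle_tm_wf :: "oracle_tm \<Rightarrow> bool" where
  "oracle_tm_wf M \<longleftrightarrow>
     tm_wf M \<and> tm_query M < tm_states M \<and> tm_response M < tm_states M \<and>
     tm_query M \<notin> {tm_accept M, tm_reject M}"

definition halting :: "'a tm_scheme \<Rightarrow> nat \<Rightarrow> bool" where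
  "halting M q \<longleftrightarrow> q = tm_accept M \<or> q = tm_reject M"

fun move_head :: "move \<Rightarrow> int \<Rightarrow> int" where
  "move_head Move_Left h = h - 1"
| "move_head Stay h = h"
| "move_head Move_Right h = h + 1"

fun tape_action :: "nat \<times> move \<Rightarrow> tape \<Rightarrow> tape" where
  "tape_action (s, d) (f, h) = (f(h := s), move_head d h)"

fun tape_read :: "tape \<Rightarrow> nat" where
  "tape_read (f, h) = f h"

definition string_tape :: "bool list \<Rightarrow> tape" where
  "string_tape x =
     ((\<lambda>i. if 0 \<le> i \<and> i < int (length x) then (if x ! nat i then 2 else 1) else 0), 0)"

text \<open>The bit string starting in cell 0 and extending up to the first non-bit symbol.\<close>

definition tape_string :: "tape \<Rightarrow> bool list" where
  "tape_string t = map (\<lambda>i. fst t (int i) = 2) [0..<LEAST i. fst t (int i) \<notin> {1, 2}]"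

text \<open>The \<open>i\<close>-th input string is placed on tape \<open>i\<close>; the remaining tapes are blank.\<close>

definition initial_config :: "'a tm_scheme \<Rightarrow> bool list list \<Rightarrow> config" where
  "initial_config M xs =
     (tm_start M,
      map (\<lambda>i. string_tape (if i < length xs then xs ! i else [])) [0..<tm_tapes M])"

definition tm_step :: "'a tm_scheme \<Rightarrow> config \<Rightarrow> config" where
  "tm_step M c =
     (if halting M (fst c) then c
      else let (q', as) = tm_delta M (fst c) (map tape_read (snd c))
           in (q', map2 tape_action as (snd c)))"

text \<open>
  Tape 1 is the oracle tape. A step from the query state replaces its whole content by the
  oracle's answer to the string written on it.
\<close>

definition oracle_step :: "(bool list \<Rightarrow> bool list) \<Rightarrow> oracle_tm \<Rightarrow> config \<Rightarrow> config" where
  "oracle_step Orc M c =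
     (if fst c = tm_query M
      then (tm_response M, (snd c)[1 := string_tape (Orc (tape_string (snd c ! 1)))])
      else tm_step M c)"

definition tm_state_after :: "'a tm_scheme \<Rightarrow> bool list list \<Rightarrow> nat \<Rightarrow> nat" where
  "tm_state_after M xs t = fst ((tm_step M ^^ t) (initial_config M xs))"

definition oracle_state_after ::
  "(bool list \<Rightarrow> bool list) \<Rightarrow> oracle_tm \<Rightarrow> bool list list \<Rightarrow> nat \<Rightarrow> nat" where
  "oracle_state_after Orc M xs t = fst ((oracle_step Orc M ^^ t) (initial_config M xs))"


section \<open>NP and NP-hardness of search problems\<close>

definition in_NP :: "bool list set \<Rightarrow> bool" where
  "in_NP A \<longleftrightarrow>
     (\<exists>(V :: tm) (p :: nat poly) (r :: nat poly). tm_wf V \<and>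
        (\<forall>x u. halting V (tm_state_after V [x, u] (poly r (length x + length u)))) \<and>
        (\<forall>x. x \<in> A \<longleftrightarrow>
           (\<exists>u. length u \<le> poly p (length x) \<and>
                tm_state_after V [x, u] (poly r (length x + length u)) = tm_accept V)))"

text \<open>
  A search problem relates instances to their solutions. An oracle solving it may behave
  arbitrarily on strings without a solution, and it may return any of the solutions otherwise.
\<close>

type_synonym search_problem = "bool list \<Rightarrow> bool list \<Rightarrow> bool"

definition solves :: "(bool list \<Rightarrow> bool list) \<Rightarrow> search_problem \<Rightarrow> bool" where
  "solves Orc R \<longleftrightarrow> (\<forall>x. (\<exists>y. R x y) \<longrightarrow> R x (Orc x))"

definition poly_turing_reducible :: "bool list set \<Rightarrow> search_problem \<Rightarrow> bool" where
  "poly_turing_reducible A R \<longleftrightarrow>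
     (\<exists>(M :: oracle_tm) (r :: nat poly). oracle_tm_wf M \<and>
        (\<forall>Orc. solves Orc R \<longrightarrow>
           (\<forall>x. oracle_state_after Orc M [x] (poly r (length x)) =
                  (if x \<in> A then tm_accept M else tm_reject M))))"

definition NP_hard :: "search_problem \<Rightarrow> bool" where
  "NP_hard R \<longleftrightarrow> (\<forall>A. in_NP A \<longrightarrow> poly_turing_reducible A R)"


section \<open>Absolute leader selection as a search problem on strings\<close>

text \<open>
  Vertices are \<open>0, \<dots>, n - 1\<close>. Edge weights and \<open>\<alpha>\<close> are fractions, given by numerator and
  denominator. All numbers are encoded in binary.
\<close>

type_synonym fraction = "nat \<times> nat"

record leader_data =
  ld_nodes :: nat
  ld_edges :: "((nat \<times> nat) \<times> fraction) list"
  ld_zero_leaders :: "nat list"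
  ld_target :: fraction
  ld_candidates :: "nat list"
  ld_budget :: nat

definition fraction_value :: "fraction \<Rightarrow> real" where
  "fraction_value a = real (fst a) / real (snd a)"

definition ld_graph :: "leader_data \<Rightarrow> nat pair_pre_digraph" where
  "ld_graph I = \<lparr> pverts = {..<ld_nodes I}, parcs = fst ` set (ld_edges I) \<rparr>"

definition ld_weight :: "leader_data \<Rightarrow> nat \<times> nat \<Rightarrow> real" where
  "ld_weight I e = fraction_value (the (map_of (ld_edges I) e))"

definition ld_valid :: "leader_data \<Rightarrow> bool" where
  "ld_valid I \<longleftrightarrow>
     distinct (map fst (ld_edges I)) \<and> (\<forall>(e, a)\<in>set (ld_edges I). snd a > 0) \<and>
     snd (ld_target I) > 0 \<and> distinct (ld_zero_leaders I) \<and> distinct (ld_candidates I) \<and>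
     leader_selection_instance (ld_graph I) (ld_weight I) (set (ld_zero_leaders I))
       (fraction_value (ld_target I)) (set (ld_candidates I)) (ld_budget I)"

fun binary :: "nat \<Rightarrow> bool list" where
  "binary n = (if n = 0 then [] else odd n # binary (n div 2))"

declare binary.simps [simp del]

definition encode_list :: "('a \<Rightarrow> bool list) \<Rightarrow> 'a list \<Rightarrow> bool list" where
  "encode_list f xs = concat (map (\<lambda>x. True # f x) xs) @ [False]"

definition encode_nat :: "nat \<Rightarrow> bool list" where
  "encode_nat n = encode_list (\<lambda>b. [b]) (binary n)"

definition encode_pair :: "('a \<Rightarrow> bool list) \<Rightarrow> ('b \<Rightarrow> bool list) \<Rightarrow> 'a \<times> 'b \<Rightarrow> bool list" where
  "encode_pair f g p = f (fst p) @ g (snd p)"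

abbreviation encode_nat_pair :: "nat \<times> nat \<Rightarrow> bool list" where
  "encode_nat_pair \<equiv> encode_pair encode_nat encode_nat"

definition ld_encode :: "leader_data \<Rightarrow> bool list" where
  "ld_encode I =
     encode_nat (ld_nodes I) @
     encode_list (encode_pair encode_nat_pair encode_nat_pair) (ld_edges I) @
     encode_list encode_nat (ld_zero_leaders I) @
     encode_nat_pair (ld_target I) @
     encode_list encode_nat (ld_candidates I) @
     encode_nat (ld_budget I)"

text \<open>A vertex set is encoded by its characteristic vector.\<close>

definition encode_vertex_set :: "nat \<Rightarrow> nat set \<Rightarrow> bool list" where
  "encode_vertex_set n S = map (\<lambda>v. v \<in> S) [0..<n]"

definition absolute_leader_selection :: search_problem where
  "absolute_leader_selection x y \<longleftrightarrow>
     (\<exists>I S1. ld_valid I \<and> x = ld_encode I \<and>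
        leader_selection_solution (ld_graph I) (ld_weight I) (set (ld_zero_leaders I))
          (fraction_value (ld_target I)) (set (ld_candidates I)) (ld_budget I) S1 \<and>
        y = encode_vertex_set (ld_nodes I) S1)"


section \<open>The encoding is unambiguous\<close>

definition prefix_free :: "('a \<Rightarrow> bool list) \<Rightarrow> bool" where
  "prefix_free f \<longleftrightarrow> (\<forall>a b r s. f a @ r = f b @ s \<longrightarrow> a = b \<and> r = s)"

lemma prefix_freeD: "prefix_free f \<Longrightarrow> f a @ r = f b @ s \<Longrightarrow> a = b \<and> r = s"
  by (auto simp: prefix_free_def)

lemma prefix_free_encode_list:
  assumes "prefix_free f"
  shows "prefix_free (encode_list f)"
proof -
  have "a = b \<and> r = s" if "encode_list f a @ r = encode_list f b @ s" for a b r s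
    using that
  proof (induction a arbitrary: b)
    case Nil
    then show ?case by (cases b) (auto simp: encode_list_def)
  next
    case (Cons x a)
    then obtain y b' where b: "b = y # b'"
      by (cases b) (auto simp: encode_list_def)
    from Cons.prems b have "f x @ (encode_list f a @ r) = f y @ (encode_list f b' @ s)"
      by (simp add: encode_list_def)
    from prefix_freeD[OF assms this] have "x = y" "encode_list f a @ r = encode_list f b' @ s"
      by auto
    with Cons.IH b show ?case by auto
  qed
  then show ?thesis by (auto simp: prefix_free_def)
qed

lemma prefix_free_encode_pair:
  assumes "prefix_free f" and "prefix_free g"
  shows "prefix_free (encode_pair f g)"
proof -
  have "a = b \<and> r = s" if "encode_pair f g a @ r = encode_pair f g b @ s" for a b r s
  proof -
    from that have "f (fst a) @ (g (snd a) @ r) = f (fst b) @ (g (snd b) @ s)"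
      by (simp add: encode_pair_def)
    from prefix_freeD[OF assms(1) this]
    have "fst a = fst b" "g (snd a) @ r = g (snd b) @ s" by auto
    with prefix_freeD[OF assms(2) this(2)] show ?thesis by (simp add: prod_eq_iff)
  qed
  then show ?thesis by (auto simp: prefix_free_def)
qed

lemma binary_eq_Nil_iff: "binary n = [] \<longleftrightarrow> n = 0"
  by (subst binary.simps) simp

lemma binary_Cons: "n \<noteq> 0 \<Longrightarrow> binary n = odd n # binary (n div 2)"
  by (subst binary.simps) simp

lemma binary_inj: "binary m = binary n \<Longrightarrow> m = n"
proof (induction m arbitrary: n rule: less_induct)
  case (less m)
  show ?case
  proof (cases "m = 0 \<or> n = 0")
    case True
    then show ?thesis using less.prems binary_eq_Nil_iff by metis
  next
    case False
    then have eq: "odd m = odd n" "binary (m div 2) = binary (n div 2)"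
      using less.prems by (simp_all add: binary_Cons)
    from False have "m div 2 < m" by simp
    from less.IH[OF this eq(2)] eq(1) show ?thesis by presburger
  qed
qed

lemma prefix_free_encode_nat: "prefix_free encode_nat"
proof -
  have list: "prefix_free (encode_list (\<lambda>b. [b]))"
    by (rule prefix_free_encode_list) (simp add: prefix_free_def)
  have "m = n \<and> r = s" if "encode_nat m @ r = encode_nat n @ s" for m n r s
    using prefix_freeD[OF list that[unfolded encode_nat_def]] binary_inj by blast
  then show ?thesis unfolding prefix_free_def by blast
qed

lemma ld_encode_inject: "ld_encode I = ld_encode J \<longleftrightarrow> I = J"
proof
  note nat = prefix_free_encode_nat
  note pair = prefix_free_encode_pair[OF nat nat]
  note edges = prefix_free_encode_list[OF prefix_free_encode_pair[OF pair pair]]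
  note list = prefix_free_encode_list[OF nat]
  assume eq: "ld_encode I = ld_encode J"
  note 1 = prefix_freeD[OF nat eq[unfolded ld_encode_def]]
  note 2 = prefix_freeD[OF edges conjunct2[OF 1]]
  note 3 = prefix_freeD[OF list conjunct2[OF 2]]
  note 4 = prefix_freeD[OF pair conjunct2[OF 3]]
  note 5 = prefix_freeD[OF list conjunct2[OF 4]]
  have "encode_nat (ld_budget I) @ [] = encode_nat (ld_budget J) @ []"
    by (simp only: conjunct2[OF 5])
  note 6 = prefix_freeD[OF nat this]
  have more: "leader_data.more I = leader_data.more J" by simp
  show "I = J"
    by (rule leader_data.equality)
      (simp_all only: conjunct1[OF 1] conjunct1[OF 2] conjunct1[OF 3] conjunct1[OF 4]
        conjunct1[OF 5] conjunct1[OF 6] more)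
qed simp

end

theory Submission
  imports Defs
begin

text \<open>
  A run of a verifier is a tiling of a rectangle with a fixed finite set of tiles, and the input
  only enters through the labels on the lower border. The tiles at all positions, written as
  numbers whose digits count the labels on the edges, turn the existence of a tiling into a subset
  sum problem. Each number becomes a candidate with its own follower, whose opinion is the scaled
  number if the candidate is chosen and 0 otherwise. All followers lie between the leaders and the
  candidates only, so the average opinion is a scaled subset sum.

  An oracle for the search problem returns an optimal set but not its value. So one more tile, which
  is allowed at the first position only, gives up on the verifier: it makes a tiling always
  available, and its number is raised by 1. An optimal set then contains this item iff there is
  no accepting run, and a single bit of one answer decides membership.

  The Turing machine that writes the instance is compiled from a small language of output
  generators with loops over polynomially bounded counters.
\<close>


section \<open>Structured counter programs on Turing machines\<close>

text \<open>All quantities are arranged so that writing the instance needs no arithmetic. The tiles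
  depend on the verifier alone, hence they are finitely many constants of the program; the input
  only decides how often a constant digit group is repeated and which constants form the lower
  border. The base is a power of two, so large that even choosing every tile at every cell causes no
  carry. A number is then a concatenation of fixed-width words. All followers need the same
  out-degree, or else their opinions would have different denominators. The padding weight that
  achieves this is, up to its top bits, the bitwise complement of the number. With \<open>M\<close>
  digit groups in base \<open>Q\<close>, every weight starts with a leading \<open>Q ^ M\<close>,
  the common degree is \<open>4 * Q ^ M\<close>, and a chosen item contributes
  \<open>5 * Q ^ M\<close> plus its number, because the chosen candidate itself has opinion 1.
  Raising one number by 1 is detectable because all other numbers and the target are even: placement
  digits are 2 rather than 1. The budget equals the number of candidates, so cardinality never
  interferes.\<close>

datatype prog =
    Skip
  | Inc nat
  | Dec nat
  | Put bool
  | Seq prog prog (infixr \<open>;;\<close> 60)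
  | While nat "nat \<Rightarrow> bool" prog
  | Cond nat "nat \<Rightarrow> bool" prog prog

definition input_symbol :: "bool list \<Rightarrow> nat \<Rightarrow> nat" where
  "input_symbol x i = (if i < length x then if x ! i then 2 else 1 else 0)"

definition scan :: "bool list \<Rightarrow> (nat \<Rightarrow> nat) \<Rightarrow> nat \<Rightarrow> nat" where
  "scan x h r = (if r = 0 then input_symbol x (h 0) else 0) + (if h r = 0 then 3 else 0)"

text \<open>
  A counter is the head position on a tape whose cell 0 is marked by adding 3 to its symbol.
  Register 0 is the head on the input tape. Tape 1 is the output tape and holds no counter.
\<close>

inductive exec :: "nat \<Rightarrow> bool list \<Rightarrow> prog \<Rightarrow> nat \<Rightarrow> (nat \<Rightarrow> nat) \<times> bool list \<Rightarrow>
    (nat \<Rightarrow> nat) \<times> bool list \<Rightarrow> bool" for K x where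
  exec_Skip: "exec K x Skip 0 s s"
| exec_Inc: "r < K \<Longrightarrow> r \<noteq> 1 \<Longrightarrow> exec K x (Inc r) 1 (h, out) (h(r := Suc (h r)), out)"
| exec_Dec: "r < K \<Longrightarrow> r \<noteq> 1 \<Longrightarrow> h r > 0 \<Longrightarrow> exec K x (Dec r) 1 (h, out) (h(r := h r - 1), out)"
| exec_Put: "exec K x (Put b) 1 (h, out) (h, out @ [b])"
| exec_Seq: "exec K x p t s s' \<Longrightarrow> exec K x q t' s' s'' \<Longrightarrow> exec K x (p ;; q) (t + t') s s''"
| exec_While_False: "r < K \<Longrightarrow> r \<noteq> 1 \<Longrightarrow> \<not> A (scan x (fst s) r) \<Longrightarrow> exec K x (While r A p) 1 s s"
| exec_While_True: "r < K \<Longrightarrow> r \<noteq> 1 \<Longrightarrow> A (scan x (fst s) r) \<Longrightarrow> exec K x p t s s' \<Longrightarrow>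
    exec K x (While r A p) t' s' s'' \<Longrightarrow> exec K x (While r A p) (1 + t + 1 + t') s s''"
| exec_Cond_True: "r < K \<Longrightarrow> r \<noteq> 1 \<Longrightarrow> A (scan x (fst s) r) \<Longrightarrow> exec K x p t s s' \<Longrightarrow>
    exec K x (Cond r A p q) (1 + t + 1) s s'"
| exec_Cond_False: "r < K \<Longrightarrow> r \<noteq> 1 \<Longrightarrow> \<not> A (scan x (fst s) r) \<Longrightarrow> exec K x q t s s' \<Longrightarrow>
    exec K x (Cond r A p q) (1 + t) s s'"

section \<open>Jump code and the machine that runs it\<close>

datatype instr = IMove nat move | IPut bool | IBranch nat "nat \<Rightarrow> bool" nat

fun code_size :: "prog \<Rightarrow> nat" where
  "code_size Skip = 0"
| "code_size (Inc r) = 1"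
| "code_size (Dec r) = 1"
| "code_size (Put b) = 1"
| "code_size (p ;; q) = code_size p + code_size q"
| "code_size (While r A p) = code_size p + 2"
| "code_size (Cond r A p q) = code_size p + code_size q + 2"

text \<open>The number \<open>s\<close> is the address of the first instruction.
  \<open>IBranch\<close> falls through when its test succeeds and jumps otherwise, so a constantly
  false test is an unconditional jump.\<close>

fun code :: "nat \<Rightarrow> prog \<Rightarrow> instr list" where
  "code s Skip = []"
| "code s (Inc r) = [IMove r Move_Right]"
| "code s (Dec r) = [IMove r Move_Left]"
| "code s (Put b) = [IPut b]"
| "code s (p ;; q) = code s p @ code (s + code_size p) q"
| "code s (While r A p) =
     IBranch r A (s + code_size p + 2) # code (s + 1) p @ [IBranch 0 (\<lambda>_. False) s]"
| "code s (Cond r A p q) =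
     IBranch r A (s + code_size p + 2) # code (s + 1) p @
     [IBranch 0 (\<lambda>_. False) (s + code_size p + code_size q + 2)] @ code (s + code_size p + 2) q"

lemma length_code [simp]: "length (code s p) = code_size p"
  by (induction p arbitrary: s) auto

definition bit_symbol :: "bool \<Rightarrow> nat" where
  "bit_symbol b = (if b then 2 else 1)"

text \<open>Capping a jump target at \<open>n\<close> keeps the state in range for arbitrary code,
  so \<open>query_machine_wf\<close> needs no hypothesis on \<open>c\<close>.\<close>

fun instr_delta :: "nat \<Rightarrow> nat \<Rightarrow> nat \<Rightarrow> instr \<Rightarrow> nat list \<Rightarrow> nat \<times> (nat \<times> move) list" where
  "instr_delta K n q (IMove r d) ss = (Suc q, map (\<lambda>i. (ss ! i, if i = r then d else Stay)) [0..<K])"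
| "instr_delta K n q (IPut b) ss =
     (Suc q, map (\<lambda>i. if i = 1 then (bit_symbol b, Move_Right) else (ss ! i, Stay)) [0..<K])"
| "instr_delta K n q (IBranch r A a) ss =
     (if A (ss ! r) then Suc q else Suc (min a n), map (\<lambda>i. (ss ! i, Stay)) [0..<K])"

text \<open>
  State 0 marks the zero cells, state \<open>Suc i\<close> executes instruction \<open>i\<close>, state \<open>n + 1\<close> queries.
  The states \<open>n + 2\<close>, \<open>n + 3\<close>, \<open>n + 4\<close> inspect bit 2 of the answer and accept iff it is \<open>False\<close>.
\<close>

definition query_machine :: "nat \<Rightarrow> instr list \<Rightarrow> oracle_tm" where
  "query_machine K c = (let n = length c in
     \<lparr>tm_tapes = K, tm_symbols = 6, tm_states = n + 7, tm_start = 0,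
      tm_accept = n + 5, tm_reject = n + 6,
      tm_delta = (\<lambda>q ss.
        if q = 0 then (1, map (\<lambda>i. (if i = 1 then ss ! i else ss ! i mod 3 + 3, Stay)) [0..<K])
        else if q \<le> n then instr_delta K n q (c ! (q - 1)) ss
        else if q = n + 2 \<or> q = n + 3
          then (Suc q, map (\<lambda>i. (ss ! i, if i = 1 then Move_Right else Stay)) [0..<K])
        else (if ss ! 1 = 1 then n + 5 else n + 6, map (\<lambda>i. (ss ! i, Stay)) [0..<K])),
      tm_query = n + 1, tm_response = n + 2\<rparr>)"

lemma query_machine_wf:
  assumes "2 \<le> K"
  shows "oracle_tm_wf (query_machine K c)"
proof -
  have *: "q' < length c + 7 \<and> length as = K \<and> fst ` set as \<subseteq> {..<6}"
    if "q < length c + 7" "length ss = K" "set ss \<subseteq> {..<6}"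
      and d: "tm_delta (query_machine K c) q ss = (q', as)" for q ss q' as
  proof -
    have s6: "ss ! i < 6" if "i < K" for i
      using that \<open>length ss = K\<close> \<open>set ss \<subseteq> {..<6}\<close> by (metis lessThan_iff nth_mem subsetD)
    have m6: "m mod 3 + 3 < (6::nat)" for m
      by simp
    have "c ! (q - 1) = i \<Longrightarrow> instr_delta K (length c) q i ss = (q', as) \<Longrightarrow> q \<le> length c \<Longrightarrow>
      ?thesis" for i
      using s6 by (cases i) (auto simp: bit_symbol_def split: if_splits)
    then show ?thesis
      using d that(1) s6 m6 by (auto simp: query_machine_def Let_def split: if_splits)
  qed
  show ?thesis
    unfolding oracle_tm_wf_def tm_wf_def
    using assms * by (auto simp: query_machine_def Let_def)
qed

section \<open>Simulation of counter programs on tapes\<close>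

definition bits_tape :: "bool list \<Rightarrow> int \<Rightarrow> nat" where
  "bits_tape y = fst (string_tape y)"

definition machine_tapes :: "nat \<Rightarrow> bool list \<Rightarrow> (nat \<Rightarrow> nat) \<times> bool list \<Rightarrow> tape list" where
  "machine_tapes K x s = map (\<lambda>i.
     if i = 0 then ((bits_tape x)(0 := bits_tape x 0 + 3), int (fst s 0))
     else if i = 1 then (bits_tape (snd s), int (length (snd s)))
     else ((\<lambda>_. 0)(0 := 3), int (fst s i))) [0..<K]"

lemma length_machine_tapes [simp]: "length (machine_tapes K x s) = K"
  by (simp add: machine_tapes_def)

lemma bits_tape_nat: "bits_tape y (int i) = input_symbol y i"
  by (auto simp: bits_tape_def string_tape_def input_symbol_def)

lemma bits_tape_append: "(bits_tape y)(int (length y) := bit_symbol b) = bits_tape (y @ [b])"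
  by (auto simp: bits_tape_def string_tape_def bit_symbol_def fun_eq_iff nth_append nat_less_iff
      split: if_splits)

lemma tape_read_machine_tapes:
  assumes "r < K" "r \<noteq> 1"
  shows "tape_read (machine_tapes K x s ! r) = scan x (fst s) r"
  using assms bits_tape_nat[of x 0]
  by (auto simp: machine_tapes_def scan_def bits_tape_nat)

lemma tape_action_same: "tape_action (tape_read t, Stay) t = t"
  by (cases t) auto

lemma map2_tape_action:
  assumes "length ts = K"
  shows "map2 tape_action (map f [0..<K]) ts = map (\<lambda>i. tape_action (f i) (ts ! i)) [0..<K]"
  using assms by (intro nth_equalityI) auto

lemma oracle_step_delta:
  assumes "tm_delta (query_machine K c) q (map tape_read ts) = (q', map f [0..<K])"
    and "length ts = K" and "q \<noteq> length c + 1" and "q < length c + 5"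
  shows "oracle_step Orc (query_machine K c) (q, ts) = (q', map (\<lambda>i. tape_action (f i) (ts ! i)) [0..<K])"
  using assms
  by (simp add: oracle_step_def tm_step_def halting_def map2_tape_action)
    (simp add: query_machine_def Let_def)

definition machine_config where
  "machine_config K x q s = (Suc q, machine_tapes K x s)"

lemma machine_tapes_nth [simp]:
  "i < K \<Longrightarrow> machine_tapes K x s ! i =
     (if i = 0 then ((bits_tape x)(0 := bits_tape x 0 + 3), int (fst s 0))
     else if i = 1 then (bits_tape (snd s), int (length (snd s)))
     else ((\<lambda>_. 0)(0 := 3), int (fst s i)))"
  by (simp add: machine_tapes_def)

lemma map_upt_eq_nth:
  "(\<And>i. i < K \<Longrightarrow> f i = xs ! i) \<Longrightarrow> length xs = K \<Longrightarrow> map f [0..<K] = xs"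
  by (auto intro: nth_equalityI)

lemma move_step:
  assumes q: "q < length c" "c ! q = IMove r d" and r: "r < K" "r \<noteq> 1"
    and h': "int h' = move_head d (int (h r))"
  shows "oracle_step Orc (query_machine K c) (machine_config K x q (h, out)) =
    machine_config K x (Suc q) (h(r := h'), out)"
proof -
  let ?ts = "machine_tapes K x (h, out)"
  have d: "tm_delta (query_machine K c) (Suc q) (map tape_read ?ts) =
    (Suc (Suc q), map (\<lambda>i. (tape_read (?ts ! i), if i = r then d else Stay)) [0..<K])"
    using q by (simp add: query_machine_def Let_def)
  have "tape_action (tape_read (?ts ! i), if i = r then d else Stay) (?ts ! i) =
    machine_tapes K x (h(r := h'), out) ! i" if "i < K" for i
    using that r h' by auto
  then have "map (\<lambda>i. tape_action (tape_read (?ts ! i), if i = r then d else Stay) (?ts ! i)) [0..<K] =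
    machine_tapes K x (h(r := h'), out)"
    by (rule map_upt_eq_nth) simp_all
  with oracle_step_delta[OF d, of Orc] show ?thesis
    using q by (simp add: machine_config_def)
qed

lemma put_step:
  assumes q: "q < length c" "c ! q = IPut b" and K: "2 \<le> K"
  shows "oracle_step Orc (query_machine K c) (machine_config K x q (h, out)) =
    machine_config K x (Suc q) (h, out @ [b])"
proof -
  let ?ts = "machine_tapes K x (h, out)"
  let ?f = "\<lambda>i. if i = 1 then (bit_symbol b, Move_Right) else (tape_read (?ts ! i), Stay)"
  have d: "tm_delta (query_machine K c) (Suc q) (map tape_read ?ts) =
    (Suc (Suc q), map ?f [0..<K])"
    using q by (simp add: query_machine_def Let_def)
  have "tape_action (?f i) (?ts ! i) = machine_tapes K x (h, out @ [b]) ! i" if "i < K" for i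
    using that K by (auto simp: bits_tape_append)
  then have "map (\<lambda>i. tape_action (?f i) (?ts ! i)) [0..<K] = machine_tapes K x (h, out @ [b])"
    by (rule map_upt_eq_nth) simp_all
  with oracle_step_delta[OF d, of Orc] show ?thesis
    using q by (simp add: machine_config_def)
qed

lemma branch_step:
  assumes q: "q < length c" "c ! q = IBranch r A a" and r: "r < K" and a: "a \<le> length c"
    and B: "A (tape_read (machine_tapes K x s ! r)) \<longleftrightarrow> B"
  shows "oracle_step Orc (query_machine K c) (machine_config K x q s) =
    machine_config K x (if B then Suc q else a) s"
proof -
  let ?ts = "machine_tapes K x s"
  have "map tape_read ?ts ! r = tape_read (?ts ! r)"
    using r by (simp del: machine_tapes_nth)
  then have d: "tm_delta (query_machine K c) (Suc q) (map tape_read ?ts) =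
    (Suc (if B then Suc q else a), map (\<lambda>i. (tape_read (?ts ! i), Stay)) [0..<K])"
    using q a B by (auto simp: query_machine_def Let_def min_def simp del: machine_tapes_nth)
  have "map (\<lambda>i. tape_action (tape_read (?ts ! i), Stay) (?ts ! i)) [0..<K] = ?ts"
    unfolding tape_action_same by (intro nth_equalityI) auto
  with oracle_step_delta[OF d, of Orc] show ?thesis
    using q by (simp add: machine_config_def)
qed

definition located :: "instr list \<Rightarrow> nat \<Rightarrow> instr list \<Rightarrow> bool" where
  "located c s l \<longleftrightarrow> s + length l \<le> length c \<and> (\<forall>i<length l. c ! (s + i) = l ! i)"

lemma located_append:
  "located c s (l @ l') \<longleftrightarrow> located c s l \<and> located c (s + length l) l'"
proof
  assume L: "located c s (l @ l')"
  then have *: "c ! (s + i) = (l @ l') ! i" if "i < length l + length l'" for i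
    using that by (simp add: located_def)
  have "c ! (s + i) = l ! i" if "i < length l" for i
    using *[of i] that by (simp add: nth_append)
  moreover have "c ! (s + length l + i) = l' ! i" if "i < length l'" for i
    using *[of "length l + i"] that by (simp add: nth_append add.assoc)
  ultimately show "located c s l \<and> located c (s + length l) l'"
    using L by (auto simp: located_def)
next
  assume L: "located c s l \<and> located c (s + length l) l'"
  have "c ! (s + i) = (l @ l') ! i" if i: "i < length l + length l'" for i
  proof (cases "i < length l")
    case False
    then have "i - length l < length l'" "s + length l + (i - length l) = s + i"
      using i by auto
    then have "c ! (s + i) = l' ! (i - length l)"
      using L unfolding located_def by metis
    then show ?thesis using False by (simp add: nth_append)
  qed (use L in \<open>auto simp: located_def nth_append\<close>)
  then show "located c s (l @ l')" using L by (auto simp: located_def)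
qed

lemma located_Cons: "located c s (a # l) \<longleftrightarrow> s < length c \<and> c ! s = a \<and> located c (Suc s) l"
  using located_append[of c s "[a]" l] by (auto simp: located_def)

text \<open>\<open>exec\<close> counts exactly the machine steps, including the tests and the jumps
  at the end of a loop body or of a first branch, so the simulation has no slack. Jump addresses are
  absolute, hence the code must sit at the address \<open>a\<close> for which it was
  generated.\<close>

lemma exec_code:
  assumes "exec K x p t s s'" "located c a (code a p)" "2 \<le> K"
  shows "(oracle_step Orc (query_machine K c) ^^ t) (machine_config K x a s) =
    machine_config K x (a + code_size p) s'"
  using assms
proof (induction arbitrary: a)
  case (exec_Seq p t s s' q t' s'')
  then have "located c a (code a p)" "located c (a + code_size p) (code (a + code_size p) q)"
    by (auto simp: located_append)
  with exec_Seq show ?case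
    by (simp add: funpow_add add.commute[of t] add.assoc)
next
  case (exec_While_False r A s p)
  then have "a < length c" "c ! a = IBranch r A (a + code_size p + 2)" "a + code_size p + 2 \<le> length c"
    by (auto simp: located_Cons located_append)
  from branch_step[OF this(1,2) exec_While_False(1) this(3) refl, where x = x and s = s and Orc = Orc] exec_While_False show ?case
    by (simp add: tape_read_machine_tapes del: machine_tapes_nth)
next
  case (exec_While_True r A s p t s' t' s'')
  have L: "a < length c" "c ! a = IBranch r A (a + code_size p + 2)" "a + code_size p + 2 \<le> length c"
    "located c (Suc a) (code (Suc a) p)"
    "Suc (a + code_size p) < length c" "c ! Suc (a + code_size p) = IBranch 0 (\<lambda>_. False) a"
    using exec_While_True.prems(1) by (auto simp: located_Cons located_append)
  have 1: "oracle_step Orc (query_machine K c) (machine_config K x a s) = machine_config K x (Suc a) s"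
    using branch_step[OF L(1,2) exec_While_True.hyps(1) L(3) refl, where x = x and s = s and Orc = Orc] exec_While_True.hyps
    by (simp add: tape_read_machine_tapes del: machine_tapes_nth)
  have 2: "(oracle_step Orc (query_machine K c) ^^ t) (machine_config K x (Suc a) s) =
    machine_config K x (Suc (a + code_size p)) s'"
    using exec_While_True.IH(1)[OF L(4) \<open>2 \<le> K\<close>] by simp
  have 3: "oracle_step Orc (query_machine K c) (machine_config K x (Suc (a + code_size p)) s') =
    machine_config K x a s'"
    using branch_step[OF L(5,6), where K = K and x = x and s = s' and Orc = Orc and B = False] L(1) \<open>2 \<le> K\<close> by simp
  have 4: "(oracle_step Orc (query_machine K c) ^^ t') (machine_config K x a s') =
    machine_config K x (a + code_size (While r A p)) s''"
    using exec_While_True.IH(2) exec_While_True.prems by blast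
  have "1 + t + 1 + t' = t' + (1 + (t + 1))" by simp
  then show ?case
    using 1 2 3 4 by (simp only: funpow_add o_apply One_nat_def funpow.simps o_id)
next
  case (exec_Cond_True r A s p t s' q)
  have L: "a < length c" "c ! a = IBranch r A (a + code_size p + 2)" "a + code_size p + 2 \<le> length c"
    "located c (Suc a) (code (Suc a) p)"
    "Suc (a + code_size p) < length c"
    "c ! Suc (a + code_size p) = IBranch 0 (\<lambda>_. False) (a + code_size p + code_size q + 2)"
    "a + code_size p + code_size q + 2 \<le> length c"
    using exec_Cond_True.prems(1) by (auto simp: located_Cons located_append) (auto simp: located_def)
  have 1: "oracle_step Orc (query_machine K c) (machine_config K x a s) = machine_config K x (Suc a) s"
    using branch_step[OF L(1,2) exec_Cond_True.hyps(1) L(3) refl, where x = x and s = s and Orc = Orc] exec_Cond_True.hyps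
    by (simp add: tape_read_machine_tapes del: machine_tapes_nth)
  have 2: "(oracle_step Orc (query_machine K c) ^^ t) (machine_config K x (Suc a) s) =
    machine_config K x (Suc (a + code_size p)) s'"
    using exec_Cond_True.IH(1)[OF L(4) \<open>2 \<le> K\<close>] by simp
  have 3: "oracle_step Orc (query_machine K c) (machine_config K x (Suc (a + code_size p)) s') =
    machine_config K x (a + code_size p + code_size q + 2) s'"
    using branch_step[OF L(5,6), where K = K and x = x and s = s' and Orc = Orc and B = False] L(7) \<open>2 \<le> K\<close> by simp
  have "1 + t + 1 = 1 + (t + 1)" by simp
  then show ?case
    using 1 2 3 by (simp only: funpow_add o_apply One_nat_def funpow.simps o_id) (simp add: add.assoc)
next
  case (exec_Cond_False r A s q t s' p)
  have L: "a < length c" "c ! a = IBranch r A (a + code_size p + 2)" "a + code_size p + 2 \<le> length c"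
    "located c (a + code_size p + 2) (code (a + code_size p + 2) q)"
    using exec_Cond_False.prems(1) by (auto simp: located_Cons located_append)
  have 1: "oracle_step Orc (query_machine K c) (machine_config K x a s) =
      machine_config K x (a + code_size p + 2) s"
    using branch_step[OF L(1,2) exec_Cond_False.hyps(1) L(3) refl, where x = x and s = s and Orc = Orc] exec_Cond_False.hyps
    by (simp add: tape_read_machine_tapes del: machine_tapes_nth)
  have 2: "(oracle_step Orc (query_machine K c) ^^ t) (machine_config K x (a + code_size p + 2) s) =
    machine_config K x (a + code_size p + code_size q + 2) s'"
    using exec_Cond_False.IH(1)[OF L(4) \<open>2 \<le> K\<close>] by (simp add: ac_simps)
  have "1 + t = t + 1" by simp
  then show ?case
    using 1 2 by (simp only: funpow_add o_apply One_nat_def funpow.simps o_id) (simp add: ac_simps)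
next
  case (exec_Inc r h out)
  then show ?case using move_step[of a c r Move_Right K "Suc (h r)" h] by (auto simp: located_Cons)
next
  case (exec_Dec r h out)
  then show ?case using move_step[of a c r Move_Left K "h r - 1" h]
    by (auto simp: located_Cons of_nat_diff)
next
  case (exec_Put b h out)
  then show ?case using put_step[of a c b K] by (auto simp: located_Cons)
qed (simp add: machine_config_def)

lemma tape_string_bits: "tape_string (bits_tape y, i) = y"
proof -
  have "bits_tape y (int k) \<in> {1, 2} \<longleftrightarrow> k < length y" for k
    by (auto simp: bits_tape_nat input_symbol_def)
  then have "(LEAST k. bits_tape y (int k) \<notin> {1, 2}) = length y"
    by (intro Least_equality) (auto simp: not_le)
  then show ?thesis
    by (auto simp: tape_string_def bits_tape_nat input_symbol_def intro!: nth_equalityI)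
qed

lemma halted_oracle_step:
  assumes "q = n + 5 \<or> q = n + 6" and "n = length c"
  shows "(oracle_step Orc (query_machine K c) ^^ t) (q, ts) = (q, ts)"
proof (induction t)
  case (Suc t)
  have "oracle_step Orc (query_machine K c) (q, ts) = (q, ts)"
    using assms by (auto simp: oracle_step_def tm_step_def halting_def query_machine_def Let_def)
  with Suc show ?case by simp
qed simp

text \<open>The program itself never enters the query state, so its output \<open>y x\<close> is the
  same for every oracle, and a single query with a single inspected bit decides membership.\<close>

theorem query_program:
  fixes P :: "nat poly"
  assumes K: "3 \<le> K"
    and run: "\<And>x. \<exists>t h. t \<le> poly P (length x) \<and> exec K x p t ((\<lambda>_. 0), []) (h, y x)"
    and answer: "\<And>Orc x. solves Orc R \<Longrightarrow>
      2 < length (Orc (y x)) \<and> (Orc (y x) ! 2 \<longleftrightarrow> x \<notin> A)"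
  shows "poly_turing_reducible A R"
proof -
  define c where "c = code 0 p"
  define n where "n = length c"
  let ?M = "query_machine K c"
  have "oracle_state_after Orc ?M [x] (poly (P + [:5:]) (length x)) =
    (if x \<in> A then tm_accept ?M else tm_reject ?M)" if sol: "solves Orc R" for Orc x
  proof -
    define step where "step = oracle_step Orc ?M"
    obtain t h where t: "t \<le> poly P (length x)" and ex: "exec K x p t ((\<lambda>_. 0), []) (h, y x)"
      using run by blast
    define ts where "ts = map (\<lambda>i. string_tape (if i = 0 then x else [])) [0..<K]"
    have init: "initial_config ?M [x] = (0, ts)"
      by (auto simp: initial_config_def query_machine_def Let_def ts_def)
    define f where "f i = (if i = 1 then tape_read (ts ! i) else tape_read (ts ! i) mod 3 + 3, Stay)" for i :: nat
    have d: "tm_delta ?M 0 (map tape_read ts) = (1, map f [0..<K])"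
      by (simp add: query_machine_def Let_def f_def ts_def)
    have "tape_action (f i) (ts ! i) = machine_tapes K x ((\<lambda>_. 0), []) ! i" if "i < K" for i
    proof -
      have "bits_tape x 0 mod 3 = bits_tape x 0"
        by (simp add: bits_tape_def string_tape_def)
      then show ?thesis
        using that by (auto simp: f_def ts_def bits_tape_def string_tape_def fun_eq_iff)
    qed
    then have "map (\<lambda>i. tape_action (f i) (ts ! i)) [0..<K] = machine_tapes K x ((\<lambda>_. 0), [])"
      by (rule map_upt_eq_nth) simp_all
    with oracle_step_delta[OF d, of Orc] have s0:
      "step (initial_config ?M [x]) = machine_config K x 0 ((\<lambda>_. 0), [])"
      by (simp add: init ts_def machine_config_def step_def)
    have "located c 0 (code 0 p)"
      by (simp add: located_def c_def)
    from exec_code[OF ex this] K have s1: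
      "(step ^^ t) (machine_config K x 0 ((\<lambda>_. 0), [])) = machine_config K x n (h, y x)"
      by (simp add: n_def c_def step_def)
    define ans where "ans = Orc (y x)"
    define us where "us i = (machine_tapes K x (h, y x))[1 := (bits_tape ans, i)]" for i
    have s2: "step (machine_config K x n (h, y x)) = (n + 2, us 0)"
      using K by (simp add: step_def oracle_step_def machine_config_def query_machine_def Let_def n_def
          tape_string_bits us_def ans_def) (simp add: bits_tape_def string_tape_def)
    have move: "step (q, us i) = (Suc q, us (i + 1))" if "q = n + 2 \<or> q = n + 3" for q i
    proof -
      define g where "g k = (tape_read (us i ! k), if k = 1 then Move_Right else Stay)" for k :: nat
      have d: "tm_delta ?M q (map tape_read (us i)) = (Suc q, map g [0..<K])"
        using that by (auto simp: query_machine_def Let_def g_def n_def us_def)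
      have "tape_action (g k) (us i ! k) = us (i + 1) ! k" if "k < K" for k
        using that by (auto simp: g_def us_def nth_list_update)
      then have "map (\<lambda>k. tape_action (g k) (us i ! k)) [0..<K] = us (i + 1)"
        by (intro nth_equalityI) (auto simp: us_def)
      with oracle_step_delta[OF d, of Orc] that show ?thesis
        by (auto simp: n_def step_def us_def)
    qed
    have s5: "step (n + 4, us 2) = (if x \<in> A then n + 5 else n + 6, us 2)"
    proof -
      have "bits_tape ans 2 = (if x \<in> A then 1 else 2)"
        using answer[OF sol, of x] bits_tape_nat[of ans 2] by (simp add: input_symbol_def ans_def)
      then have d: "tm_delta ?M (n + 4) (map tape_read (us 2)) =
          (if x \<in> A then n + 5 else n + 6, map (\<lambda>k. (tape_read (us 2 ! k), Stay)) [0..<K])"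
        using K by (auto simp: query_machine_def Let_def n_def us_def)
      have "map (\<lambda>k. tape_action (tape_read (us 2 ! k), Stay) (us 2 ! k)) [0..<K] = us 2"
        unfolding tape_action_same by (intro nth_equalityI) (auto simp: us_def)
      with oracle_step_delta[OF d, of Orc] show ?thesis
        by (auto simp: n_def step_def us_def)
    qed
    \<comment> \<open>The five steps besides the program: marking the zero cells, the query, two
      moves to bit 2 of the answer, and the test of that bit.\<close>
    have "(step ^^ (t + 5)) (initial_config ?M [x]) =
      step (step (step (step ((step ^^ t) (step (initial_config ?M [x]))))))"
      by (simp add: funpow_swap1 numeral_eq_Suc)
    also have "\<dots> = (if x \<in> A then n + 5 else n + 6, us 2)"
      using move[of "n + 2" 0] move[of "n + 3" 1] s5 by (simp add: s0 s1 s2 eval_nat_numeral)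
    finally have fin: "(step ^^ (t + 5)) (initial_config ?M [x]) = (if x \<in> A then n + 5 else n + 6, us 2)" .
    \<comment> \<open>The state is read at one prescribed time, so shorter runs are padded with
      steps of the halted machine.\<close>
    have "poly (P + [:5:]) (length x) = (poly P (length x) - t) + (t + 5)"
      using t by simp
    then have "(step ^^ poly (P + [:5:]) (length x)) (initial_config ?M [x]) =
        (step ^^ (poly P (length x) - t)) (if x \<in> A then n + 5 else n + 6, us 2)"
      using fin by (simp only: funpow_add o_apply)
    also have "\<dots> = (if x \<in> A then n + 5 else n + 6, us 2)"
      unfolding step_def by (rule halted_oracle_step) (auto simp: n_def)
    finally show ?thesis
      by (simp add: oracle_state_after_def step_def query_machine_def Let_def n_def)
  qed
  moreover have "oracle_tm_wf ?M"
    using query_machine_wf K by simp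
  ultimately show ?thesis
    unfolding poly_turing_reducible_def by blast
qed


subsection \<open>Bounded execution of counter programs\<close>

definition runs :: "nat \<Rightarrow> bool list \<Rightarrow> prog \<Rightarrow> nat \<Rightarrow> (nat \<Rightarrow> nat) \<times> bool list \<Rightarrow>
    (nat \<Rightarrow> nat) \<times> bool list \<Rightarrow> bool" where
  "runs K x p B s s' \<longleftrightarrow> (\<exists>t\<le>B. exec K x p t s s')"

lemma runs_cong: "runs K x p B s s'' \<Longrightarrow> s'' = s' \<Longrightarrow> B \<le> B' \<Longrightarrow> runs K x p B' s s'"
  unfolding runs_def using le_trans by blast

lemma runs_Skip: "runs K x Skip 0 s s"
  unfolding runs_def using exec_Skip by blast

lemma runs_Inc: "r < K \<Longrightarrow> r \<noteq> 1 \<Longrightarrow> runs K x (Inc r) 1 (h, out) (h(r := Suc (h r)), out)"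
  unfolding runs_def using exec_Inc by blast

lemma runs_Dec: "r < K \<Longrightarrow> r \<noteq> 1 \<Longrightarrow> h r > 0 \<Longrightarrow> runs K x (Dec r) 1 (h, out) (h(r := h r - 1), out)"
  unfolding runs_def using exec_Dec by blast

lemma runs_Put: "runs K x (Put b) 1 (h, out) (h, out @ [b])"
  unfolding runs_def using exec_Put by blast

lemma runs_Seq:
  assumes "runs K x p B s s'" "runs K x q B' s' s''"
  shows "runs K x (p ;; q) (B + B') s s''"
  using assms exec_Seq add_mono unfolding runs_def by metis

lemma runs_Cond:
  assumes "r < K" "r \<noteq> 1"
    and "A (scan x (fst s) r) \<Longrightarrow> runs K x p B s s'"
    and "\<not> A (scan x (fst s) r) \<Longrightarrow> runs K x q B s s'"
  shows "runs K x (Cond r A p q) (B + 2) s s'"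
proof (cases "A (scan x (fst s) r)")
  case True
  with assms(3) obtain t where "t \<le> B" "exec K x p t s s'" by (auto simp: runs_def)
  with exec_Cond_True[of r K A x s p t s' q] assms(1,2) True show ?thesis
    unfolding runs_def by (intro exI[of _ "1 + t + 1"]) auto
next
  case False
  with assms(4) obtain t where "t \<le> B" "exec K x q t s s'" by (auto simp: runs_def)
  with exec_Cond_False[of r K A x s q t s' p] assms(1,2) False show ?thesis
    unfolding runs_def by (intro exI[of _ "1 + t"]) auto
qed

lemma runs_While_False:
  "r < K \<Longrightarrow> r \<noteq> 1 \<Longrightarrow> \<not> A (scan x (fst s) r) \<Longrightarrow> runs K x (While r A p) 1 s s"
  unfolding runs_def using exec_While_False by blast

lemma runs_While_True:
  assumes "r < K" "r \<noteq> 1" "A (scan x (fst s) r)"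
    and "runs K x p B s s'" "runs K x (While r A p) B' s' s''"
  shows "runs K x (While r A p) (B + B' + 2) s s''"
proof -
  from assms obtain t t' where "t \<le> B" "exec K x p t s s'" "t' \<le> B'" "exec K x (While r A p) t' s' s''"
    by (auto simp: runs_def)
  with exec_While_True[of r K A x s p t s' t' s''] assms(1-3) show ?thesis
    unfolding runs_def by (intro exI[of _ "1 + t + 1 + t'"]) auto
qed

text \<open>\<open>S i\<close> is the state before round \<open>i\<close>. A round costs the test
  and the jump back on top of the body; the final 1 is the failing test.\<close>

lemma runs_While:
  assumes "r < K" "r \<noteq> 1" "\<And>i. i < k \<Longrightarrow> A (scan x (fst (S i)) r)" "\<not> A (scan x (fst (S k)) r)"
    and "\<And>i. i < k \<Longrightarrow> runs K x p B (S i) (S (Suc i))"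
  shows "runs K x (While r A p) (k * (B + 2) + 1) (S 0) (S k)"
  using assms
proof (induction k arbitrary: S)
  case 0
  then show ?case using runs_While_False by simp
next
  case (Suc k)
  have "runs K x (While r A p) (k * (B + 2) + 1) (S (Suc 0)) (S (Suc k))"
    using Suc.IH[of "\<lambda>i. S (Suc i)"] Suc.prems by simp
  from runs_While_True[OF Suc.prems(1,2) Suc.prems(3)[of 0] Suc.prems(5)[of 0] this] show ?case
    by (simp add: algebra_simps)
qed

text \<open>Symbols from 3 on mark cell 0, so a smaller symbol means that the head has left it and
  the counter is positive.\<close>

definition nz :: "nat \<Rightarrow> bool" where
  "nz s \<longleftrightarrow> s < 3"

lemma input_symbol_less: "input_symbol x i < 3"
  by (simp add: input_symbol_def)

lemma nz_scan [simp]: "nz (scan x h r) \<longleftrightarrow> h r \<noteq> 0"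
  using input_symbol_less[of x "h 0"] by (auto simp: nz_def scan_def)

lemma scan_0_mod: "scan x h 0 mod 3 = input_symbol x (h 0)"
  using input_symbol_less[of x "h 0"] by (auto simp: scan_def)

definition zero :: "nat \<Rightarrow> prog" where
  "zero r = While r nz (Dec r)"

definition transfer :: "nat \<Rightarrow> nat \<Rightarrow> prog" where
  "transfer a b = While a nz (Dec a ;; Inc b)"

text \<open>A counter can only be read by counting it down, so its value goes to \<open>b\<close>
  and to the scratch counter \<open>c\<close>, and back from \<open>c\<close> to
  \<open>a\<close>.\<close>

definition copy :: "nat \<Rightarrow> nat \<Rightarrow> nat \<Rightarrow> prog" where
  "copy a b c = While a nz (Dec a ;; Inc b ;; Inc c) ;; transfer c a"

lemma runs_zero:
  assumes "r < K" "r \<noteq> 1"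
  shows "runs K x (zero r) (3 * h r + 1) (h, out) (h(r := 0), out)"
proof -
  let ?S = "\<lambda>i. (h(r := h r - i), out)"
  have "runs K x (zero r) (h r * (1 + 2) + 1) (?S 0) (?S (h r))"
    unfolding zero_def
  proof (rule runs_While[where S = ?S])
    fix i assume "i < h r"
    with runs_Dec[OF assms, of "h(r := h r - i)" x out]
    show "runs K x (Dec r) 1 (?S i) (?S (Suc i))" by simp
  qed (use assms in auto)
  moreover have "h r * (1 + 2) + 1 = 3 * h r + 1" by simp
  ultimately show ?thesis by (simp only: diff_zero diff_self_eq_0 fun_upd_triv)
qed

lemma runs_transfer:
  assumes "a < K" "a \<noteq> 1" "b < K" "b \<noteq> 1" "a \<noteq> b"
  shows "runs K x (transfer a b) (4 * h a + 1) (h, out) (h(a := 0, b := h b + h a), out)"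
proof -
  let ?S = "\<lambda>i. (h(a := h a - i, b := h b + i), out)"
  have "runs K x (transfer a b) (h a * (2 + 2) + 1) (?S 0) (?S (h a))"
    unfolding transfer_def
  proof (rule runs_While[where S = ?S])
    fix i assume "i < h a"
    show "runs K x (Dec a ;; Inc b) 2 (?S i) (?S (Suc i))"
      by (rule runs_cong[OF runs_Seq[OF runs_Dec runs_Inc]])
        (use assms \<open>i < h a\<close> in \<open>auto simp: fun_eq_iff\<close>)
  qed (use assms in auto)
  then show ?thesis by (simp add: mult.commute)
qed

lemma runs_copy:
  assumes "a < K" "a \<noteq> 1" "b < K" "b \<noteq> 1" "c < K" "c \<noteq> 1" "a \<noteq> b" "a \<noteq> c" "b \<noteq> c" and "h c = 0"
  shows "runs K x (copy a b c) (9 * h a + 2) (h, out) (h(b := h b + h a), out)"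
proof -
  let ?S = "\<lambda>i. (h(a := h a - i, b := h b + i, c := i), out)"
  have 1: "runs K x (While a nz (Dec a ;; Inc b ;; Inc c)) (h a * (3 + 2) + 1) (?S 0) (?S (h a))"
  proof (rule runs_While[where S = ?S])
    fix i assume "i < h a"
    show "runs K x (Dec a ;; Inc b ;; Inc c) 3 (?S i) (?S (Suc i))"
      by (rule runs_cong[OF runs_Seq[OF runs_Dec runs_Seq[OF runs_Inc runs_Inc]]])
        (use assms \<open>i < h a\<close> in \<open>auto simp: fun_eq_iff\<close>)
  qed (use assms in auto)
  have S0: "?S 0 = (h, out)"
    using assms by (auto simp: fun_eq_iff)
  show ?thesis
    unfolding copy_def
    by (rule runs_cong[OF runs_Seq[OF 1[unfolded S0] runs_transfer]])
      (use assms in \<open>auto simp: fun_eq_iff\<close>)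
qed


subsection \<open>Output generators\<close>

text \<open>
  A generator writes a bit string. Variables are numbered by binding depth: \<open>For\<close> binds the loop
  index and the number of remaining iterations, \<open>Bind\<close> binds the length of the string that its
  first argument generates.
\<close>

datatype gen =
    Emit "bool list"
  | Then gen gen (infixr \<open>\<triangleright>\<close> 60)
  | For nat gen
  | Bind gen gen
  | Bin nat
  | IfSymbol nat gen gen gen
  | EmitInput
  | IfZero nat gen gen

text \<open>This is \<open>encode_nat\<close> without the closing \<open>False\<close>, so that
  constant low bits can be written in front of the digits of a counter.\<close>

definition binary_items :: "nat \<Rightarrow> bool list" where
  "binary_items n = concat (map (\<lambda>b. [True, b]) (binary n))"

fun sem :: "bool list \<Rightarrow> nat \<Rightarrow> gen \<Rightarrow> (nat \<Rightarrow> nat) \<Rightarrow> bool list" where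
  "sem x d (Emit bs) E = bs"
| "sem x d (g1 \<triangleright> g2) E = sem x d g1 E @ sem x d g2 E"
| "sem x d (For b g) E =
     concat (map (\<lambda>i. sem x (Suc (Suc d)) g (E(d := i, Suc d := E b - Suc i))) [0..<E b])"
| "sem x d (Bind g1 g2) E = sem x (Suc d) g2 (E(d := length (sem x (Suc d) g1 E)))"
| "sem x d (Bin b) E = binary_items (E b)"
| "sem x d (IfSymbol b g0 g1 g2) E =
     (if input_symbol x (E b) = 0 then sem x d g0 E
      else if input_symbol x (E b) = 1 then sem x d g1 E else sem x d g2 E)"
| "sem x d EmitInput E = replicate (length x) True"
| "sem x d (IfZero b g1 g2) E = (if E b = 0 then sem x d g1 E else sem x d g2 E)"

fun scoped :: "nat \<Rightarrow> gen \<Rightarrow> bool" where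
  "scoped d (Emit bs) = True"
| "scoped d (g1 \<triangleright> g2) = (scoped d g1 \<and> scoped d g2)"
| "scoped d (For b g) = (b < d \<and> scoped (Suc (Suc d)) g)"
| "scoped d (Bind g1 g2) = (scoped (Suc d) g1 \<and> scoped (Suc d) g2)"
| "scoped d (Bin b) = (b < d)"
| "scoped d (IfSymbol b g0 g1 g2) = (b < d \<and> scoped d g0 \<and> scoped d g1 \<and> scoped d g2)"
| "scoped d EmitInput = True"
| "scoped d (IfZero b g1 g2) = (b < d \<and> scoped d g1 \<and> scoped d g2)"

text \<open>
  Variable \<open>l\<close> lives in register \<open>2 l + 2\<close>. Output goes to channel \<open>c\<close>: channel 0 is the output
  tape, a channel \<open>c > 0\<close> only counts the bits in register \<open>2 c + 1\<close>.
\<close>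

definition emit1 :: "nat \<Rightarrow> bool \<Rightarrow> prog" where
  "emit1 c b = (if c = 0 then Put b else Inc (2 * c + 1))"

definition halve :: "nat \<Rightarrow> nat \<Rightarrow> nat \<Rightarrow> prog" where
  "halve a b c = While a nz (Dec a ;; Cond a nz (Dec a ;; Inc b) (Inc c))"

definition emit_binary :: "nat \<Rightarrow> nat \<Rightarrow> nat \<Rightarrow> nat \<Rightarrow> prog" where
  "emit_binary ch a b c = While a nz
     (halve a b c ;; emit1 ch True ;; Cond c nz (Dec c ;; emit1 ch True) (emit1 ch False) ;; transfer b a)"

text \<open>\<open>Bind\<close> runs its first argument on the fresh channel \<open>Suc d\<close>,
  whose counter is register \<open>2 * d + 3\<close>, and moves the count into the register of the
  new variable. In \<open>For\<close>, the variable for the remaining iterations is the loop's own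
  down-counter. \<open>IfSymbol\<close> moves the input head to the inspected position and back;
  \<open>mod 3\<close> removes the mark of cell 0. All scratch registers are 0 again at the
  end.\<close>

fun compile :: "nat \<Rightarrow> gen \<Rightarrow> nat \<Rightarrow> prog" where
  "compile d (Emit bs) ch = foldr (\<lambda>b p. emit1 ch b ;; p) bs Skip"
| "compile d (g1 \<triangleright> g2) ch = compile d g1 ch ;; compile d g2 ch"
| "compile d (For b g) ch =
     copy (2 * b + 2) (2 * d + 4) (2 * d + 6) ;;
     While (2 * d + 4) nz (Dec (2 * d + 4) ;; compile (Suc (Suc d)) g ch ;; Inc (2 * d + 2)) ;;
     zero (2 * d + 2)"
| "compile d (Bind g1 g2) ch =
     compile (Suc d) g1 (Suc d) ;; transfer (2 * d + 3) (2 * d + 2) ;;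
     compile (Suc d) g2 ch ;; zero (2 * d + 2)"
| "compile d (Bin b) ch =
     copy (2 * b + 2) (2 * d + 2) (2 * d + 8) ;; emit_binary ch (2 * d + 2) (2 * d + 4) (2 * d + 6)"
| "compile d (IfSymbol b g0 g1 g2) ch =
     copy (2 * b + 2) 0 (2 * d + 2) ;;
     Cond 0 (\<lambda>s. s mod 3 = 0) (zero 0 ;; compile d g0 ch)
       (Cond 0 (\<lambda>s. s mod 3 = 1) (zero 0 ;; compile d g1 ch) (zero 0 ;; compile d g2 ch))"
| "compile d EmitInput ch = While 0 (\<lambda>s. s mod 3 \<noteq> 0) (Inc 0 ;; emit1 ch True) ;; zero 0"
| "compile d (IfZero b g1 g2) ch = Cond (2 * b + 2) nz (compile d g2 ch) (compile d g1 ch)"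

definition emit_regs :: "nat \<Rightarrow> bool list \<Rightarrow> (nat \<Rightarrow> nat) \<Rightarrow> nat \<Rightarrow> nat" where
  "emit_regs c bs h = (if c = 0 then h else h(2 * c + 1 := h (2 * c + 1) + length bs))"

definition emit_out :: "nat \<Rightarrow> bool list \<Rightarrow> bool list \<Rightarrow> bool list" where
  "emit_out c bs out = (if c = 0 then out @ bs else out)"

definition emit :: "nat \<Rightarrow> bool list \<Rightarrow> (nat \<Rightarrow> nat) \<times> bool list \<Rightarrow> (nat \<Rightarrow> nat) \<times> bool list" where
  "emit c bs s = (emit_regs c bs (fst s), emit_out c bs (snd s))"

lemma emit_Nil [simp]: "emit c [] s = s"
  by (simp add: emit_def emit_regs_def emit_out_def)

lemma emit_append: "emit c bs' (emit c bs s) = emit c (bs @ bs') s"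
  by (auto simp: emit_def emit_regs_def emit_out_def fun_eq_iff)

lemma emit_regs_other: "r \<noteq> 2 * c + 1 \<Longrightarrow> emit_regs c bs h r = h r"
  by (simp add: emit_regs_def)

lemma emit_regs_even [simp]: "even r \<Longrightarrow> emit_regs c bs h r = h r"
  by (rule emit_regs_other) auto

lemma emit_regs_upd: "r \<noteq> 2 * c + 1 \<Longrightarrow> emit_regs c bs (h(r := v)) = (emit_regs c bs h)(r := v)"
  by (auto simp: emit_regs_def fun_eq_iff)

lemma runs_emit1: "2 * c + 1 < K \<Longrightarrow> runs K x (emit1 c b) 1 s (emit c [b] s)"
  using runs_Inc[of "2 * c + 1" K x "fst s" "snd s"] runs_Put[of K x b "fst s" "snd s"]
  by (cases s) (auto simp: emit1_def emit_def emit_regs_def emit_out_def)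

lemma runs_emits:
  "2 * c + 1 < K \<Longrightarrow> runs K x (foldr (\<lambda>b p. emit1 c b ;; p) bs Skip) (length bs) s (emit c bs s)"
proof (induction bs arbitrary: s)
  case (Cons b bs)
  have "runs K x (emit1 c b ;; foldr (\<lambda>b p. emit1 c b ;; p) bs Skip) (1 + length bs) s
     (emit c bs (emit c [b] s))"
    by (rule runs_Seq[OF runs_emit1 Cons.IH]) (use Cons.prems in auto)
  then show ?case by (simp add: emit_append)
qed (simp add: runs_Skip)

lemma runs_halve:
  assumes "a < K" "a \<noteq> 1" "b < K" "b \<noteq> 1" "c < K" "c \<noteq> 1" "a \<noteq> b" "a \<noteq> c" "b \<noteq> c"
    and "h b = 0" "h c = 0"
  shows "runs K x (halve a b c) (7 * h a + 8) (h, out)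
    (h(a := 0, b := h a div 2, c := h a mod 2), out)"
proof -
  define n where "n = h a"
  \<comment> \<open>An odd \<open>n\<close> needs one more round, which finds a single unit left and
    puts it into \<open>c\<close>.\<close>
  let ?k = "(n + 1) div 2"
  let ?S = "\<lambda>i. (h(a := n - 2 * i, b := min i (n div 2), c := (if 2 * i > n then 1 else 0)), out)"
  have "runs K x (halve a b c) (?k * (5 + 2) + 1) (?S 0) (?S ?k)"
    unfolding halve_def
  proof (rule runs_While[where S = ?S])
    fix i assume i: "i < ?k"
    have n0: "n - 2 * i \<noteq> 0" using i by auto
    let ?T = "(h(a := n - 2 * i - 1, b := min i (n div 2), c := (if 2 * i > n then 1 else 0)), out)"
    have 1: "runs K x (Dec a) 1 (?S i) ?T"
      by (rule runs_cong[OF runs_Dec]) (use assms n0 in \<open>auto simp: fun_eq_iff\<close>)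
    have 2: "runs K x (Cond a nz (Dec a ;; Inc b) (Inc c)) (2 + 2) ?T (?S (Suc i))"
    proof (rule runs_Cond)
      assume "nz (scan x (fst ?T) a)"
      then have "n - 2 * i - 1 \<noteq> 0" "i < n div 2" using assms by auto
      then show "runs K x (Dec a ;; Inc b) 2 ?T (?S (Suc i))"
        by (intro runs_cong[OF runs_Seq[OF runs_Dec runs_Inc]])
          (use assms n0 in \<open>auto simp: fun_eq_iff\<close>)
    next
      assume "\<not> nz (scan x (fst ?T) a)"
      then have "n = 2 * i + 1" using assms n0 by auto
      then show "runs K x (Inc c) 2 ?T (?S (Suc i))"
        by (intro runs_cong[OF runs_Inc]) (use assms in \<open>auto simp: fun_eq_iff\<close>)
    qed (use assms in auto)
    show "runs K x (Dec a ;; Cond a nz (Dec a ;; Inc b) (Inc c)) 5 (?S i) (?S (Suc i))"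
      using runs_Seq[OF 1 2] by simp
  qed (use assms in auto)
  moreover have "?S 0 = (h, out)"
    using assms by (auto simp: n_def fun_eq_iff)
  moreover have "?S ?k = (h(a := 0, b := h a div 2, c := h a mod 2), out)"
    using assms by (auto simp: n_def fun_eq_iff) presburger+
  ultimately have "runs K x (halve a b c) (?k * (5 + 2) + 1) (h, out)
      (h(a := 0, b := h a div 2, c := h a mod 2), out)" by simp
  then show ?thesis
    by (rule runs_cong) (auto simp: n_def)
qed

lemma binary_items_0: "binary_items 0 = []"
  using binary_eq_Nil_iff[of 0] by (simp add: binary_items_def)

lemma binary_items_rec: "n > 0 \<Longrightarrow> binary_items n = [True, odd n] @ binary_items (n div 2)"
  by (simp add: binary_items_def binary_Cons)

lemma runs_emit_binary:
  assumes "a < K" "b < K" "c < K" "even a" "even b" "even c" "a \<noteq> b" "a \<noteq> c" "b \<noteq> c"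
    and "2 * ch + 1 < K" and "h b = 0" "h c = 0"
  shows "runs K x (emit_binary ch a b c) (h a * (20 * h a + 20) + 1) (h, out)
    (emit ch (binary_items (h a)) (h(a := 0), out))"
  using assms(11,12)
proof (induction "h a" arbitrary: h out rule: less_induct)
  case less
  show ?case
  proof (cases "h a = 0")
    case True
    then have "h(a := 0) = h" by auto
    have "a \<noteq> 1" using assms by auto
    with True runs_While_False[of a K nz x "(h, out)"] assms \<open>h(a := 0) = h\<close> show ?thesis
      by (simp add: emit_binary_def binary_items_0)
  next
    case False
    have ne: "a \<noteq> 1" "b \<noteq> 1" "c \<noteq> 1" "a \<noteq> 2 * ch + 1" "b \<noteq> 2 * ch + 1" "c \<noteq> 2 * ch + 1"
      using assms by auto
    define h1 where "h1 = h(a := 0, b := h a div 2, c := h a mod 2)"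
    define s2 where "s2 = emit ch [True] (h1, out)"
    define s3 where "s3 = emit ch [True, odd (h a)] (h1(c := 0), out)"
    define h' where "h' = h(a := h a div 2)"
    have 1: "runs K x (halve a b c) (7 * h a + 8) (h, out) (h1, out)"
      unfolding h1_def by (rule runs_halve) (use assms less.prems ne in auto)
    have 2: "runs K x (emit1 ch True) 1 (h1, out) s2"
      unfolding s2_def by (rule runs_emit1) (use assms in auto)
    have 3: "runs K x (Cond c nz (Dec c ;; emit1 ch True) (emit1 ch False)) (2 + 2) s2 s3"
    proof (rule runs_Cond)
      have s2c: "fst s2 c = h a mod 2"
        using assms by (simp add: s2_def emit_def h1_def)
      { assume "nz (scan x (fst s2) c)"
        then have odd: "odd (h a)" "h1 c = 1" using s2c by (auto simp: odd_iff_mod_2_eq_one h1_def)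
        show "runs K x (Dec c ;; emit1 ch True) 2 s2 s3"
          by (subst surjective_pairing[of s2], rule runs_cong[OF runs_Seq[OF runs_Dec runs_emit1]])
            (use assms ne odd in \<open>auto simp: s2_def s3_def emit_def emit_regs_def emit_out_def fun_eq_iff\<close>)
      }
      { assume "\<not> nz (scan x (fst s2) c)"
        then have even: "even (h a)" using s2c by auto
        then have "h1(c := 0) = h1" by (auto simp: h1_def)
        then show "runs K x (emit1 ch False) 2 s2 s3"
          by (intro runs_cong[OF runs_emit1])
            (use assms even in \<open>auto simp: s2_def s3_def emit_append\<close>)
      }
    qed (use assms ne in auto)
    have 4: "runs K x (transfer b a) (4 * h a + 1) s3 (emit ch [True, odd (h a)] (h', out))"
      by (subst surjective_pairing[of s3], rule runs_cong[OF runs_transfer])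
        (use assms ne less.prems in \<open>auto simp: s3_def emit_def emit_regs_def emit_out_def h1_def h'_def fun_eq_iff\<close>)
    have 5: "runs K x (emit_binary ch a b c) (fst (emit ch [True, odd (h a)] (h', out)) a *
        (20 * fst (emit ch [True, odd (h a)] (h', out)) a + 20) + 1)
      (fst (emit ch [True, odd (h a)] (h', out)), snd (emit ch [True, odd (h a)] (h', out)))
      (emit ch (binary_items (fst (emit ch [True, odd (h a)] (h', out)) a))
        ((fst (emit ch [True, odd (h a)] (h', out)))(a := 0), snd (emit ch [True, odd (h a)] (h', out))))"
      by (rule less.hyps) (use False assms less.prems in \<open>auto simp: emit_def h'_def\<close>)
    \<comment> \<open>Only a decrease by 1 is used, not the halving: it already frees
      \<open>40 * h a\<close> steps, more than the linear cost of one round.\<close>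
    have n2: "h a div 2 * (20 * (h a div 2) + 20) \<le> (h a - 1) * (20 * h a)"
    proof (rule mult_mono)
      show "h a div 2 \<le> h a - 1" "20 * (h a div 2) + 20 \<le> 20 * h a"
        using False by presburger+
    qed auto
    obtain m where m: "h a = Suc m" using False by (cases "h a") auto
    have fin: "emit ch (binary_items (fst (emit ch [True, odd (h a)] (h', out)) a))
        ((fst (emit ch [True, odd (h a)] (h', out)))(a := 0), snd (emit ch [True, odd (h a)] (h', out)))
      = emit ch (binary_items (h a)) (h(a := 0), out)"
      using assms(4) ne False
      by (auto simp: binary_items_rec[of "h a"] emit_def emit_regs_def emit_out_def h'_def fun_eq_iff)
    show ?thesis
      unfolding emit_binary_def
    proof (rule runs_cong[OF runs_While_True[OF _ _ _
            runs_Seq[OF 1 runs_Seq[OF 2 runs_Seq[OF 3 4]]] 5[unfolded emit_binary_def prod.collapse]]])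
      show "7 * h a + 8 + (1 + (2 + 2 + (4 * h a + 1))) +
          (fst (emit ch [True, odd (h a)] (h', out)) a *
           (20 * fst (emit ch [True, odd (h a)] (h', out)) a + 20) + 1) + 2
          \<le> h a * (20 * h a + 20) + 1"
        using n2 assms(4) by (simp add: emit_def h'_def m algebra_simps)
    qed (use assms ne False fin in auto)
  qed
qed


declare Suc_double_not_eq_double [simp] double_not_eq_Suc_double [simp]

section \<open>Correctness and polynomial running time of generators\<close>

definition frame :: "nat \<Rightarrow> (nat \<Rightarrow> nat) \<Rightarrow> bool" where
  "frame d h \<longleftrightarrow> h 0 = 0 \<and> (\<forall>r\<ge>2 * d + 2. h r = 0)"

definition vars :: "(nat \<Rightarrow> nat) \<Rightarrow> nat \<Rightarrow> nat" where
  "vars h l = h (2 * l + 2)"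

text \<open>\<open>M\<close> bounds the input length and all variables in scope. The output length
  is bounded along with the running time because \<open>Bind\<close> makes it the value of a
  variable. The channel \<open>c\<close> is arbitrary up to \<open>d\<close>, since the same
  generator may run for its output or only for its length.\<close>

definition realizes :: "nat \<Rightarrow> nat \<Rightarrow> nat poly \<Rightarrow> gen \<Rightarrow> bool" where
  "realizes d K0 P g \<longleftrightarrow> (\<forall>K x h out c M. K0 \<le> K \<longrightarrow> length x \<le> M \<longrightarrow> c \<le> d \<longrightarrow> frame d h \<longrightarrow>
     (\<forall>l<d. vars h l \<le> M) \<longrightarrow>
     runs K x (compile d g c) (poly P M) (h, out) (emit c (sem x d g (vars h)) (h, out)) \<and>
     length (sem x d g (vars h)) \<le> poly P M)"

lemma realizesI:
  assumes "\<And>K x h out c M. K0 \<le> K \<Longrightarrow> length x \<le> M \<Longrightarrow> c \<le> d \<Longrightarrow> frame d h \<Longrightarrow>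
     \<forall>l<d. vars h l \<le> M \<Longrightarrow>
     runs K x (compile d g c) (poly P M) (h, out) (emit c (sem x d g (vars h)) (h, out)) \<and>
     length (sem x d g (vars h)) \<le> poly P M"
  shows "realizes d K0 P g"
  unfolding realizes_def using assms by blast

lemma realizesD:
  assumes "realizes d K0 P g" "K0 \<le> K" "length x \<le> M" "c \<le> d" "frame d h" "\<forall>l<d. vars h l \<le> M"
  shows "runs K x (compile d g c) (poly P M) (h, out) (emit c (sem x d g (vars h)) (h, out))"
    and "length (sem x d g (vars h)) \<le> poly P M"
  using assms unfolding realizes_def by blast+

lemma frame_0: "frame d h \<Longrightarrow> h 0 = 0"
  by (simp add: frame_def)

lemma frame_Suc: "frame d h \<Longrightarrow> frame (Suc d) h"
  by (simp add: frame_def)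

lemma frame_emit_regs: "c \<le> d \<Longrightarrow> frame d (emit_regs c bs h) \<longleftrightarrow> frame d h"
  by (auto simp: frame_def emit_regs_def)

lemma vars_emit_regs [simp]: "vars (emit_regs c bs h) = vars h"
  by (auto simp: vars_def)

lemma emit_pair: "emit c bs (h, out) = (emit_regs c bs h, emit_out c bs out)"
  by (simp add: emit_def)

lemma poly_nat_mono: "a \<le> b \<Longrightarrow> poly (p :: nat poly) a \<le> poly p b"
  by (induction p) (auto intro!: add_mono mult_mono)

lemma realizes_Emit: "realizes d (2 * d + 2) [:length bs:] (Emit bs)"
  by (rule realizesI) (auto intro: runs_emits)

lemma realizes_Then:
  assumes "realizes d K1 P1 g1" "realizes d K2 P2 g2"
  shows "realizes d (max K1 K2) (P1 + P2) (g1 \<triangleright> g2)"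
proof (rule realizesI)
  fix K and x :: "bool list" and h out c M
  assume A: "max K1 K2 \<le> K" "length x \<le> M" "c \<le> d" "frame d h" "\<forall>l<d. vars h l \<le> M"
  note 1 = realizesD[OF assms(1) _ A(2-5), where K = K]
  let ?b = "sem x d g1 (vars h)"
  have f: "frame d (emit_regs c ?b h)" using A by (simp add: frame_emit_regs)
  note 2 = realizesD[OF assms(2) _ A(2,3) f, where K = K]
  have "runs K x (compile d (g1 \<triangleright> g2) c) (poly P1 M + poly P2 M) (h, out)
    (emit c (sem x d g2 (vars h)) (emit c ?b (h, out)))"
    unfolding compile.simps
    by (rule runs_Seq[OF 1(1)]) (use 2(1) A in \<open>auto simp: emit_pair\<close>)
  then show "runs K x (compile d (g1 \<triangleright> g2) c) (poly (P1 + P2) M) (h, out)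
      (emit c (sem x d (g1 \<triangleright> g2) (vars h)) (h, out)) \<and>
      length (sem x d (g1 \<triangleright> g2) (vars h)) \<le> poly (P1 + P2) M"
    using 1 2 A by (simp add: emit_append)
qed

lemma realizes_For:
  assumes "b < d" "realizes (Suc (Suc d)) K0 P g"
  shows "realizes d (max K0 (2 * d + 10)) ([:4, 12:] + [:0, 1:] * (P + [:4:])) (For b g)"
proof (rule realizesI)
  fix K and x :: "bool list" and h out c M
  assume A: "max K0 (2 * d + 10) \<le> K" "length x \<le> M" "c \<le> d" "frame d h" "\<forall>l<d. vars h l \<le> M"
  define k where "k = h (2 * b + 2)"
  have k: "k = vars h b" "k \<le> M" using A(5)[rule_format, OF assms(1)] by (auto simp: k_def vars_def)
  define f where "f i = sem x (Suc (Suc d)) g ((vars h)(d := i, Suc d := k - Suc i))" for i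
  define bs where "bs i = concat (map f [0..<i])" for i
  define S where "S i = emit c (bs i) (h(2 * d + 2 := i, 2 * d + 4 := k - i), out)" for i
  have ne: "2 * c + 1 \<noteq> 2 * j" for j by presburger
  have bd: "2 * b + 2 \<noteq> 2 * d + 2" "2 * b + 2 \<noteq> 2 * d + 4" "2 * b + 2 \<noteq> 2 * d + 6"
    using assms(1) by auto
  have h0: "h (2 * d + 2) = 0" "h (2 * d + 4) = 0" "h (2 * d + 6) = 0"
    using A(4) by (auto simp: frame_def)
  have 1: "runs K x (copy (2 * b + 2) (2 * d + 4) (2 * d + 6)) (9 * k + 2) (h, out) (S 0)"
    unfolding k_def
    by (rule runs_cong[OF runs_copy])
      (use A assms(1) h0 in \<open>auto simp: S_def bs_def k_def fun_eq_iff\<close>)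
  let ?body = "Dec (2 * d + 4) ;; compile (Suc (Suc d)) g c ;; Inc (2 * d + 2)"
  have body: "runs K x ?body (1 + (poly P M + 1)) (S i) (S (Suc i)) \<and> length (f i) \<le> poly P M"
    if i: "i < k" for i
  proof -
    define h' where "h' = emit_regs c (bs i) (h(2 * d + 2 := i, 2 * d + 4 := k - Suc i))"
    define o' where "o' = emit_out c (bs i) out"
    have d1: "runs K x (Dec (2 * d + 4)) 1 (S i) (h', o')"
      unfolding S_def emit_pair
      by (rule runs_cong[OF runs_Dec])
        (use A(1) i in \<open>auto simp: h'_def o'_def emit_regs_def fun_eq_iff\<close>)
    have v: "vars h' = (vars h)(d := i, Suc d := k - Suc i)"
      by (auto simp: h'_def vars_def fun_eq_iff)
    have fr: "frame (Suc (Suc d)) h'"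
      using A(3,4) by (auto simp: frame_def h'_def emit_regs_def)
    have vM: "\<forall>l<Suc (Suc d). vars h' l \<le> M"
      using A(5) i k unfolding v by (auto simp: less_Suc_eq)
    have d2: "runs K x (compile (Suc (Suc d)) g c) (poly P M) (h', o') (emit c (f i) (h', o'))"
      and len: "length (f i) \<le> poly P M"
      using realizesD[OF assms(2) _ A(2) _ fr vM, where K = K and c = c] A(1,3) by (auto simp: v f_def)
    have d3: "runs K x (Inc (2 * d + 2)) 1 (emit c (f i) (h', o')) (S (Suc i))"
      unfolding emit_pair
      by (rule runs_cong[OF runs_Inc])
        (use A(1) i in \<open>auto simp: S_def h'_def o'_def bs_def emit_regs_def emit_out_def emit_def fun_eq_iff\<close>)
    show ?thesis using runs_Seq[OF d1 runs_Seq[OF d2 d3]] len by simp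
  qed
  have 2: "runs K x (While (2 * d + 4) nz ?body) (k * (1 + (poly P M + 1) + 2) + 1) (S 0) (S k)"
    by (rule runs_While) (use A(1) body in \<open>auto simp: S_def emit_def\<close>)
  have 3: "runs K x (zero (2 * d + 2)) (3 * k + 1) (S k) (emit c (bs k) (h, out))"
  proof (subst S_def, subst emit_pair, rule runs_cong[OF runs_zero])
    have "(h(2 * d + 2 := k, 2 * d + 4 := k - k))(2 * d + 2 := 0) = h"
      using h0 by (auto simp: fun_eq_iff)
    then have "(emit_regs c (bs k) (h(2 * d + 2 := k, 2 * d + 4 := k - k)))(2 * d + 2 := 0) =
        emit_regs c (bs k) h"
      by (subst emit_regs_upd[symmetric]) auto
    then show "((emit_regs c (bs k) (h(2 * d + 2 := k, 2 * d + 4 := k - k)))(2 * d + 2 := 0),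
        emit_out c (bs k) out) = emit c (bs k) (h, out)"
      by (simp add: emit_pair)
  qed (use A(1) in auto)
  have s: "sem x d (For b g) (vars h) = bs k"
    by (simp add: bs_def f_def k cong: map_cong)
  have "length (bs j) \<le> j * poly P M" if "j \<le> k" for j
    using that
  proof (induction j)
    case (Suc j)
    then show ?case using body[of j] by (simp add: bs_def)
  qed (simp add: bs_def)
  then have len: "length (bs k) \<le> k * poly P M" by simp
  have "k * (poly P M + 4) \<le> M * (poly P M + 4)" using k(2) by simp
  then have t: "9 * k + 2 + (k * (1 + (poly P M + 1) + 2) + 1 + (3 * k + 1)) \<le>
      poly ([:4, 12:] + [:0, 1:] * (P + [:4:])) M" "k * poly P M \<le> poly ([:4, 12:] + [:0, 1:] * (P + [:4:])) M"
    using k(2) by (auto simp: algebra_simps)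
  show "runs K x (compile d (For b g) c) (poly ([:4, 12:] + [:0, 1:] * (P + [:4:])) M) (h, out)
      (emit c (sem x d (For b g) (vars h)) (h, out)) \<and>
      length (sem x d (For b g) (vars h)) \<le> poly ([:4, 12:] + [:0, 1:] * (P + [:4:])) M"
    unfolding s compile.simps
    using runs_cong[OF runs_Seq[OF 1 runs_Seq[OF 2 3]] refl t(1)] le_trans[OF len t(2)] by blast
qed

text \<open>The new variable can be as large as the output of \<open>g1\<close>, so
  \<open>g2\<close> runs under the bound \<open>M + n\<close> with \<open>n\<close> at most
  \<open>poly P1 M\<close>; hence the composition of polynomials.\<close>

lemma realizes_Bind:
  assumes "realizes (Suc d) K1 P1 g1" "realizes (Suc d) K2 P2 g2"
  shows "realizes d (max (max K1 K2) (2 * d + 10)) (8 * P1 + [:2:] + P2 \<circ>\<^sub>p ([:0, 1:] + P1)) (Bind g1 g2)"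
proof (rule realizesI)
  fix K and x :: "bool list" and h out c M
  assume A: "max (max K1 K2) (2 * d + 10) \<le> K" "length x \<le> M" "c \<le> d" "frame d h" "\<forall>l<d. vars h l \<le> M"
  have h0: "h (2 * d + 2) = 0" "h (2 * d + 3) = 0"
    using A(4) by (auto simp: frame_def)
  have vM: "\<forall>l<Suc d. vars h l \<le> M"
    using A(5) h0 by (auto simp: less_Suc_eq vars_def)
  have K1: "K1 \<le> K" using A(1) by simp
  define bs where "bs = sem x (Suc d) g1 (vars h)"
  define n where "n = length bs"
  note 1 = realizesD[OF assms(1) K1 A(2) le_refl frame_Suc[OF A(4)] vM, folded bs_def]
  have n: "n \<le> poly P1 M" using 1 A(1) by (simp add: n_def)
  have e: "emit (Suc d) bs (h, out) = (h(2 * d + 3 := n), out)"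
    using h0 by (auto simp: emit_def emit_regs_def emit_out_def n_def fun_eq_iff numeral_3_eq_3)
  define h' where "h' = h(2 * d + 2 := n)"
  have 2: "runs K x (transfer (2 * d + 3) (2 * d + 2)) (4 * n + 1) (h(2 * d + 3 := n), out) (h', out)"
    by (rule runs_cong[OF runs_transfer]) (use A(1) h0 in \<open>auto simp: h'_def fun_eq_iff\<close>)
  have v: "vars h' = (vars h)(d := n)"
    by (auto simp: h'_def vars_def fun_eq_iff)
  have fr: "frame (Suc d) h'"
    using A(4) by (auto simp: frame_def h'_def)
  have vM': "\<forall>l<Suc d. vars h' l \<le> M + n"
    using A(5) unfolding v by (auto simp: less_Suc_eq trans_le_add1)
  define cs where "cs = sem x (Suc d) g2 (vars h')"
  have "K2 \<le> K" "length x \<le> M + n" "c \<le> Suc d" using A by auto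
  note 3 = realizesD[OF assms(2) this fr vM', folded cs_def]
  have 4: "runs K x (zero (2 * d + 2)) (3 * n + 1) (emit c cs (h', out)) (emit c cs (h, out))"
    unfolding emit_pair
    by (rule runs_cong[OF runs_zero]) (use A(1) h0 in \<open>auto simp: h'_def emit_regs_def fun_eq_iff\<close>)
  have s: "sem x d (Bind g1 g2) (vars h) = cs"
    by (simp add: cs_def v n_def bs_def)
  have P2: "poly P2 (M + n) \<le> poly P2 (M + poly P1 M)"
    using n by (intro poly_nat_mono) simp
  have t: "poly P1 M + (4 * n + 1 + (poly P2 (M + n) + (3 * n + 1))) \<le>
    poly (8 * P1 + [:2:] + P2 \<circ>\<^sub>p ([:0, 1:] + P1)) M"
    using P2 n by (simp add: poly_pcompose)
  have "poly P2 (M + n) \<le> poly (8 * P1 + [:2:] + P2 \<circ>\<^sub>p ([:0, 1:] + P1)) M"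
    using P2 by (simp add: poly_pcompose)
  then show "runs K x (compile d (Bind g1 g2) c) (poly (8 * P1 + [:2:] + P2 \<circ>\<^sub>p ([:0, 1:] + P1)) M) (h, out)
      (emit c (sem x d (Bind g1 g2) (vars h)) (h, out)) \<and>
      length (sem x d (Bind g1 g2) (vars h)) \<le> poly (8 * P1 + [:2:] + P2 \<circ>\<^sub>p ([:0, 1:] + P1)) M"
    unfolding s compile.simps
    using runs_cong[OF runs_Seq[OF 1(1)[of out, unfolded e] runs_Seq[OF 2 runs_Seq[OF 3(1) 4]]] refl t]
      le_trans[OF 3(2)] by blast
qed

lemma length_binary_items: "length (binary_items n) \<le> 2 * n"
proof (induction n rule: less_induct)
  case (less n)
  show ?case
  proof (cases "n = 0")
    case False
    then have "n div 2 < n" by simp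
    then have "length (binary_items (n div 2)) \<le> 2 * (n div 2)" by (rule less)
    moreover have "2 + 2 * (n div 2) \<le> 2 * n" using False by presburger
    ultimately show ?thesis using False by (simp add: binary_items_rec)
  qed (simp add: binary_items_0)
qed

lemma realizes_Bin:
  assumes "b < d"
  shows "realizes d (2 * d + 10) ([:3, 9:] + [:0, 20:] * [:1, 1:]) (Bin b)"
proof (rule realizesI)
  fix K and x :: "bool list" and h out c M
  assume A: "2 * d + 10 \<le> K" "length x \<le> M" "c \<le> d" "frame d h" "\<forall>l<d. vars h l \<le> M"
  define k where "k = h (2 * b + 2)"
  have k: "k = vars h b" "k \<le> M" using A(5)[rule_format, OF assms(1)] by (auto simp: k_def vars_def)
  have h0: "h (2 * d + 2) = 0" "h (2 * d + 4) = 0" "h (2 * d + 6) = 0" "h (2 * d + 8) = 0"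
    using A(4) by (auto simp: frame_def)
  have 1: "runs K x (copy (2 * b + 2) (2 * d + 2) (2 * d + 8)) (9 * k + 2) (h, out) (h(2 * d + 2 := k), out)"
    unfolding k_def
    by (rule runs_cong[OF runs_copy]) (use A assms h0 in \<open>auto simp: fun_eq_iff\<close>)
  have 2: "runs K x (emit_binary c (2 * d + 2) (2 * d + 4) (2 * d + 6)) (k * (20 * k + 20) + 1)
    (h(2 * d + 2 := k), out) (emit c (binary_items k) (h, out))"
    by (rule runs_cong[OF runs_emit_binary]) (use A h0 in \<open>auto simp: fun_upd_idem\<close>)
  have "k * (20 * k + 20) \<le> M * (20 * M + 20)" using k(2) by (intro mult_mono) auto
  moreover have p: "poly ([:3, 9:] + [:0, 20:] * [:1, 1:]) M = (9 * M + 3) + M * (20 * M + 20)"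
    by (simp add: algebra_simps)
  moreover have "9 * k + 3 \<le> 9 * M + 3" using k(2) by simp
  ultimately have t: "9 * k + 2 + (k * (20 * k + 20) + 1) \<le> poly ([:3, 9:] + [:0, 20:] * [:1, 1:]) M"
    by linarith
  have "2 * k \<le> 9 * M + 3" using k(2) by simp
  then have "2 * k \<le> poly ([:3, 9:] + [:0, 20:] * [:1, 1:]) M"
    unfolding p by (rule trans_le_add1)
  then show "runs K x (compile d (Bin b) c) (poly ([:3, 9:] + [:0, 20:] * [:1, 1:]) M) (h, out)
      (emit c (sem x d (Bin b) (vars h)) (h, out)) \<and>
      length (sem x d (Bin b) (vars h)) \<le> poly ([:3, 9:] + [:0, 20:] * [:1, 1:]) M"
    unfolding compile.simps sem.simps k(1)[symmetric]
    using runs_cong[OF runs_Seq[OF 1 2] refl t] le_trans[OF length_binary_items[of k]] by blast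
qed

lemma realizes_IfSymbol:
  assumes "b < d" "realizes d K0 P0 g0" "realizes d K1 P1 g1" "realizes d K2 P2 g2"
  shows "realizes d (max (max K0 (max K1 K2)) (2 * d + 10)) ([:10, 12:] + P0 + P1 + P2) (IfSymbol b g0 g1 g2)"
proof (rule realizesI)
  fix K and x :: "bool list" and h out c M
  assume A: "max (max K0 (max K1 K2)) (2 * d + 10) \<le> K" "length x \<le> M" "c \<le> d" "frame d h"
    "\<forall>l<d. vars h l \<le> M"
  define k where "k = h (2 * b + 2)"
  have k: "k = vars h b" "k \<le> M" using A(5)[rule_format, OF assms(1)] by (auto simp: k_def vars_def)
  have h0: "h 0 = 0" "h (2 * d + 2) = 0"
    using A(4) by (auto simp: frame_def)
  define h' where "h' = h(0 := k)"
  have 1: "runs K x (copy (2 * b + 2) 0 (2 * d + 2)) (9 * k + 2) (h, out) (h', out)"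
    unfolding k_def
    by (rule runs_cong[OF runs_copy]) (use A assms(1) h0 in \<open>auto simp: fun_eq_iff h'_def k_def\<close>)
  have z: "runs K x (zero 0) (3 * k + 1) (h', out) (h, out)"
    by (rule runs_cong[OF runs_zero]) (use A(1) h0 in \<open>auto simp: h'_def fun_upd_idem\<close>)
  let ?B = "3 * k + 1 + (poly P0 M + poly P1 M + poly P2 M)"
  have br: "runs K x (zero 0 ;; compile d g c) ?B (h', out) (emit c (sem x d g (vars h)) (h, out))"
    if "realizes d K' P g" "K' \<le> K" "poly P M \<le> poly P0 M + poly P1 M + poly P2 M" for g K' P
    using runs_cong[OF runs_Seq[OF z realizesD(1)[OF that(1,2) A(2-5)]] refl] that(3) by simp
  have sc: "scan x (fst (h', out)) 0 mod 3 = input_symbol x k"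
    using scan_0_mod[of x h'] by (simp add: h'_def)
  have s: "input_symbol x k < 3" by (rule input_symbol_less)
  have b0: "runs K x (zero 0 ;; compile d g0 c) ?B (h', out) (emit c (sem x d g0 (vars h)) (h, out))"
    and b1: "runs K x (zero 0 ;; compile d g1 c) ?B (h', out) (emit c (sem x d g1 (vars h)) (h, out))"
    and b2: "runs K x (zero 0 ;; compile d g2 c) ?B (h', out) (emit c (sem x d g2 (vars h)) (h, out))"
    using br[OF assms(2)] br[OF assms(3)] br[OF assms(4)] A(1) by auto
  let ?R = "emit c (sem x d (IfSymbol b g0 g1 g2) (vars h)) (h, out)"
  have 2: "runs K x (Cond 0 (\<lambda>s. s mod 3 = 0) (zero 0 ;; compile d g0 c)
       (Cond 0 (\<lambda>s. s mod 3 = 1) (zero 0 ;; compile d g1 c) (zero 0 ;; compile d g2 c)))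
     (?B + 2 + 2) (h', out) ?R"
  proof (rule runs_Cond)
    show "runs K x (zero 0 ;; compile d g0 c) (?B + 2) (h', out) ?R"
      if "scan x (fst (h', out)) 0 mod 3 = 0"
      using that b0 unfolding sc by (auto simp: k(1)[symmetric] intro: runs_cong)
    show "runs K x (Cond 0 (\<lambda>s. s mod 3 = 1) (zero 0 ;; compile d g1 c) (zero 0 ;; compile d g2 c))
      (?B + 2) (h', out) ?R"
      if "scan x (fst (h', out)) 0 mod 3 \<noteq> 0"
    proof (rule runs_Cond)
      show "runs K x (zero 0 ;; compile d g1 c) ?B (h', out) ?R"
        if "scan x (fst (h', out)) 0 mod 3 = 1"
        using that b1 unfolding sc by (auto simp: k(1)[symmetric])
      show "runs K x (zero 0 ;; compile d g2 c) ?B (h', out) ?R"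
        if "scan x (fst (h', out)) 0 mod 3 \<noteq> 1"
        using that b2 \<open>scan x (fst (h', out)) 0 mod 3 \<noteq> 0\<close> unfolding sc by (auto simp: k(1)[symmetric])
    qed (use A(1) in auto)
  qed (use A(1) in auto)
  have t: "9 * k + 2 + (?B + 2 + 2) \<le> poly ([:10, 12:] + P0 + P1 + P2) M"
    using k(2) by (simp add: algebra_simps)
  have "length (sem x d (IfSymbol b g0 g1 g2) (vars h)) \<le> poly ([:10, 12:] + P0 + P1 + P2) M"
    using realizesD(2)[OF assms(2) _ A(2-5), of K] realizesD(2)[OF assms(3) _ A(2-5), of K]
      realizesD(2)[OF assms(4) _ A(2-5), of K] A(1) by auto
  then show "runs K x (compile d (IfSymbol b g0 g1 g2) c) (poly ([:10, 12:] + P0 + P1 + P2) M) (h, out) ?R \<and>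
      length (sem x d (IfSymbol b g0 g1 g2) (vars h)) \<le> poly ([:10, 12:] + P0 + P1 + P2) M"
    unfolding compile.simps using runs_cong[OF runs_Seq[OF 1 2] refl t] by blast
qed

lemma realizes_EmitInput: "realizes d (2 * d + 10) [:2, 7:] EmitInput"
proof (rule realizesI)
  fix K and x :: "bool list" and h out c M
  assume A: "2 * d + 10 \<le> K" "length x \<le> M" "c \<le> d" "frame d h"
  have h0: "h 0 = 0" using A(4) by (rule frame_0)
  let ?n = "length x"
  define S where "S i = emit c (replicate i True) (h(0 := i), out)" for i
  have 1: "runs K x (While 0 (\<lambda>s. s mod 3 \<noteq> 0) (Inc 0 ;; emit1 c True)) (?n * (2 + 2) + 1) (S 0) (S ?n)"
  proof (rule runs_While)
    fix i assume "i < ?n"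
    then show "scan x (fst (S i)) 0 mod 3 \<noteq> 0"
      unfolding scan_0_mod by (simp add: S_def emit_def input_symbol_def)
    show "runs K x (Inc 0 ;; emit1 c True) 2 (S i) (S (Suc i))"
      by (subst surjective_pairing[of "S i"], rule runs_cong[OF runs_Seq[OF runs_Inc runs_emit1]])
        (use A in \<open>auto simp: S_def emit_def emit_regs_def emit_out_def fun_eq_iff replicate_append_same\<close>)
  next
    show "\<not> scan x (fst (S ?n)) 0 mod 3 \<noteq> 0"
      unfolding scan_0_mod by (simp add: S_def emit_def input_symbol_def)
  qed (use A in auto)
  have 2: "runs K x (zero 0) (3 * ?n + 1) (S ?n) (emit c (replicate ?n True) (h, out))"
    unfolding S_def emit_pair
    by (rule runs_cong[OF runs_zero]) (use A(1) h0 in \<open>auto simp: emit_regs_def fun_eq_iff\<close>)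
  have S0: "S 0 = (h, out)" using h0 by (simp add: S_def fun_upd_idem)
  show "runs K x (compile d EmitInput c) (poly [:2, 7:] M) (h, out)
      (emit c (sem x d EmitInput (vars h)) (h, out)) \<and>
      length (sem x d EmitInput (vars h)) \<le> poly [:2, 7:] M"
    unfolding compile.simps sem.simps
    using runs_cong[OF runs_Seq[OF 1[unfolded S0] 2] refl, of "poly [:2, 7:] M"] A(2) by simp
qed

lemma realizes_IfZero:
  assumes "b < d" "realizes d K1 P1 g1" "realizes d K2 P2 g2"
  shows "realizes d (max (max K1 K2) (2 * d + 10)) ([:2:] + P1 + P2) (IfZero b g1 g2)"
proof (rule realizesI)
  fix K and x :: "bool list" and h out c M
  assume A: "max (max K1 K2) (2 * d + 10) \<le> K" "length x \<le> M" "c \<le> d" "frame d h"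
    "\<forall>l<d. vars h l \<le> M"
  note 1 = realizesD[OF assms(2) _ A(2-5), where K = K]
  note 2 = realizesD[OF assms(3) _ A(2-5), where K = K]
  let ?R = "emit c (sem x d (IfZero b g1 g2) (vars h)) (h, out)"
  have 3: "runs K x (Cond (2 * b + 2) nz (compile d g2 c) (compile d g1 c)) (poly P1 M + poly P2 M + 2) (h, out) ?R"
  proof (rule runs_Cond)
    show "runs K x (compile d g2 c) (poly P1 M + poly P2 M) (h, out) ?R"
      if "nz (scan x (fst (h, out)) (2 * b + 2))"
      by (rule runs_cong[OF 2(1)]) (use that A(1) in \<open>auto simp: vars_def\<close>)
    show "runs K x (compile d g1 c) (poly P1 M + poly P2 M) (h, out) ?R"
      if "\<not> nz (scan x (fst (h, out)) (2 * b + 2))"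
      by (rule runs_cong[OF 1(1)]) (use that A(1) in \<open>auto simp: vars_def\<close>)
  qed (use A(1) assms(1) in auto)
  have "length (sem x d (IfZero b g1 g2) (vars h)) \<le> poly P1 M + poly P2 M"
    using 1(2) 2(2) A(1) by auto
  then show "runs K x (compile d (IfZero b g1 g2) c) (poly ([:2:] + P1 + P2) M) (h, out) ?R \<and>
    length (sem x d (IfZero b g1 g2) (vars h)) \<le> poly ([:2:] + P1 + P2) M"
    unfolding compile.simps using runs_cong[OF 3 refl] by simp
qed

text \<open>The number of rounds is fixed before a loop starts, and variables are loop counters or
  lengths of generated strings, so finitely many nestings compose to a polynomial.\<close>

theorem gen_realizable: "scoped d g \<Longrightarrow> \<exists>K0 P. realizes d K0 P g"
proof (induction g arbitrary: d)
  case (Then g1 g2)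
  then show ?case by (auto dest!: Then.IH intro: realizes_Then)
next
  case (For b g)
  then show ?case by (auto dest!: For.IH intro: realizes_For)
next
  case (Bind g1 g2)
  then show ?case by (auto dest!: Bind.IH intro: realizes_Bind)
next
  case (IfSymbol b g0 g1 g2)
  then show ?case by (auto dest!: IfSymbol.IH intro: realizes_IfSymbol)
next
  case (IfZero b g1 g2)
  then show ?case by (auto dest!: IfZero.IH intro: realizes_IfZero)
qed (auto intro: realizes_Emit realizes_Bin realizes_EmitInput)

theorem poly_turing_reducible_gen:
  assumes "scoped 0 g"
    and "\<And>Orc x. solves Orc R \<Longrightarrow>
      2 < length (Orc (sem x 0 g (\<lambda>_. 0))) \<and> (Orc (sem x 0 g (\<lambda>_. 0)) ! 2 \<longleftrightarrow> x \<notin> A)"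
  shows "poly_turing_reducible A R"
proof -
  obtain K0 P where r: "realizes 0 K0 P g"
    using gen_realizable[OF assms(1)] by blast
  have v: "vars (\<lambda>_. 0) = (\<lambda>_. 0)" by (simp add: vars_def fun_eq_iff)
  have "runs (max K0 3) x (compile 0 g 0) (poly P (length x)) (\<lambda>_. 0, []) (\<lambda>_. 0, sem x 0 g (\<lambda>_. 0))" for x
    using realizesD(1)[OF r, of "max K0 3" x "length x" 0 "\<lambda>_. 0" "[]"]
    by (simp add: v frame_def emit_def emit_regs_def emit_out_def)
  then have "\<exists>t h. t \<le> poly P (length x) \<and>
      exec (max K0 3) x (compile 0 g 0) t (\<lambda>_. 0, []) (h, sem x 0 g (\<lambda>_. 0))" for x
    unfolding runs_def by blast
  with assms(2) show ?thesis
    by (intro query_program[where y = "\<lambda>x. sem x 0 g (\<lambda>_. 0)" and p = "compile 0 g 0" and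
          P = P and K = "max K0 3"]) auto
qed


section \<open>Accepting computations as tilings\<close>

type_synonym ('h, 'v) tile = "'h \<times> 'h \<times> 'v \<times> 'v"

definition left :: "('h, 'v) tile \<Rightarrow> 'h" where "left t = fst t"
definition right :: "('h, 'v) tile \<Rightarrow> 'h" where "right t = fst (snd t)"
definition bottom :: "('h, 'v) tile \<Rightarrow> 'v" where "bottom t = fst (snd (snd t))"
definition top :: "('h, 'v) tile \<Rightarrow> 'v" where "top t = snd (snd (snd t))"

lemmas tile_sel = left_def right_def bottom_def top_def

text \<open>
  The cells of a rectangle of width \<open>W\<close> with \<open>N\<close> cells are numbered row by row, so the upper
  neighbour of cell \<open>i\<close> is cell \<open>i + W\<close>. Horizontal adjacency ignores row ends.
\<close>

definition tiling :: "nat \<Rightarrow> nat \<Rightarrow> 'h \<Rightarrow> (nat \<Rightarrow> 'v) \<Rightarrow> (nat \<Rightarrow> 'v) \<Rightarrow> (nat \<Rightarrow> ('h, 'v) tile) \<Rightarrow> bool" where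
  "tiling W N e lo hi \<tau> \<longleftrightarrow>
     left (\<tau> 0) = e \<and> right (\<tau> (N - 1)) = e \<and>
     (\<forall>i. Suc i < N \<longrightarrow> right (\<tau> i) = left (\<tau> (Suc i))) \<and>
     (\<forall>c<W. bottom (\<tau> c) = lo c) \<and>
     (\<forall>i. i + W < N \<longrightarrow> top (\<tau> i) = bottom (\<tau> (i + W))) \<and>
     (\<forall>c<W. top (\<tau> (N - W + c)) = hi c)"

text \<open>In \<open>Init a f p\<close>, \<open>a\<close> is the input symbol, \<open>f\<close>
  marks the columns where the certificate may be guessed, and \<open>p\<close> marks the column of
  tape cell 0. \<open>Conf q cs\<close> repeats the state in every column and lists for each tape
  the symbol and whether the head is there.\<close>

datatype cell = Init nat bool bool | Conf nat "(nat \<times> bool) list" | Done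

text \<open>The heads of different tapes stand in different columns, so no cell sees all symbols
  that are read. The signal of the row therefore announces the whole tuple, and each cell with a
  head checks its own entry.\<close>

datatype signal = Guess | Step "nat list" | Finish | GiveUp

type_synonym slot = "cell \<times> cell"
type_synonym vlabel = "(bool \<times> bool) \<times> cell"
type_synonym hlabel = "(signal \<times> slot \<times> slot) option"

text \<open>
  A slot holds the contents of a cell before and after a row is processed. The horizontal labels
  broadcast the signal of the row and show each cell the slots of its neighbours. The vertical
  labels also record whether the column is the first or the last one.
\<close>

definition mk_tile :: "signal \<Rightarrow> slot option \<Rightarrow> slot \<Rightarrow> slot option \<Rightarrow> (hlabel, vlabel) tile" where
  "mk_tile s zl z zr =
     (map_option (\<lambda>z'. (s, z', z)) zl, map_option (\<lambda>z'. (s, z, z')) zr,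
      ((zl = None, zr = None), fst z), ((zl = None, zr = None), snd z))"

fun arrives :: "(nat \<times> move) list \<Rightarrow> slot option \<Rightarrow> nat \<Rightarrow> move \<Rightarrow> bool" where
  "arrives as (Some (Conf q cs, _)) j d \<longleftrightarrow> snd (cs ! j) \<and> snd (as ! j) = d"
| "arrives as _ j d \<longleftrightarrow> False"

fun guessed :: "slot option \<Rightarrow> nat" where
  "guessed (Some (_, Conf q cs)) = fst (cs ! 1)"
| "guessed _ = 0"

text \<open>In \<open>Guess\<close>, a nonblank certificate symbol needs the start column or a
  nonblank symbol to its left, so the guess is a string without gaps that begins in cell 0 of tape
  1. \<open>Finish\<close> also accepts \<open>Done\<close>, so an early acceptance can be followed
  by idle rows up to the full height.\<close>

fun rule :: "tm \<Rightarrow> signal \<Rightarrow> slot option \<Rightarrow> slot \<Rightarrow> slot option \<Rightarrow> bool" where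
  "rule V Guess zl z zr \<longleftrightarrow> (\<exists>a f p s.
     z = (Init a f p, Conf (tm_start V) ((a, p) # (s, p) # replicate (tm_tapes V - 2) (0, p))) \<and>
     s \<le> 2 \<and> (s \<noteq> 0 \<longrightarrow> f \<and> (p \<or> guessed zl \<noteq> 0)))"
| "rule V (Step ss) zl z zr \<longleftrightarrow> length ss = tm_tapes V \<and> (\<exists>q cs q' as.
     fst z = Conf q cs \<and> \<not> halting V q \<and> tm_delta V q ss = (q', as) \<and>
     (\<forall>j<tm_tapes V. snd (cs ! j) \<longrightarrow> fst (cs ! j) = ss ! j) \<and>
     snd z = Conf q' (map (\<lambda>j. (if snd (cs ! j) then fst (as ! j) else fst (cs ! j),
       arrives as (Some z) j Stay \<or> arrives as zl j Move_Right \<or> arrives as zr j Move_Left))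
         [0..<tm_tapes V]))"
| "rule V Finish zl z zr \<longleftrightarrow> snd z = Done \<and> (fst z = Done \<or> (\<exists>cs. fst z = Conf (tm_accept V) cs))"
| "rule V GiveUp zl z zr \<longleftrightarrow> snd z = Done \<and> (\<exists>a f p. fst z = Init a f p)"

definition cells :: "tm \<Rightarrow> cell set" where
  "cells V = {Init a f p | a f p. a \<le> 2} \<union>
     {Conf q cs | q cs. q < tm_states V \<and> length cs = tm_tapes V \<and> set cs \<subseteq> {..<tm_symbols V} \<times> UNIV} \<union>
     {Done}"

definition signals :: "tm \<Rightarrow> signal set" where
  "signals V = {Guess, Finish, GiveUp} \<union>
     {Step ss | ss. length ss = tm_tapes V \<and> set ss \<subseteq> {..<tm_symbols V}}"

definition slots :: "tm \<Rightarrow> slot set" where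
  "slots V = cells V \<times> cells V"

definition end_slots :: "tm \<Rightarrow> slot option set" where
  "end_slots V = insert None (Some ` slots V)"

text \<open>
  Only the left end of a row can start to give up, and that tile is left out here.
\<close>

definition tiles :: "tm \<Rightarrow> (hlabel, vlabel) tile set" where
  "tiles V = {mk_tile s zl z zr | s zl z zr. rule V s zl z zr \<and> s \<in> signals V \<and>
     zl \<in> end_slots V \<and> z \<in> slots V \<and> zr \<in> end_slots V \<and> \<not> (s = GiveUp \<and> zl = None)}"

text \<open>The start column will lie so far to the right that the first two columns are blank for
  every input, so this one tile serves all inputs.\<close>

definition give_up_tile :: "(hlabel, vlabel) tile" where
  "give_up_tile = mk_tile GiveUp None (Init 0 False False, Done) (Some (Init 0 False False, Done))"

lemma finite_cells: "finite (cells V)"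
proof -
  let ?A = "(\<lambda>(a, f, p). Init a f p) ` ({..2} \<times> UNIV \<times> UNIV)"
  let ?B = "(\<lambda>(q, cs). Conf q cs) ` ({..<tm_states V} \<times>
    {cs. set cs \<subseteq> {..<tm_symbols V} \<times> UNIV \<and> length cs = tm_tapes V})"
  have "cells V \<subseteq> ?A \<union> ?B \<union> {Done}"
  proof
    fix y assume y: "y \<in> cells V"
    show "y \<in> ?A \<union> ?B \<union> {Done}"
    proof (cases y)
      case (Init a f p)
      then show ?thesis using y image_eqI[of y "\<lambda>(a, f, p). Init a f p" "(a, f, p)"]
        by (simp add: cells_def)
    next
      case (Conf q cs)
      then show ?thesis using y image_eqI[of y "\<lambda>(q, cs). Conf q cs" "(q, cs)"]
        by (simp add: cells_def)
    qed simp
  qed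
  moreover have "finite ?A" "finite ?B"
    by (intro finite_imageI finite_cartesian_product finite_lists_length_eq; simp)+
  ultimately show ?thesis
    by (simp add: finite_subset)
qed

lemma finite_signals: "finite (signals V)"
proof -
  have "{Step ss | ss. length ss = tm_tapes V \<and> set ss \<subseteq> {..<tm_symbols V}} =
    Step ` {ss. set ss \<subseteq> {..<tm_symbols V} \<and> length ss = tm_tapes V}"
    by auto
  then show ?thesis
    unfolding signals_def by (simp add: finite_lists_length_eq)
qed

lemma finite_tiles: "finite (tiles V)"
proof -
  have "tiles V \<subseteq> (\<lambda>(s, zl, z, zr). mk_tile s zl z zr) `
      (signals V \<times> end_slots V \<times> slots V \<times> end_slots V)"
  proof
    fix \<tau> assume "\<tau> \<in> tiles V"
    then obtain s zl z zr where "\<tau> = mk_tile s zl z zr" "s \<in> signals V" "zl \<in> end_slots V"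
      "z \<in> slots V" "zr \<in> end_slots V"
      unfolding tiles_def by blast
    then show "\<tau> \<in> (\<lambda>(s, zl, z, zr). mk_tile s zl z zr) `
      (signals V \<times> end_slots V \<times> slots V \<times> end_slots V)"
      by (intro image_eqI[of _ _ "(s, zl, z, zr)"]) simp_all
  qed
  moreover have "finite (signals V \<times> end_slots V \<times> slots V \<times> end_slots V)"
    by (simp add: slots_def end_slots_def finite_cells finite_signals)
  ultimately show ?thesis
    using finite_subset[OF _ finite_imageI] by simp
qed


subsection \<open>Tilings and sequences of rows\<close>

definition rows :: "tm \<Rightarrow> nat \<Rightarrow> nat \<Rightarrow> (nat \<Rightarrow> cell) \<Rightarrow> (nat \<Rightarrow> signal) \<Rightarrow> (nat \<Rightarrow> nat \<Rightarrow> slot) \<Rightarrow> bool" where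
  "rows V R W lo \<sigma> z \<longleftrightarrow>
     (\<forall>t<R. \<forall>c<W. rule V (\<sigma> t) (if c = 0 then None else Some (z t (c - 1))) (z t c)
        (if Suc c = W then None else Some (z t (Suc c)))) \<and>
     (\<forall>t c. Suc t < R \<longrightarrow> c < W \<longrightarrow> fst (z (Suc t) c) = snd (z t c)) \<and>
     (\<forall>c<W. fst (z 0 c) = lo c \<and> snd (z (R - 1) c) = Done)"

definition edge_label :: "nat \<Rightarrow> (nat \<Rightarrow> cell) \<Rightarrow> nat \<Rightarrow> vlabel" where
  "edge_label W f c = ((c = 0, Suc c = W), f c)"

lemma cell_index: "t < R \<Longrightarrow> c < W \<Longrightarrow> t * W + c < R * (W :: nat)"
proof -
  assume "t < R" "c < W"
  then have "t * W + c < Suc t * W" "Suc t * W \<le> R * W" using mult_le_mono1[of "Suc t" R W] by auto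
  then show ?thesis by linarith
qed

text \<open>The vertical labels copy the flags for the first and the last column upwards from the
  lower border. So the horizontal label \<open>None\<close> occurs exactly at row ends, and the
  chain of horizontal edges splits into rows; inside a row the other labels identify the signals and
  the slots of neighbours.\<close>

lemma tiling_rows:
  assumes W: "2 \<le> W" and R: "0 < R"
    and til: "tiling W (R * W) None (edge_label W lo) (edge_label W (\<lambda>_. Done)) \<tau>"
    and mem: "\<And>i. i < R * W \<Longrightarrow> \<tau> i \<in> tiles V"
  obtains \<sigma> z where "rows V R W lo \<sigma> z" "\<And>t. t < R \<Longrightarrow> \<sigma> t \<noteq> GiveUp"
proof -
  have "\<forall>i. \<exists>q. i < R * W \<longrightarrow> \<tau> i = mk_tile (fst q) (fst (snd q)) (fst (snd (snd q))) (snd (snd (snd q))) \<and>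
      rule V (fst q) (fst (snd q)) (fst (snd (snd q))) (snd (snd (snd q))) \<and>
      \<not> (fst q = GiveUp \<and> fst (snd q) = None)"
  proof (intro allI)
    fix i
    show "\<exists>q. i < R * W \<longrightarrow> \<tau> i = mk_tile (fst q) (fst (snd q)) (fst (snd (snd q))) (snd (snd (snd q))) \<and>
      rule V (fst q) (fst (snd q)) (fst (snd (snd q))) (snd (snd (snd q))) \<and>
      \<not> (fst q = GiveUp \<and> fst (snd q) = None)"
    proof (cases "i < R * W")
      case True
      from mem[OF True] obtain s zl y zr where
        "\<tau> i = mk_tile s zl y zr" "rule V s zl y zr" "\<not> (s = GiveUp \<and> zl = None)"
        unfolding tiles_def by blast
      then show ?thesis by (intro exI[of _ "(s, zl, y, zr)"]) auto
    qed simp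
  qed
  from choice[OF this] obtain q where q: "\<forall>i. i < R * W \<longrightarrow>
      \<tau> i = mk_tile (fst (q i)) (fst (snd (q i))) (fst (snd (snd (q i)))) (snd (snd (snd (q i)))) \<and>
      rule V (fst (q i)) (fst (snd (q i))) (fst (snd (snd (q i)))) (snd (snd (snd (q i)))) \<and>
      \<not> (fst (q i) = GiveUp \<and> fst (snd (q i)) = None)" ..
  define s zl y zr where "s i = fst (q i)" and "zl i = fst (snd (q i))" and "y i = fst (snd (snd (q i)))"
    and "zr i = snd (snd (snd (q i)))" for i
  have tile: "\<And>i. i < R * W \<Longrightarrow> \<tau> i = mk_tile (s i) (zl i) (y i) (zr i)" and
    rl: "\<And>i. i < R * W \<Longrightarrow> rule V (s i) (zl i) (y i) (zr i)" and
    ng: "\<And>i. i < R * W \<Longrightarrow> \<not> (s i = GiveUp \<and> zl i = None)"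
    using q unfolding s_def zl_def y_def zr_def by blast+
  have idx: "t * W + c < R * W" if "t < R" "c < W" for t c
    using cell_index that .
  have hor: "map_option (\<lambda>z'. (s i, y i, z')) (zr i) = map_option (\<lambda>z'. (s (Suc i), z', y (Suc i))) (zl (Suc i))"
    if "Suc i < R * W" for i
  proof -
    have "right (\<tau> i) = left (\<tau> (Suc i))" using til that by (simp add: tiling_def)
    then show ?thesis using tile[of i] tile[of "Suc i"] that by (simp add: tile_sel mk_tile_def)
  qed
  have vert: "(zl i = None, zr i = None) = (zl (i + W) = None, zr (i + W) = None)" "snd (y i) = fst (y (i + W))"
    if "i + W < R * W" for i
  proof -
    have "top (\<tau> i) = bottom (\<tau> (i + W))" using til that by (simp add: tiling_def)
    then show "(zl i = None, zr i = None) = (zl (i + W) = None, zr (i + W) = None)" "snd (y i) = fst (y (i + W))"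
      using tile[of i] tile[of "i + W"] that by (simp_all add: tile_sel mk_tile_def)
  qed
  have lo: "(zl c = None, zr c = None) = (c = 0, Suc c = W)" "fst (y c) = lo c" if "c < W" for c
  proof -
    have "bottom (\<tau> c) = edge_label W lo c" using til that by (simp add: tiling_def)
    then show "(zl c = None, zr c = None) = (c = 0, Suc c = W)" "fst (y c) = lo c"
      using tile[of c] idx[OF R that] by (simp_all add: tile_sel mk_tile_def edge_label_def)
  qed
  have kind: "(zl (t * W + c) = None, zr (t * W + c) = None) = (c = 0, Suc c = W)" if "t < R" "c < W" for t c
    using that
  proof (induction t)
    case (Suc t)
    then have "t * W + c + W < R * W" using idx[of "Suc t" c] by (simp add: algebra_simps)
    from vert(1)[OF this] Suc.IH Suc.prems show ?case by (simp add: add.commute add.left_commute)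
  qed (use lo in simp)
  have nbr: "s (t * W + Suc c) = s (t * W + c)" "zr (t * W + c) = Some (y (t * W + Suc c))"
    "zl (t * W + Suc c) = Some (y (t * W + c))" if "t < R" "Suc c < W" for t c
  proof -
    have "zr (t * W + c) \<noteq> None" using kind[of t c] that by simp
    moreover have "zl (t * W + Suc c) \<noteq> None" using kind[of t "Suc c"] that by simp
    ultimately obtain a b where ab: "zr (t * W + c) = Some a" "zl (t * W + Suc c) = Some b" by blast
    have "Suc (t * W + c) < R * W" using idx[OF that] by simp
    from hor[OF this] ab show "s (t * W + Suc c) = s (t * W + c)" "zr (t * W + c) = Some (y (t * W + Suc c))"
      "zl (t * W + Suc c) = Some (y (t * W + c))"
      by simp_all
  qed
  have sig: "s (t * W + c) = s (t * W)" if "t < R" "c < W" for t c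
    using that
  proof (induction c)
    case (Suc c)
    then show ?case using nbr(1)[of t c] by simp
  qed simp
  have "rows V R W lo (\<lambda>t. s (t * W)) (\<lambda>t c. y (t * W + c))"
    unfolding rows_def
  proof (intro conjI allI impI)
    fix t c assume tc: "t < R" "c < W"
    have "zl (t * W + c) = (if c = 0 then None else Some (y (t * W + (c - 1))))"
    proof (cases c)
      case 0
      then show ?thesis using kind[OF tc] by simp
    next
      case (Suc c')
      then show ?thesis using nbr(3)[of t c'] tc by simp
    qed
    moreover have "zr (t * W + c) = (if Suc c = W then None else Some (y (t * W + Suc c)))"
    proof (cases "Suc c = W")
      case True
      then show ?thesis using kind[OF tc] by simp
    next
      case False
      then show ?thesis using nbr(2)[of t c] tc by simp
    qed
    ultimately show "rule V (s (t * W)) (if c = 0 then None else Some (y (t * W + (c - 1)))) (y (t * W + c))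
        (if Suc c = W then None else Some (y (t * W + Suc c)))"
      using rl[OF idx[OF tc]] sig[OF tc] by simp
  next
    fix t c assume tc: "Suc t < R" "c < W"
    then have "t * W + c + W < R * W" using idx[of "Suc t" c] by (simp add: algebra_simps)
    from vert(2)[OF this] show "fst (y (Suc t * W + c)) = snd (y (t * W + c))"
      by (simp add: add.commute add.left_commute)
  next
    fix c assume c: "c < W"
    show "fst (y (0 * W + c)) = lo c" using lo(2)[OF c] by simp
    have e: "R * W - W + c = (R - 1) * W + c" by (simp add: diff_mult_distrib)
    have "top (\<tau> (R * W - W + c)) = edge_label W (\<lambda>_. Done) c" using til c by (simp add: tiling_def)
    then show "snd (y ((R - 1) * W + c)) = Done"
      using tile[OF idx[of "R - 1" c]] R c unfolding e by (simp add: tile_sel mk_tile_def edge_label_def)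
  qed
  moreover have "s (t * W) \<noteq> GiveUp" if "t < R" for t
    using ng[OF idx[OF that, of 0]] kind[of t 0] that W by auto
  ultimately show thesis using that by blast
qed

definition row_tile :: "nat \<Rightarrow> (nat \<Rightarrow> signal) \<Rightarrow> (nat \<Rightarrow> nat \<Rightarrow> slot) \<Rightarrow> nat \<Rightarrow> (hlabel, vlabel) tile" where
  "row_tile W \<sigma> z i = (let t = i div W; c = i mod W in
     mk_tile (\<sigma> t) (if c = 0 then None else Some (z t (c - 1))) (z t c)
       (if Suc c = W then None else Some (z t (Suc c))))"

lemma rows_tiling:
  assumes W: "2 \<le> W" and R: "0 < R" and r: "rows V R W lo \<sigma> z"
  shows "tiling W (R * W) None (edge_label W lo) (edge_label W (\<lambda>_. Done)) (row_tile W \<sigma> z)"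
proof -
  have W0: "0 < W" using W by simp
  have last: "(R * W - 1) mod W = W - 1"
  proof -
    have "W \<le> R * W" using R by simp
    then have "R * W - 1 = (R - 1) * W + (W - 1)"
      using W by (simp add: diff_mult_distrib)
    moreover have "((R - 1) * W + (W - 1)) mod W = (W - 1) mod W" by (rule mod_mult_self3)
    ultimately show ?thesis using W by (simp del: mod_mult_self3)
  qed
  have "right (row_tile W \<sigma> z i) = left (row_tile W \<sigma> z (Suc i))" for i
  proof (cases "Suc (i mod W) = W")
    case True
    then have "Suc i mod W = 0" by (simp add: mod_Suc)
    then show ?thesis using True by (simp add: row_tile_def Let_def mk_tile_def tile_sel)
  next
    case False
    then have "Suc i mod W = Suc (i mod W)" "Suc i div W = i div W"
      using W0 by (simp_all add: mod_Suc div_Suc)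
    then show ?thesis using False by (simp add: row_tile_def Let_def mk_tile_def tile_sel)
  qed
  moreover have "top (row_tile W \<sigma> z i) = bottom (row_tile W \<sigma> z (i + W))" if "i + W < R * W" for i
  proof -
    have "Suc (i div W) < R"
      using less_mult_imp_div_less[OF that] W0 by simp
    then have "fst (z (Suc (i div W)) (i mod W)) = snd (z (i div W) (i mod W))"
      using r W0 by (simp add: rows_def)
    then show ?thesis using W0 by (simp add: row_tile_def Let_def mk_tile_def tile_sel)
  qed
  moreover have "bottom (row_tile W \<sigma> z c) = edge_label W lo c" if "c < W" for c
    using r that by (auto simp: row_tile_def Let_def mk_tile_def tile_sel edge_label_def rows_def)
  moreover have "top (row_tile W \<sigma> z (R * W - W + c)) = edge_label W (\<lambda>_. Done) c" if "c < W" for c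
  proof -
    have e: "R * W - W + c = (R - 1) * W + c" by (simp add: diff_mult_distrib)
    have "(R * W - W + c) div W = R - 1" "(R * W - W + c) mod W = c" unfolding e using that by simp_all
    then show ?thesis
      using r that by (auto simp: row_tile_def Let_def mk_tile_def tile_sel edge_label_def rows_def)
  qed
  moreover have "left (row_tile W \<sigma> z 0) = None" "right (row_tile W \<sigma> z (R * W - 1)) = None"
    using last W by (simp_all add: row_tile_def Let_def mk_tile_def tile_sel)
  ultimately show ?thesis by (simp add: tiling_def)
qed

lemma row_tile_in_tiles:
  assumes W: "2 \<le> W" and r: "rows V R W lo \<sigma> z" and i: "i < R * W"
    and sl: "\<And>t c. t < R \<Longrightarrow> c < W \<Longrightarrow> z t c \<in> slots V" and sg: "\<And>t. t < R \<Longrightarrow> \<sigma> t \<in> signals V"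
    and ng: "\<not> (\<sigma> (i div W) = GiveUp \<and> i mod W = 0)"
  shows "row_tile W \<sigma> z i \<in> tiles V"
proof -
  define t c where "t = i div W" and "c = i mod W"
  have tc: "t < R" "c < W"
    using i W by (auto simp: t_def c_def less_mult_imp_div_less)
  let ?zl = "if c = 0 then None else Some (z t (c - 1))"
  let ?zr = "if Suc c = W then None else Some (z t (Suc c))"
  have "rule V (\<sigma> t) ?zl (z t c) ?zr" using r tc by (simp add: rows_def)
  moreover have "?zl \<in> end_slots V" "?zr \<in> end_slots V" "z t c \<in> slots V" "\<sigma> t \<in> signals V"
    using tc sl sg by (auto simp: end_slots_def)
  moreover have "row_tile W \<sigma> z i = mk_tile (\<sigma> t) ?zl (z t c) ?zr"
    by (simp add: row_tile_def t_def c_def Let_def)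
  moreover have "\<not> (\<sigma> t = GiveUp \<and> ?zl = None)" using ng by (auto simp: t_def c_def split: if_splits)
  ultimately show ?thesis unfolding tiles_def by blast
qed


subsection \<open>Rows and configurations\<close>

definition config_at :: "tm \<Rightarrow> bool list list \<Rightarrow> nat \<Rightarrow> config" where
  "config_at V xs t = (tm_step V ^^ t) (initial_config V xs)"

definition config_ok :: "tm \<Rightarrow> nat \<Rightarrow> config \<Rightarrow> bool" where
  "config_ok V b c \<longleftrightarrow> fst c < tm_states V \<and> length (snd c) = tm_tapes V \<and>
     (\<forall>j<tm_tapes V. (\<forall>i. fst (snd c ! j) i < tm_symbols V) \<and> \<bar>snd (snd c ! j)\<bar> \<le> int b)"

definition snapshot :: "nat \<Rightarrow> config \<Rightarrow> nat \<Rightarrow> cell" where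
  "snapshot S cfg c =
     Conf (fst cfg) (map (\<lambda>t. (fst t (int c - int S), snd t = int c - int S)) (snd cfg))"

lemma tape_read_fst: "tape_read t = fst t (snd t)"
  by (cases t) simp

lemma tape_action_alt: "tape_action a t = ((fst t)(snd t := fst a), move_head (snd a) (snd t))"
  by (cases t; cases a) simp

lemma config_ok_symbol:
  assumes "config_ok V b c" "t \<in> set (snd c)"
  shows "fst t i < tm_symbols V"
proof -
  from assms(2) obtain j where "j < length (snd c)" "t = snd c ! j" by (auto simp: in_set_conv_nth)
  then show ?thesis using assms(1) by (simp add: config_ok_def)
qed

lemma tm_step_active:
  assumes wf: "tm_wf V" and ok: "config_ok V b c" and act: "\<not> halting V (fst c)"
    and d: "tm_delta V (fst c) (map tape_read (snd c)) = (q', as)"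
  shows "tm_step V c = (q', map2 tape_action as (snd c))" "length as = tm_tapes V"
    "q' < tm_states V" "\<And>j. j < tm_tapes V \<Longrightarrow> fst (as ! j) < tm_symbols V"
proof -
  show "tm_step V c = (q', map2 tape_action as (snd c))"
    using act d by (simp add: tm_step_def)
  have "set (map tape_read (snd c)) \<subseteq> {..<tm_symbols V}"
    using config_ok_symbol[OF ok] by (auto simp: tape_read_fst)
  then have *: "q' < tm_states V \<and> length as = tm_tapes V \<and> fst ` set as \<subseteq> {..<tm_symbols V}"
    using wf ok d unfolding tm_wf_def config_ok_def by (metis length_map)
  then show "length as = tm_tapes V" "q' < tm_states V" by auto
  fix j assume "j < tm_tapes V"
  with * show "fst (as ! j) < tm_symbols V"
    by (metis image_subset_iff lessThan_iff nth_mem)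
qed

lemma config_ok_step:
  assumes wf: "tm_wf V" and ok: "config_ok V b c"
  shows "config_ok V (Suc b) (tm_step V c)"
proof (cases "halting V (fst c)")
  case True
  then show ?thesis using ok by (force simp: tm_step_def config_ok_def)
next
  case False
  obtain q' as where d: "tm_delta V (fst c) (map tape_read (snd c)) = (q', as)" by fastforce
  note s = tm_step_active[OF wf ok False d]
  have "\<bar>move_head m h\<bar> \<le> int (Suc b)" if "\<bar>h\<bar> \<le> int b" for m h
    using that by (cases m) auto
  then show ?thesis
    using ok s by (auto simp: config_ok_def tape_action_alt)
qed

lemma config_ok_initial:
  assumes "tm_wf V"
  shows "config_ok V 0 (initial_config V xs)"
  using assms by (auto simp: config_ok_def initial_config_def tm_wf_def string_tape_def)

lemma config_ok_at: "tm_wf V \<Longrightarrow> config_ok V t (config_at V xs t)"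
  by (induction t) (auto simp: config_at_def config_ok_initial config_ok_step)

lemma config_at_Suc: "config_at V xs (Suc t) = tm_step V (config_at V xs t)"
  by (simp add: config_at_def)

lemma config_at_halted:
  "halting V (fst (config_at V xs s)) \<Longrightarrow> s \<le> t \<Longrightarrow> config_at V xs t = config_at V xs s"
  by (induction t) (auto simp: le_Suc_eq config_at_Suc tm_step_def)

text \<open>After a step a head is in column \<open>c\<close> iff it was there and stayed, or came
  from an adjacent column. At the ends of the row the missing neighbour does no harm: the bound
  \<open>b\<close> on the head positions excludes a head coming from outside.\<close>

lemma snapshot_step:
  assumes wf: "tm_wf V" and ok: "config_ok V b cfg" and act: "\<not> halting V (fst cfg)"
    and d: "tm_delta V (fst cfg) (map tape_read (snd cfg)) = (q', as)"
    and b: "Suc b \<le> S" "S + b + 1 < W" and c: "c < W"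
    and zl: "c > 0 \<Longrightarrow> fst zl = snapshot S cfg (c - 1)" and z: "fst z = snapshot S cfg c"
    and zr: "Suc c < W \<Longrightarrow> fst zr = snapshot S cfg (Suc c)"
  shows "snapshot S (tm_step V cfg) c = Conf q'
    (map (\<lambda>j. let cs = map (\<lambda>t. (fst t (int c - int S), snd t = int c - int S)) (snd cfg) in
      (if snd (cs ! j) then fst (as ! j) else fst (cs ! j),
       arrives as (Some z) j Stay \<or> arrives as (if c = 0 then None else Some zl) j Move_Right \<or>
       arrives as (if Suc c = W then None else Some zr) j Move_Left)) [0..<tm_tapes V])"
proof -
  note s = tm_step_active[OF wf ok act d]
  have len: "length (snd cfg) = tm_tapes V" using ok by (simp add: config_ok_def)
  have arr: "arrives as (Some y) j m \<longleftrightarrow> snd (snd cfg ! j) = int c' - int S \<and> snd (as ! j) = m"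
    if "fst y = snapshot S cfg c'" "j < tm_tapes V" for y c' j m
    using that len by (cases y) (simp add: snapshot_def)
  show ?thesis
    unfolding s(1) snapshot_def Let_def
  proof (simp only: fst_conv snd_conv cell.inject simp_thms, rule nth_equalityI)
    fix j assume "j < length (map (\<lambda>t. (fst t (int c - int S), snd t = int c - int S)) (map2 tape_action as (snd cfg)))"
    then have j: "j < tm_tapes V" using s(2) len by simp
    define h m where "h = snd (snd cfg ! j)" and "m = snd (as ! j)"
    have hb: "\<bar>h\<bar> \<le> int b" using ok j by (simp add: config_ok_def h_def)
    have 1: "arrives as (Some z) j Stay \<longleftrightarrow> h = int c - int S \<and> m = Stay"
      using arr[OF z j] by (simp add: h_def m_def)
    have 2: "arrives as (if c = 0 then None else Some zl) j Move_Right \<longleftrightarrow> h + 1 = int c - int S \<and> m = Move_Right"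
    proof (cases "c = 0")
      case True
      then show ?thesis using hb b by auto
    next
      case False
      then have "arrives as (Some zl) j Move_Right \<longleftrightarrow> h = int (c - 1) - int S \<and> m = Move_Right"
        using arr[OF zl j] by (simp add: h_def m_def)
      then show ?thesis using False by (auto simp: of_nat_diff)
    qed
    have 3: "arrives as (if Suc c = W then None else Some zr) j Move_Left \<longleftrightarrow> h - 1 = int c - int S \<and> m = Move_Left"
    proof (cases "Suc c = W")
      case True
      then show ?thesis using hb b by auto
    next
      case False
      then have "arrives as (Some zr) j Move_Left \<longleftrightarrow> h = int (Suc c) - int S \<and> m = Move_Left"
        using arr[OF zr j] c by (simp add: h_def m_def)
      then show ?thesis using False by auto
    qed
    have mv: "move_head m h = int c - int S \<longleftrightarrow> (h = int c - int S \<and> m = Stay) \<or>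
        (h + 1 = int c - int S \<and> m = Move_Right) \<or> (h - 1 = int c - int S \<and> m = Move_Left)"
      by (cases m) auto
    show "map (\<lambda>t. (fst t (int c - int S), snd t = int c - int S)) (map2 tape_action as (snd cfg)) ! j =
      map (\<lambda>j. (if snd (map (\<lambda>t. (fst t (int c - int S), snd t = int c - int S)) (snd cfg) ! j) then fst (as ! j)
         else fst (map (\<lambda>t. (fst t (int c - int S), snd t = int c - int S)) (snd cfg) ! j),
       arrives as (Some z) j Stay \<or> arrives as (if c = 0 then None else Some zl) j Move_Right \<or>
       arrives as (if Suc c = W then None else Some zr) j Move_Left)) [0..<tm_tapes V] ! j"
      using j s(2) len by (simp add: 1 2 3 mv tape_action_alt flip: h_def m_def)
  qed (use s(2) len in simp)
qed

definition input_cell :: "bool list \<Rightarrow> nat \<Rightarrow> nat \<Rightarrow> nat \<Rightarrow> cell" where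
  "input_cell x S p c = Init (fst (string_tape x) (int c - int S)) (S \<le> c \<and> c < S + p) (c = S)"

lemma snapshot_initial:
  assumes "2 \<le> tm_tapes V"
  shows "snapshot S (initial_config V [x, u]) c = Conf (tm_start V)
    ((fst (string_tape x) (int c - int S), c = S) # (fst (string_tape u) (int c - int S), c = S) #
      replicate (tm_tapes V - 2) (0, c = S))"
proof -
  obtain k where k: "tm_tapes V = Suc (Suc k)" using assms that[of "tm_tapes V - 2"] by simp
  have "[0..<Suc (Suc k)] = 0 # 1 # map (\<lambda>i. i + 2) [0..<k]"
    by (rule nth_equalityI) (auto simp: nth_Cons simp del: upt_Suc split: nat.splits)
  moreover have "map (\<lambda>i. (0 :: nat, c = S)) [0..<k] = replicate k (0, c = S)"
    by (simp add: map_replicate_const)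
  moreover have "snd (string_tape y) = int c - int S \<longleftrightarrow> c = S" "fst (string_tape []) i = 0" for y i
    by (auto simp: string_tape_def)
  ultimately show ?thesis
    by (simp add: snapshot_def initial_config_def k o_def del: upt_Suc)
qed

text \<open>Column \<open>S\<close> shows cell 0 of every tape. A head moves by at most one column
  per row, so with at least \<open>R\<close> columns on either side no head leaves the window during
  \<open>R\<close> rows.\<close>

locale window =
  fixes V :: tm and x :: "bool list" and p S R W :: nat
  assumes wf: "tm_wf V" and R: "2 \<le> R" "R \<le> S" "S + R < W" and p: "S + p < W"
begin

lemma rows_sound:
  assumes rows: "rows V R W (input_cell x S p) \<sigma> z" and ng: "\<And>t. t < R \<Longrightarrow> \<sigma> t \<noteq> GiveUp"
  obtains u s where "length u \<le> p" "s + 2 \<le> R" "tm_state_after V [x, u] s = tm_accept V"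
proof -
  let ?zl = "\<lambda>t c. if c = 0 then None else Some (z t (c - 1))"
  let ?zr = "\<lambda>t c. if Suc c = W then None else Some (z t (Suc c))"
  have K: "2 \<le> tm_tapes V" using wf by (simp add: tm_wf_def)
  have rl: "rule V (\<sigma> t) (?zl t c) (z t c) (?zr t c)" if "t < R" "c < W" for t c
    using rows that unfolding rows_def by blast
  have up: "fst (z (Suc t) c) = snd (z t c)" if "Suc t < R" "c < W" for t c
    using rows that unfolding rows_def by blast
  have lo: "fst (z 0 c) = input_cell x S p c" "snd (z (R - 1) c) = Done" if "c < W" for c
    using rows that unfolding rows_def by blast+
  \<comment> \<open>The lower border holds \<open>Init\<close> cells, which only
    \<open>Guess\<close> and the excluded \<open>GiveUp\<close> can process.\<close>
  have "\<sigma> 0 = Guess"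
  proof (cases "\<sigma> 0")
    case (Step ss)
    then show ?thesis using rl[of 0 0] R lo(1)[of 0] by (simp add: input_cell_def)
  next
    case Finish
    then show ?thesis using rl[of 0 0] R lo(1)[of 0] by (simp add: input_cell_def)
  qed (use ng R in auto)
  have "\<exists>s. snd (z 0 c) = Conf (tm_start V)
      ((fst (string_tape x) (int c - int S), c = S) # (s, c = S) # replicate (tm_tapes V - 2) (0, c = S)) \<and>
      s \<le> 2 \<and> (s \<noteq> 0 \<longrightarrow> (S \<le> c \<and> c < S + p) \<and> (c = S \<or> guessed (?zl 0 c) \<noteq> 0))" if "c < W" for c
    using rl[of 0 c] \<open>\<sigma> 0 = Guess\<close> lo(1)[OF that] R that by (cases "z 0 c") (simp add: input_cell_def)
  then have "\<forall>c. \<exists>s. c < W \<longrightarrow> snd (z 0 c) = Conf (tm_start V)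
      ((fst (string_tape x) (int c - int S), c = S) # (s, c = S) # replicate (tm_tapes V - 2) (0, c = S)) \<and>
      s \<le> 2 \<and> (s \<noteq> 0 \<longrightarrow> (S \<le> c \<and> c < S + p) \<and> (c = S \<or> guessed (?zl 0 c) \<noteq> 0))" by blast
  from choice[OF this] obtain g where g: "\<forall>c. c < W \<longrightarrow> snd (z 0 c) = Conf (tm_start V)
      ((fst (string_tape x) (int c - int S), c = S) # (g c, c = S) # replicate (tm_tapes V - 2) (0, c = S)) \<and>
      g c \<le> 2 \<and> (g c \<noteq> 0 \<longrightarrow> (S \<le> c \<and> c < S + p) \<and> (c = S \<or> guessed (?zl 0 c) \<noteq> 0))" ..
  have g1: "snd (z 0 c) = Conf (tm_start V)
      ((fst (string_tape x) (int c - int S), c = S) # (g c, c = S) # replicate (tm_tapes V - 2) (0, c = S))"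
    and g2: "g c \<le> 2" and g3: "g c \<noteq> 0 \<Longrightarrow> S \<le> c \<and> c < S + p"
    and g4: "g c \<noteq> 0 \<Longrightarrow> c = S \<or> guessed (?zl 0 c) \<noteq> 0" if "c < W" for c
    using g that by blast+
  have g5: "g (S + k) \<noteq> 0" if "g (S + Suc k) \<noteq> 0" "S + Suc k < W" for k
  proof -
    have "guessed (Some (z 0 (S + k))) \<noteq> 0" using g4[of "S + Suc k"] that by simp
    then show ?thesis using g1[of "S + k"] that by (cases "z 0 (S + k)") simp
  qed
  \<comment> \<open>The guess has no gaps, so its nonblank symbols are those before the first blank
    one and \<open>m\<close> is the length of the certificate. A blank exists because guessing is
    forbidden from column \<open>S + p\<close> on.\<close>
  define m where "m = (LEAST k. g (S + k) = 0)"
  have gp: "g (S + p) = 0" using g3[of "S + p"] p by auto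
  have m: "m \<le> p" "g (S + m) = 0"
    unfolding m_def using gp by (rule Least_le, rule LeastI)
  have gm: "g (S + k) \<noteq> 0" if "k < m" for k
    using that not_less_Least unfolding m_def by blast
  have gz: "g (S + k) = 0" if "m \<le> k" "S + k < W" for k
    using that
  proof (induction k rule: dec_induct)
    case (step k)
    then show ?case using g5[of k] by auto
  qed (use m in simp)
  define u where "u = map (\<lambda>k. g (S + k) = 2) [0..<m]"
  have gu: "g c = fst (string_tape u) (int c - int S)" if c: "c < W" for c
  proof (cases "S \<le> c")
    case True
    then obtain k where k: "c = S + k" using le_Suc_ex by blast
    show ?thesis
    proof (cases "k < m")
      case True
      then have "g (S + k) \<noteq> 0" "g (S + k) \<le> 2" using gm g2[OF c] k by auto
      then have "g (S + k) = 1 \<or> g (S + k) = 2" by linarith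
      then show ?thesis using True k by (auto simp: string_tape_def u_def)
    next
      case False
      then show ?thesis using gz[of k] k c by (simp add: string_tape_def u_def)
    qed
  next
    case False
    then show ?thesis using g3[OF c] by (auto simp: string_tape_def)
  qed
  have u: "length u \<le> p" using m by (simp add: u_def)
  let ?cf = "config_at V [x, u]"
  \<comment> \<open>The rows follow the run only up to acceptance and may be \<open>Done\<close>
    afterwards; the first alternative allows for that. The 2 stands for the guessing row and the
    finishing row.\<close>
  have inv: "(\<exists>s. s + 2 \<le> R \<and> fst (?cf s) = tm_accept V) \<or> (\<forall>c<W. snd (z t c) = snapshot S (?cf t) c)"
    if "Suc t < R" for t
    using that
  proof (induction t)
    case 0
    have "snd (z 0 c) = snapshot S (?cf 0) c" if "c < W" for c
      unfolding config_at_def using g1[OF that] gu[OF that] snapshot_initial[OF K, of S x u c] by simp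
    then show ?case by blast
  next
    case (Suc t)
    show ?case
    proof (cases "\<exists>s. s + 2 \<le> R \<and> fst (?cf s) = tm_accept V")
      case False
      then have sn: "fst (z (Suc t) c) = snapshot S (?cf t) c" if "c < W" for c
        using Suc.IH Suc.prems up[of t c] that False by auto
      have nacc: "fst (?cf t) \<noteq> tm_accept V" using False Suc.prems by auto
      have W0: "0 < W" using R by simp
      obtain ss where ss: "\<sigma> (Suc t) = Step ss"
      proof (cases "\<sigma> (Suc t)")
        case Guess
        then show thesis using rl[of "Suc t" 0] sn[of 0] Suc.prems W0 by (auto simp: snapshot_def)
      next
        case Finish
        then show thesis using rl[of "Suc t" 0] sn[of 0] Suc.prems W0 nacc by (auto simp: snapshot_def)
      next
        case GiveUp
        then show thesis using ng[of "Suc t"] Suc.prems by auto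
      qed
      define cs where "cs c = map (\<lambda>t. (fst t (int c - int S), snd t = int c - int S)) (snd (?cf t))" for c
      have sncs: "snapshot S (?cf t) c = Conf (fst (?cf t)) (cs c)" for c by (simp add: snapshot_def cs_def)
      obtain q' as where d: "tm_delta V (fst (?cf t)) ss = (q', as)" by fastforce
      have ssl: "length ss = tm_tapes V"
        using rl[of "Suc t" 0] W0 Suc.prems unfolding ss by simp
      have st: "\<not> halting V (fst (?cf t))"
        "\<forall>j<tm_tapes V. snd (cs c ! j) \<longrightarrow> fst (cs c ! j) = ss ! j"
        "snd (z (Suc t) c) = Conf q' (map (\<lambda>j. (if snd (cs c ! j) then fst (as ! j) else fst (cs c ! j),
       arrives as (Some (z (Suc t) c)) j Stay \<or> arrives as (?zl (Suc t) c) j Move_Right \<or>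
       arrives as (?zr (Suc t) c) j Move_Left)) [0..<tm_tapes V])" if "c < W" for c
        using rl[of "Suc t" c] that sn[OF that] Suc.prems d unfolding ss sncs by auto
      have ok: "config_ok V t (?cf t)" by (rule config_ok_at[OF wf])
      have len: "length (snd (?cf t)) = tm_tapes V" using ok by (simp add: config_ok_def)
      \<comment> \<open>Entry \<open>j\<close> of the announced tuple is checked by the column under
        head \<open>j\<close>, and that column lies in the window.\<close>
      have rd: "ss ! j = tape_read (snd (?cf t) ! j)" if j: "j < tm_tapes V" for j
      proof -
        define h where "h = snd (snd (?cf t) ! j)"
        have hb: "\<bar>h\<bar> \<le> int t" using ok j by (simp add: config_ok_def h_def)
        define c where "c = nat (int S + h)"
        have c: "int c = int S + h" "c < W" using hb Suc.prems R by (auto simp: c_def)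
        have "cs c ! j = (fst (snd (?cf t) ! j) h, True)"
          using j len c(1) by (simp add: cs_def h_def)
        then show ?thesis using st(2)[OF c(2), rule_format, OF j] by (simp add: tape_read_fst h_def)
      qed
      have d': "tm_delta V (fst (?cf t)) (map tape_read (snd (?cf t))) = (q', as)"
      proof -
        have "ss = map tape_read (snd (?cf t))"
          using ssl len rd by (intro nth_equalityI) auto
        with d show ?thesis by simp
      qed
      have "snd (z (Suc t) c) = snapshot S (?cf (Suc t)) c" if c: "c < W" for c
        unfolding config_at_Suc st(3)[OF c]
        by (subst snapshot_step[OF wf ok _ d', where W = W and zl = "z (Suc t) (c - 1)" and z = "z (Suc t) c"
              and zr = "z (Suc t) (Suc c)"])
          (use st(1)[OF c] sn c R Suc.prems in \<open>auto simp: cs_def Let_def\<close>)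
      then show ?thesis by blast
    qed blast
  qed
  \<comment> \<open>Column 0 of the last row would turn a configuration into \<open>Done\<close>.
    From a configuration only \<open>Finish\<close> does that, and it demands the accepting
    state.\<close>
  have fin: "\<exists>s. s + 2 \<le> R \<and> fst (?cf s) = tm_accept V"
  proof (rule ccontr)
    assume neg: "\<not> ?thesis"
    have R1: "Suc (R - 2) < R" "Suc (R - 2) = R - 1" using R by auto
    have W0: "0 < W" using R by simp
    have "fst (z (R - 1) 0) = snapshot S (?cf (R - 2)) 0"
      using inv[OF R1(1)] neg up[OF R1(1) W0] W0 R1(2) by auto
    moreover have "snd (z (R - 1) 0) = Done" using lo(2)[OF W0] .
    moreover have "rule V (\<sigma> (R - 1)) (?zl (R - 1) 0) (z (R - 1) 0) (?zr (R - 1) 0)"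
      using rl[of "R - 1" 0] R W0 by simp
    moreover have "fst (?cf (R - 2)) \<noteq> tm_accept V" using neg R by auto
    ultimately show False by (cases "\<sigma> (R - 1)") (auto simp: snapshot_def)
  qed
  then obtain s where "s + 2 \<le> R" "fst (?cf s) = tm_accept V" by blast
  then show thesis using that[OF u] by (simp add: tm_state_after_def config_at_def)
qed

definition stage :: "bool list \<Rightarrow> nat \<Rightarrow> nat \<Rightarrow> nat \<Rightarrow> cell" where
  "stage u s t c = (if t = 0 then input_cell x S p c
     else if t \<le> Suc s then snapshot S (config_at V [x, u] (t - 1)) c else Done)"

lemma rows_complete:
  assumes u: "length u \<le> p" and s: "s + 2 \<le> R" and acc: "tm_state_after V [x, u] s = tm_accept V"
  obtains \<sigma> z where "rows V R W (input_cell x S p) \<sigma> z" "\<And>t. t < R \<Longrightarrow> \<sigma> t \<noteq> GiveUp"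
    "\<And>t c. t < R \<Longrightarrow> c < W \<Longrightarrow> z t c \<in> slots V" "\<And>t. t < R \<Longrightarrow> \<sigma> t \<in> signals V"
proof -
  let ?cf = "config_at V [x, u]"
  have K: "2 \<le> tm_tapes V" using wf by (simp add: tm_wf_def)
  \<comment> \<open>A \<open>Step\<close> row starts from a non-halting configuration only, so the
    tiling must follow the run to its first accepting time and no further.\<close>
  define s0 where "s0 = (LEAST s. fst (?cf s) = tm_accept V)"
  have acc': "fst (?cf s) = tm_accept V" using acc by (simp add: tm_state_after_def config_at_def)
  have "s0 \<le> s" unfolding s0_def by (rule Least_le) (rule acc')
  moreover have "fst (?cf s0) = tm_accept V"
    unfolding s0_def by (rule LeastI[where P = "\<lambda>t. fst (?cf t) = tm_accept V"]) (rule acc')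
  ultimately have s0: "fst (?cf s0) = tm_accept V" "s0 + 2 \<le> R" using s by linarith+
  have act: "\<not> halting V (fst (?cf t))" if "t < s0" for t
  proof
    assume h: "halting V (fst (?cf t))"
    then have "fst (?cf s0) = fst (?cf t)" using config_at_halted[OF h, of s0] that by simp
    then have "fst (?cf t) = tm_accept V" using s0(1) by simp
    then show False using not_less_Least[of t "\<lambda>s. fst (?cf s) = tm_accept V"] that by (simp add: s0_def)
  qed
  define z where "z t c = (stage u s0 t c, stage u s0 (Suc t) c)" for t c
  define reads where "reads t = map tape_read (snd (?cf t))" for t
  define \<sigma> where "\<sigma> t = (if t = 0 then Guess else if t \<le> s0 then Step (reads (t - 1)) else Finish)" for t
  have ok: "config_ok V t (?cf t)" for t by (rule config_ok_at[OF wf])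
  have sl: "stage u s0 t c \<in> cells V" for t c
    using ok[of "t - 1"] config_ok_symbol[OF ok[of "t - 1"]]
    by (auto simp: stage_def cells_def input_cell_def snapshot_def config_ok_def string_tape_def)
  have sg: "\<sigma> t \<in> signals V" for t
    using ok[of "t - 1"] config_ok_symbol[OF ok[of "t - 1"]]
    by (auto simp: \<sigma>_def signals_def reads_def config_ok_def tape_read_fst)
  let ?zl = "\<lambda>t c. if c = 0 then None else Some (z t (c - 1))"
  let ?zr = "\<lambda>t c. if Suc c = W then None else Some (z t (Suc c))"
  have "rule V (\<sigma> t) (?zl t c) (z t c) (?zr t c)" if t: "t < R" and c: "c < W" for t c
  proof -
    consider "t = 0" | "0 < t" "t \<le> s0" | "s0 < t" by linarith
    then show ?thesis
    proof cases
      case 1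
      let ?g = "fst (string_tape u) (int c - int S)"
      have z0: "z 0 c = (input_cell x S p c, Conf (tm_start V)
        ((fst (string_tape x) (int c - int S), c = S) # (fst (string_tape u) (int c - int S), c = S) #
         replicate (tm_tapes V - 2) (0, c = S)))" for c
        using snapshot_initial[OF K, of S x u c] by (simp add: z_def stage_def config_at_def)
      have g2: "?g \<le> 2" by (simp add: string_tape_def)
      have ru: "rule V Guess l (z 0 c) l'"
        if "?g \<noteq> 0 \<longrightarrow> (S \<le> c \<and> c < S + p) \<and> (c = S \<or> guessed l \<noteq> 0)" for l l'
        using that z0[of c] g2 by (simp add: input_cell_def)
      have "(S \<le> c \<and> c < S + p) \<and> (c = S \<or> guessed (?zl 0 c) \<noteq> 0)" if "?g \<noteq> 0"
      proof -
        have k: "S \<le> c" "c < S + length u" using that by (auto simp: string_tape_def split: if_splits)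
        have "guessed (?zl 0 c) \<noteq> 0" if "c \<noteq> S"
        proof -
          have "int (c - 1) - int S = int (c - 1 - S)" using k that by auto
          then have "fst (string_tape u) (int (c - 1) - int S) \<noteq> 0" using k that by (auto simp: string_tape_def)
          then show ?thesis using k that z0[of "c - 1"] by simp
        qed
        moreover have "c < S + p" using k u by simp
        ultimately show ?thesis using k by blast
      qed
      then have "rule V Guess (?zl 0 c) (z 0 c) (?zr 0 c)" by (intro ru) blast
      moreover have "\<sigma> 0 = Guess" by (simp add: \<sigma>_def)
      ultimately show ?thesis unfolding \<open>t = 0\<close> by (simp only:)
    next
      case 2
      then obtain t' where t': "t = Suc t'" "t' < s0" by (cases t) auto
      obtain q' as where d: "tm_delta V (fst (?cf t')) (reads t') = (q', as)" by fastforce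
      have zt: "fst (z t c) = snapshot S (?cf t') c" for c using t' by (simp add: z_def stage_def)
      have zt': "snd (z t c) = snapshot S (?cf (Suc t')) c" using t' by (simp add: z_def stage_def)
      define cs where "cs = map (\<lambda>t. (fst t (int c - int S), snd t = int c - int S)) (snd (?cf t'))"
      have sn: "fst (z t c) = Conf (fst (?cf t')) cs" by (simp add: zt snapshot_def cs_def)
      have len: "length (snd (?cf t')) = tm_tapes V" using ok[of t'] by (simp add: config_ok_def)
      have rd: "\<forall>j<tm_tapes V. snd (cs ! j) \<longrightarrow> fst (cs ! j) = reads t' ! j"
        using len by (auto simp: cs_def reads_def tape_read_fst)
      have bd: "Suc t' \<le> S" "S + t' + 1 < W" using t' s0(2) R by auto
      have "snd (z t c) = Conf q' (map (\<lambda>j. (if snd (cs ! j) then fst (as ! j) else fst (cs ! j),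
       arrives as (Some (z t c)) j Stay \<or> arrives as (?zl t c) j Move_Right \<or>
       arrives as (?zr t c) j Move_Left)) [0..<tm_tapes V])"
        unfolding zt' config_at_Suc
        by (subst snapshot_step[OF wf ok act[OF t'(2)] d[unfolded reads_def] bd c, where
              zl = "z t (c - 1)" and z = "z t c" and zr = "z t (Suc c)"])
          (auto simp: zt cs_def Let_def)
      then show ?thesis
        using 2 t' sn rd act[OF t'(2)] d len by (simp add: \<sigma>_def) (simp add: reads_def)
    next
      case 3
      then show ?thesis using s0(1)
        by (cases "t = Suc s0") (auto simp: \<sigma>_def z_def stage_def snapshot_def)
    qed
  qed
  moreover have "snd (z (R - 1) c) = Done" for c using s0(2) by (simp add: z_def stage_def)
  ultimately have "rows V R W (input_cell x S p) \<sigma> z"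
    by (simp add: rows_def z_def stage_def[of _ _ 0])
  then show thesis using that[of \<sigma> z] sl sg by (simp add: slots_def z_def \<sigma>_def)
qed

lemma rows_give_up:
  obtains \<sigma> z where "rows V R W (input_cell x S p) \<sigma> z" "\<And>t. \<sigma> t = GiveUp \<longleftrightarrow> t = 0"
    "\<And>t c. z t c \<in> slots V" "\<And>t. \<sigma> t \<in> signals V"
    "\<And>c. z 0 c = (input_cell x S p c, Done)"
proof -
  define z where "z t c = (if t = 0 then input_cell x S p c else Done, Done)" for t c :: nat
  define \<sigma> where "\<sigma> t = (if t = 0 then GiveUp else Finish)" for t :: nat
  have "rows V R W (input_cell x S p) \<sigma> z"
    by (auto simp: rows_def z_def \<sigma>_def input_cell_def)
  then show thesis
    using that[of \<sigma> z] by (auto simp: z_def \<sigma>_def slots_def cells_def signals_def input_cell_def string_tape_def)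
qed

end


text \<open>The 2 is for the guessing row and the finishing row. The summands
  \<open>length x + poly p (length x)\<close> put the last column beyond the input, so that its
  border label is a constant.\<close>

definition row_count :: "nat poly \<Rightarrow> nat poly \<Rightarrow> bool list \<Rightarrow> nat" where
  "row_count p r x = poly r (length x + poly p (length x)) + length x + poly p (length x) + 2"

text \<open>With \<open>Z\<close> rows these are \<open>Suc Z\<close> columns, then
  \<open>poly p (length x)\<close> columns for the certificate from tape cell 0 on, then again
  \<open>Suc Z\<close> columns.\<close>

definition row_width :: "nat poly \<Rightarrow> nat poly \<Rightarrow> bool list \<Rightarrow> nat" where
  "row_width p r x = 2 * row_count p r x + poly p (length x) + 2"

definition input_row :: "nat poly \<Rightarrow> nat poly \<Rightarrow> bool list \<Rightarrow> nat \<Rightarrow> cell" where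
  "input_row p r x = input_cell x (Suc (row_count p r x)) (poly p (length x))"

definition run_tiling :: "nat poly \<Rightarrow> nat poly \<Rightarrow> bool list \<Rightarrow> (nat \<Rightarrow> (hlabel, vlabel) tile) \<Rightarrow> bool" where
  "run_tiling p r x \<tau> \<longleftrightarrow> tiling (row_width p r x) (row_count p r x * row_width p r x) None
     (edge_label (row_width p r x) (input_row p r x)) (edge_label (row_width p r x) (\<lambda>_. Done)) \<tau>"


theorem in_NP_tiling:
  assumes "in_NP A"
  obtains V p r where "tm_wf V"
    "\<And>x. x \<in> A \<longleftrightarrow> (\<exists>\<tau>. run_tiling p r x \<tau> \<and> (\<forall>i<row_count p r x * row_width p r x. \<tau> i \<in> tiles V))"
    "\<And>x. \<exists>\<tau>. run_tiling p r x \<tau> \<and> \<tau> 0 = give_up_tile \<and>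
       (\<forall>i<row_count p r x * row_width p r x. 0 < i \<longrightarrow> \<tau> i \<in> tiles V)"
proof -
  from assms obtain V :: tm and p r :: "nat poly" where *: "tm_wf V \<and>
      (\<forall>x u. halting V (tm_state_after V [x, u] (poly r (length x + length u)))) \<and>
      (\<forall>x. x \<in> A \<longleftrightarrow> (\<exists>u. length u \<le> poly p (length x) \<and>
        tm_state_after V [x, u] (poly r (length x + length u)) = tm_accept V))"
    unfolding in_NP_def by (elim exE) (rule that)
  then have wf: "tm_wf V"
    and halt: "\<And>x u. halting V (tm_state_after V [x, u] (poly r (length x + length u)))"
    and acc: "\<And>x. x \<in> A \<longleftrightarrow> (\<exists>u. length u \<le> poly p (length x) \<and>
      tm_state_after V [x, u] (poly r (length x + length u)) = tm_accept V)"
    by simp_all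
  define R where "R = row_count p r"
  define W where "W = row_width p r"
  define P where "P x = poly p (length x)" for x :: "bool list"
  have win: "window V (P x) (Suc (R x)) (R x) (W x)" for x
    using wf by unfold_locales (auto simp: R_def W_def P_def row_count_def row_width_def)
  have W2: "2 \<le> W x" and R0: "0 < R x" for x
    by (auto simp: R_def W_def row_count_def row_width_def)
  have til: "run_tiling p r x \<tau> \<longleftrightarrow> tiling (W x) (R x * W x) None
     (edge_label (W x) (input_cell x (Suc (R x)) (P x))) (edge_label (W x) (\<lambda>_. Done)) \<tau>" for x \<tau>
    by (simp add: run_tiling_def R_def W_def P_def input_row_def)
  have 1: "x \<in> A \<longleftrightarrow> (\<exists>\<tau>. run_tiling p r x \<tau> \<and> (\<forall>i<R x * W x. \<tau> i \<in> tiles V))" for x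
  proof
    assume "x \<in> A"
    then obtain u where u: "length u \<le> P x"
      "tm_state_after V [x, u] (poly r (length x + length u)) = tm_accept V"
      using acc by (auto simp: P_def)
    have le: "poly r (length x + length u) + 2 \<le> R x"
      using poly_nat_mono[of "length x + length u" "length x + P x" r] u(1)
      by (simp add: R_def row_count_def P_def)
    obtain \<sigma> z where
      rz: "rows V (R x) (W x) (input_cell x (Suc (R x)) (P x)) \<sigma> z" and
      ng: "\<And>t. t < R x \<Longrightarrow> \<sigma> t \<noteq> GiveUp" and
      mem: "\<And>t c. t < R x \<Longrightarrow> c < W x \<Longrightarrow> z t c \<in> slots V" "\<And>t. t < R x \<Longrightarrow> \<sigma> t \<in> signals V"
      by (rule window.rows_complete[OF win u(1) le u(2)]) (rule that; blast)
    have "row_tile (W x) \<sigma> z i \<in> tiles V" if "i < R x * W x" for i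
      using row_tile_in_tiles[OF W2 rz that mem] ng[of "i div W x"] that
      by (auto simp: less_mult_imp_div_less)
    then show "\<exists>\<tau>. run_tiling p r x \<tau> \<and> (\<forall>i<R x * W x. \<tau> i \<in> tiles V)"
      using rows_tiling[OF W2 R0 rz] til by blast
  next
    assume "\<exists>\<tau>. run_tiling p r x \<tau> \<and> (\<forall>i<R x * W x. \<tau> i \<in> tiles V)"
    then obtain \<tau> where tau: "run_tiling p r x \<tau>" "\<And>i. i < R x * W x \<Longrightarrow> \<tau> i \<in> tiles V" by blast
    obtain \<sigma> z where
      rz: "rows V (R x) (W x) (input_cell x (Suc (R x)) (P x)) \<sigma> z" "\<And>t. t < R x \<Longrightarrow> \<sigma> t \<noteq> GiveUp"
    proof (rule tiling_rows[OF W2 R0 tau(1)[unfolded til] tau(2)])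
      fix \<sigma> z
      assume a: "rows V (R x) (W x) (input_cell x (Suc (R x)) (P x)) \<sigma> z" and b: "\<And>t. t < R x \<Longrightarrow> \<sigma> t \<noteq> GiveUp"
      show thesis by (rule that[OF a b])
    qed
    obtain u s where
      u: "length u \<le> P x" and s: "tm_state_after V [x, u] s = tm_accept V"
    proof (rule window.rows_sound[OF win rz])
      fix u s
      assume a: "length u \<le> P x" and b: "tm_state_after V [x, u] s = tm_accept V"
      show thesis by (rule that[OF a b])
    qed
    define s' where "s' = poly r (length x + length u)"
    \<comment> \<open>The tiling gives acceptance at some time \<open>s\<close>, while membership
      asks for the time of the clock. Both configurations are halting, and one is reached from the
      other, so they coincide.\<close>
    have h: "halting V (fst (config_at V [x, u] s))" "halting V (fst (config_at V [x, u] s'))"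
      using s halt[of x u] by (simp_all add: halting_def tm_state_after_def config_at_def s'_def)
    have "config_at V [x, u] s' = config_at V [x, u] s"
    proof (cases "s \<le> s'")
      case True
      then show ?thesis by (rule config_at_halted[OF h(1)])
    next
      case False
      then have "s' \<le> s" by simp
      from config_at_halted[OF h(2) this] show ?thesis by (rule sym)
    qed
    then have "tm_state_after V [x, u] s' = tm_accept V"
      using s by (simp add: tm_state_after_def config_at_def)
    then show "x \<in> A" using acc u by (auto simp: P_def s'_def)
  qed
  have 2: "\<exists>\<tau>. run_tiling p r x \<tau> \<and> \<tau> 0 = give_up_tile \<and> (\<forall>i<R x * W x. 0 < i \<longrightarrow> \<tau> i \<in> tiles V)" for x
  proof -
    obtain \<sigma> z where
      rz: "rows V (R x) (W x) (input_cell x (Suc (R x)) (P x)) \<sigma> z" and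
      g: "\<And>t. \<sigma> t = GiveUp \<longleftrightarrow> t = 0" and
      mem: "\<And>t c. z t c \<in> slots V" "\<And>t. \<sigma> t \<in> signals V" and
      z0: "\<And>c. z 0 c = (input_cell x (Suc (R x)) (P x) c, Done)"
    proof (rule window.rows_give_up[where x = x, OF win[of x]])
      fix \<sigma> z
      assume a: "rows V (R x) (W x) (input_cell x (Suc (R x)) (P x)) \<sigma> z"
        and b: "\<And>t. \<sigma> t = GiveUp \<longleftrightarrow> t = 0" and c: "\<And>t c. z t c \<in> slots V" and d: "\<And>t. \<sigma> t \<in> signals V"
        and e: "\<And>c. z 0 c = (input_cell x (Suc (R x)) (P x) c, Done)"
      show thesis by (rule that) (use a b c d e in blast)+
    qed
    have "row_tile (W x) \<sigma> z i \<in> tiles V" if "i < R x * W x" "0 < i" for i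
    proof (rule row_tile_in_tiles[OF W2 rz that(1) mem])
      show "\<not> (\<sigma> (i div W x) = GiveUp \<and> i mod W x = 0)"
        using that(2) g by (metis add_0 mod_mult_div_eq mult_0_right neq0_conv)
    qed
    moreover have "row_tile (W x) \<sigma> z 0 = give_up_tile"
    proof -
      have "Suc 0 \<noteq> W x" "1 < Suc (R x)" using W2[of x] R0[of x] by auto
      then show ?thesis using g[of 0]
        by (auto simp: row_tile_def give_up_tile_def z0 input_cell_def string_tape_def)
    qed
    ultimately show ?thesis using rows_tiling[OF W2 R0 rz] til by blast
  qed
  show thesis using that[OF wf] 1 2 unfolding R_def W_def by blast
qed


section \<open>Subset sums as average opinions\<close>

text \<open>No path of two edges stays inside \<open>F\<close>, so \<open>A\<close> restricted to
  \<open>F\<close> squares to zero and the Neumann series for the inverse of \<open>d - A\<close>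
  ends after its linear term.\<close>

lemma two_level_block_inverse:
  fixes A :: "'v \<Rightarrow> 'v \<Rightarrow> real"
  assumes F: "finite F" and d: "\<And>u. u \<in> F \<Longrightarrow> d u \<noteq> 0"
    and M: "\<And>u v. u \<in> F \<Longrightarrow> v \<in> F \<Longrightarrow> M u v = (if u = v then d u else 0) - A u v"
    and A: "\<And>u v w. u \<in> F \<Longrightarrow> v \<in> F \<Longrightarrow> w \<in> F \<Longrightarrow> A u v * A v w = 0"
  shows "is_block_inverse F M (\<lambda>u v. (if u = v then 1 / d u else 0) + A u v / (d u * d v))"
proof -
  let ?N = "\<lambda>u v. (if u = v then 1 / d u else 0) + A u v / (d u * d v)"
  have 1: "(\<Sum>z\<in>F. M u z * ?N z v) = (if u = v then 1 else 0)" if u: "u \<in> F" and v: "v \<in> F" for u v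
  proof -
    have "M u z * ?N z v = (if z = u then d u * ?N u v else 0) - (if z = v then A u v / d v else 0)"
      if z: "z \<in> F" for z
    proof -
      have "A u z * (A z v / (d z * d v)) = 0" using A[OF u z v] by simp
      then show ?thesis unfolding M[OF u z] using d[OF z] d[OF u] by (auto simp: algebra_simps)
    qed
    then have "(\<Sum>z\<in>F. M u z * ?N z v) =
        (\<Sum>z\<in>F. (if z = u then d u * ?N u v else 0) - (if z = v then A u v / d v else 0))"
      by (rule sum.cong[OF refl])
    also have "\<dots> = d u * ?N u v - A u v / d v"
      using u v F by (simp add: sum_subtractf)
    also have "\<dots> = (if u = v then 1 else 0)"
      using d[OF u] d[OF v] by (simp add: field_simps)
    finally show ?thesis .
  qed
  have 2: "(\<Sum>z\<in>F. ?N u z * M z v) = (if u = v then 1 else 0)" if u: "u \<in> F" and v: "v \<in> F" for u v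
  proof -
    have "?N u z * M z v = (if z = v then ?N u v * d v else 0) - (if z = u then A u v / d u else 0)"
      if z: "z \<in> F" for z
    proof -
      have "A u z / (d u * d z) * A z v = 0" using A[OF u z v] by simp
      then show ?thesis unfolding M[OF z v] using d[OF z] d[OF v] by (auto simp: algebra_simps)
    qed
    then have "(\<Sum>z\<in>F. ?N u z * M z v) =
        (\<Sum>z\<in>F. (if z = v then ?N u v * d v else 0) - (if z = u then A u v / d u else 0))"
      by (rule sum.cong[OF refl])
    also have "\<dots> = ?N u v * d v - A u v / d u"
      using u v F by (simp add: sum_subtractf)
    also have "\<dots> = (if u = v then 1 else 0)"
      using d[OF u] d[OF v] by (simp add: field_simps)
    finally show ?thesis .
  qed
  show ?thesis unfolding is_block_inverse_def using 1 2 by blast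
qed

text \<open>\<open>block_inverse\<close> is an unspecified choice, known to invert the block once
  some inverse \<open>N\<close> exists. Applied to the condition that \<open>y\<close> is harmonic
  at the followers, it recovers \<open>y\<close> there.\<close>

lemma steady_state_eqI:
  fixes y :: "'v \<Rightarrow> real"
  assumes fin: "finite (pverts G)" and S: "S0 \<union> P \<subseteq> pverts G"
    and inv: "is_block_inverse (pverts G - (S0 \<union> P)) (laplacian G w) N"
    and lead: "\<And>s. s \<in> S0 \<union> P \<Longrightarrow> y s = leader_opinion P s"
    and eq: "\<And>u. u \<in> pverts G - (S0 \<union> P) \<Longrightarrow> (\<Sum>z\<in>pverts G. laplacian G w u z * y z) = 0"
    and v: "v \<in> pverts G"
  shows "steady_state G w S0 P v = y v"
proof (cases "v \<in> S0 \<union> P")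
  case True
  then show ?thesis using lead by (simp add: steady_state_def Let_def)
next
  case False
  define F where "F = pverts G - (S0 \<union> P)"
  define L where "L = laplacian G w"
  define N' where "N' = block_inverse F L"
  have vF: "v \<in> F" using False v by (simp add: F_def)
  have "is_block_inverse F L N'"
    unfolding N'_def block_inverse_def 
    by (rule someI[where P = "is_block_inverse F L" and x = N]) (use inv in \<open>simp add: F_def L_def\<close>)
  then have N': "(\<Sum>z\<in>F. N' v z * L z u) = (if v = u then 1 else 0)" if "u \<in> F" for u
    using that vF by (simp add: is_block_inverse_def)
  have finF: "finite F" "finite (S0 \<union> P)" using fin S by (auto simp: F_def intro: finite_subset)
  have V: "pverts G = (S0 \<union> P) \<union> F" "(S0 \<union> P) \<inter> F = {}" using S by (auto simp: F_def)
  have row: "(\<Sum>s\<in>S0 \<union> P. L u s * leader_opinion P s) = - (\<Sum>z\<in>F. L u z * y z)" if "u \<in> F" for u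
  proof -
    have "0 = (\<Sum>z\<in>pverts G. L u z * y z)" using eq[of u] that by (simp add: F_def L_def)
    also have "\<dots> = (\<Sum>s\<in>S0 \<union> P. L u s * y s) + (\<Sum>z\<in>F. L u z * y z)"
      unfolding V(1) using finF(2,1) V(2) by (rule sum.union_disjoint)
    also have "(\<Sum>s\<in>S0 \<union> P. L u s * y s) = (\<Sum>s\<in>S0 \<union> P. L u s * leader_opinion P s)"
      using lead by (intro sum.cong) auto
    finally show ?thesis by simp
  qed
  have "steady_state G w S0 P v = - (\<Sum>u\<in>F. N' v u * (\<Sum>s\<in>S0 \<union> P. L u s * leader_opinion P s))"
    using False by (simp add: steady_state_def Let_def F_def L_def N'_def)
  also have "\<dots> = (\<Sum>u\<in>F. \<Sum>z\<in>F. N' v u * L u z * y z)"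
    by (simp add: row sum_negf[symmetric] sum_distrib_left mult.assoc cong: sum.cong)
  also have "\<dots> = (\<Sum>z\<in>F. (\<Sum>u\<in>F. N' v u * L u z) * y z)"
    by (subst sum.swap) (simp add: sum_distrib_right)
  also have "\<dots> = (\<Sum>z\<in>F. if z = v then y z else 0)"
    by (intro sum.cong) (auto simp: N')
  also have "\<dots> = y v" using finF vF by simp
  finally show ?thesis .
qed

text \<open>
  The vertices 0 and 1 are the leaders with opinion 0. Item \<open>j\<close> has the candidate \<open>2 j\<close> and a
  follower \<open>2 j + 1\<close> whose opinion is \<open>w j / (w j + c j + 1)\<close> if the candidate is chosen.
\<close>

definition item_edges :: "(nat \<Rightarrow> nat) \<Rightarrow> (nat \<Rightarrow> nat) \<Rightarrow> nat \<Rightarrow> ((nat \<times> nat) \<times> fraction) list" where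
  "item_edges w c j = [((2 * j, 0), (1, 1)), ((2 * j + 1, 2 * j), (w j, 1)), ((2 * j + 1, 0), (c j, 1)),
     ((2 * j + 1, 1), (1, 1)), ((0, 2 * j + 1), (1, 1))]"

text \<open>An unchosen candidate follows vertex 0 alone and so has opinion 0. Edges that leave the
  vertices 0 and 1 cannot change the constant opinions of these leaders; together with the unit
  edges into vertex 1 they make the graph strongly connected.\<close>

definition items_data :: "nat \<Rightarrow> (nat \<Rightarrow> nat) \<Rightarrow> (nat \<Rightarrow> nat) \<Rightarrow> nat \<Rightarrow> nat \<Rightarrow> leader_data" where
  "items_data J w c num den =
     \<lparr>ld_nodes = 2 * J + 2,
      ld_edges = ((1, 0), (1, 1)) # concat (map (item_edges w c) [1..<Suc J]),
      ld_zero_leaders = [0, 1], ld_target = (num, den),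
      ld_candidates = map (\<lambda>j. 2 * j) [1..<Suc J], ld_budget = J\<rparr>"

lemma items_edges_keys:
  "fst ` set (concat (map (item_edges w c) [1..<Suc J])) \<subseteq> {..<2 * J + 2} \<times> {..<2 * J + 2} - {(1, 0)}"
  by (auto simp: item_edges_def)

lemma items_edges_distinct: "distinct (map fst (concat (map (item_edges w c) [1..<Suc J])))"
proof (induction J)
  case (Suc J)
  have "fst ` set (item_edges w c (Suc J)) \<inter> {..<2 * J + 2} \<times> {..<2 * J + 2} = {}"
    "distinct (map fst (item_edges w c (Suc J)))"
    by (auto simp: item_edges_def)
  moreover have "fst ` set (concat (map (item_edges w c) [1..<Suc J])) \<subseteq> {..<2 * J + 2} \<times> {..<2 * J + 2}"
    using items_edges_keys by fast
  ultimately have "fst ` set (concat (map (item_edges w c) [1..<Suc J])) \<inter> fst ` set (item_edges w c (Suc J)) = {}"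
    by fast
  with Suc \<open>distinct (map fst (item_edges w c (Suc J)))\<close> show ?case by simp
qed simp

text \<open>The padding weight \<open>c j\<close> gives all followers the same out-degree
  \<open>D\<close>, so the opinions of the chosen items have a common denominator and add up like
  integers. The 1 is the edge to vertex 1.\<close>

locale item_system =
  fixes J :: nat and w c :: "nat \<Rightarrow> nat" and D num :: nat
  assumes J: "1 \<le> J" and w: "\<And>j. 1 \<le> j \<Longrightarrow> j \<le> J \<Longrightarrow> 0 < w j \<and> 0 < c j \<and> w j + c j + 1 = D"
begin

definition "I = items_data J w c num (D * (2 * J + 2))"
definition "G = ld_graph I"
abbreviation "wt \<equiv> ld_weight I"

lemma verts: "pverts G = {..<2 * J + 2}"
  by (simp add: G_def I_def ld_graph_def items_data_def)

lemma finite_verts: "finite (pverts G)"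
  by (simp add: verts)

lemma I_sel: "set (ld_zero_leaders I) = {0, 1}" "set (ld_candidates I) = (\<lambda>j. 2 * j) ` {1..J}"
  "ld_budget I = J" "ld_nodes I = 2 * J + 2" "ld_target I = (num, D * (2 * J + 2))"
  by (auto simp: I_def items_data_def)

lemma D_pos: "2 < D"
  using w[of 1] J by linarith

lemma edges_distinct: "distinct (map fst (ld_edges I))"
  using items_edges_distinct[of w c J] items_edges_keys[of w c J]
  by (auto simp: I_def items_data_def)

lemma edge_iff: "(e, a) \<in> set (ld_edges I) \<longleftrightarrow>
    e = (1, 0) \<and> a = (1, 1) \<or> (\<exists>j\<in>{1..J}. (e, a) \<in> set (item_edges w c j))"
  by (auto simp: I_def items_data_def)

lemma adjacency_edge:
  assumes "((u, v), a) \<in> set (ld_edges I)"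
  shows "adjacency G wt u v = fraction_value a"
proof -
  have "map_of (ld_edges I) (u, v) = Some a"
    using assms edges_distinct by simp
  moreover have "(u, v) \<in> parcs G"
    using assms by (force simp: G_def ld_graph_def)
  ultimately show ?thesis by (simp add: adjacency_def ld_weight_def)
qed

lemma adjacency_no_edge:
  assumes "\<And>a. ((u, v), a) \<notin> set (ld_edges I)"
  shows "adjacency G wt u v = 0"
  using assms by (force simp: adjacency_def G_def ld_graph_def)

lemma adjacency_candidate:
  assumes "1 \<le> j" "j \<le> J"
  shows "adjacency G wt (2 * j) v = (if v = 0 then 1 else 0)"
proof (cases "v = 0")
  case True
  have "((2 * j, 0), (1, 1)) \<in> set (ld_edges I)"
    unfolding edge_iff using assms by (force simp: item_edges_def)
  from adjacency_edge[OF this] True show ?thesis by (simp add: fraction_value_def)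
next
  case False
  then have "adjacency G wt (2 * j) v = 0"
    using assms by (intro adjacency_no_edge) (auto simp: edge_iff item_edges_def; presburger)
  with False show ?thesis by simp
qed

lemma adjacency_follower:
  assumes "1 \<le> j" "j \<le> J"
  shows "adjacency G wt (2 * j + 1) v =
    (if v = 2 * j then real (w j) else 0) + (if v = 0 then real (c j) else 0) + (if v = 1 then 1 else 0)"
proof -
  have "((2 * j + 1, 2 * j), (w j, 1)) \<in> set (ld_edges I)" "((2 * j + 1, 0), (c j, 1)) \<in> set (ld_edges I)"
    "((2 * j + 1, 1), (1, 1)) \<in> set (ld_edges I)"
    unfolding edge_iff using assms by (force simp: item_edges_def)+
  note this[THEN adjacency_edge]
  moreover have "adjacency G wt (2 * j + 1) v = 0" if "v \<noteq> 2 * j" "v \<noteq> 0" "v \<noteq> 1"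
    using that assms by (intro adjacency_no_edge) (auto simp: edge_iff item_edges_def; presburger)
  ultimately show ?thesis using assms by (auto simp: fraction_value_def)
qed

lemma degree_candidate:
  "1 \<le> j \<Longrightarrow> j \<le> J \<Longrightarrow> (\<Sum>v\<in>pverts G. adjacency G wt (2 * j) v * y v) = y 0"
  by (simp add: adjacency_candidate verts if_distrib[of "\<lambda>a. a * _"] cong: if_cong)

lemma degree_follower:
  assumes "1 \<le> j" "j \<le> J"
  shows "(\<Sum>v\<in>pverts G. adjacency G wt (2 * j + 1) v * y v) = real (w j) * y (2 * j) + real (c j) * y 0 + y 1"
proof -
  have V: "finite (pverts G)" "2 * j \<in> pverts G" "0 \<in> pverts G" "1 \<in> pverts G"
    using assms by (auto simp: verts)
  have "(\<Sum>v\<in>pverts G. adjacency G wt (2 * j + 1) v * y v) =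
    (\<Sum>v\<in>pverts G. (if v = 2 * j then real (w j) * y v else 0) + (if v = 0 then real (c j) * y v else 0) +
      (if v = 1 then y v else 0))"
    by (intro sum.cong) (auto simp: adjacency_follower[OF assms, unfolded Suc_eq_plus1[symmetric]] distrib_right)
  also have "\<dots> = real (w j) * y (2 * j) + real (c j) * y 0 + y 1"
    using V by (simp add: sum.distrib)
  finally show ?thesis .
qed

lemma vertex_cases:
  assumes "v \<in> pverts G"
  obtains "v = 0" | "v = 1" | j where "1 \<le> j" "j \<le> J" "v = 2 * j" | j where "1 \<le> j" "j \<le> J" "v = 2 * j + 1"
proof -
  have "v < 2 * J + 2" using assms verts by simp
  then have "v = 0 \<or> v = 1 \<or> (1 \<le> v div 2 \<and> v div 2 \<le> J \<and> (v = 2 * (v div 2) \<or> v = 2 * (v div 2) + 1))"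
    by presburger
  then show thesis using that by blast
qed

section \<open>Steady state and average opinion of the item system\<close>

definition opinion :: "nat set \<Rightarrow> nat \<Rightarrow> real" where
  "opinion P v = (if v \<in> P then 1 else if odd v \<and> v - 1 \<in> P then real (w (v div 2)) / real D else 0)"

lemma steady_state_opinion:
  assumes P: "P \<subseteq> (\<lambda>j. 2 * j) ` {1..J}" and v: "v \<in> pverts G"
  shows "steady_state G wt {0, 1} P v = opinion P v"
proof -
  define F where "F = pverts G - ({0, 1} \<union> P)"
  define d where "d u = (\<Sum>z\<in>pverts G. adjacency G wt u z)" for u
  have d_cand: "d (2 * j) = 1" if "1 \<le> j" "j \<le> J" for j
    using degree_candidate[OF that, of "\<lambda>_. 1"] by (simp add: d_def)
  have d_foll: "d (2 * j + 1) = real D" if "1 \<le> j" "j \<le> J" for j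
    using degree_follower[OF that, of "\<lambda>_. 1"] w[OF that] by (simp add: d_def flip: of_nat_add)
  have lap: "laplacian G wt u z = (if u = z then d u else 0) - adjacency G wt u z" for u z
    by (simp add: laplacian_def degree_matrix_def d_def)
  have dF: "d u \<noteq> 0" if "u \<in> F" for u
  proof -
    have "u \<in> pverts G" "u \<noteq> 0" "u \<noteq> 1" using that by (auto simp: F_def)
    then show ?thesis using d_cand d_foll D_pos by (elim vertex_cases) auto
  qed
  \<comment> \<open>An edge inside \<open>F\<close> leads from a follower to its unchosen candidate,
    whose only edge goes to vertex 0. So two such edges never follow each other.\<close>
  have AF: "adjacency G wt u z * adjacency G wt z z' = 0" if "u \<in> F" "z \<in> F" "z' \<in> F" for u z z'
  proof -
    have z0: "z \<noteq> 0" "z \<noteq> 1" "z' \<noteq> 0" using that by (auto simp: F_def)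
    have "z \<in> pverts G" "u \<in> pverts G" "u \<noteq> 0" "u \<noteq> 1" using that by (auto simp: F_def)
    from this(1) show ?thesis
    proof (cases rule: vertex_cases)
      case (3 j)
      then show ?thesis using adjacency_candidate z0 by simp
    next
      case (4 j)
      have "adjacency G wt u z = 0"
        using \<open>u \<in> pverts G\<close>
      proof (cases rule: vertex_cases)
        case (3 i)
        then show ?thesis using adjacency_candidate z0 by simp
      next
        case (4 i)
        have "z \<noteq> 2 * i" using \<open>z = 2 * j + 1\<close> by presburger
        then show ?thesis using 4 adjacency_follower z0 by simp
      qed (use \<open>u \<noteq> 0\<close> \<open>u \<noteq> 1\<close> in auto)
      then show ?thesis by simp
    qed (use z0 in auto)
  qed
  have ev: "even u \<and> 2 \<le> u" if "u \<in> P" for u using P that by force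
  have P1: "0 \<notin> P" "1 \<notin> P" using ev[of 0] ev[of 1] by auto
  have Podd: "2 * j + 1 \<notin> P" for j using ev[of "2 * j + 1"] by auto
  show ?thesis
  proof (rule steady_state_eqI[OF _ _ two_level_block_inverse[where A = "adjacency G wt" and d = d]])
    show "finite (pverts G)" by (simp add: verts)
    show "{0, 1} \<union> P \<subseteq> pverts G" using P by (auto simp: verts)
    show "opinion P s = leader_opinion P s" if "s \<in> {0, 1} \<union> P" for s
      using that P1 by (auto simp: opinion_def leader_opinion_def)
    fix u assume u: "u \<in> pverts G - ({0, 1} \<union> P)"
    have "(\<Sum>z\<in>pverts G. laplacian G wt u z * opinion P z) =
        d u * opinion P u - (\<Sum>z\<in>pverts G. adjacency G wt u z * opinion P z)"
    proof -
      have "(\<Sum>z\<in>pverts G. laplacian G wt u z * opinion P z) =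
        (\<Sum>z\<in>pverts G. (if u = z then d u * opinion P u else 0) - adjacency G wt u z * opinion P z)"
        by (intro sum.cong) (auto simp: lap left_diff_distrib)
      then show ?thesis using u finite_verts by (simp add: sum_subtractf)
    qed
    also have "\<dots> = 0"
    proof -
      have "u \<in> pverts G" "u \<noteq> 0" "u \<noteq> 1" "u \<notin> P" using u by auto
      from this(1) show ?thesis
      proof (cases rule: vertex_cases)
        case (3 j)
        then show ?thesis using degree_candidate[of j] P1 \<open>u \<notin> P\<close> by (simp add: opinion_def)
      next
        case (4 j)
        have "opinion P 0 = 0" "opinion P 1 = 0" using P1 by (auto simp: opinion_def)
        moreover have "opinion P (2 * j) = (if 2 * j \<in> P then 1 else 0)" by (simp add: opinion_def)
        moreover have "opinion P (2 * j + 1) = (if 2 * j \<in> P then real (w j) / real D else 0)"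
          using Podd[of j] by (simp add: opinion_def)
        ultimately show ?thesis
          unfolding 4(3) degree_follower[OF 4(1,2)] d_foll[OF 4(1,2)] using D_pos by simp
      qed (use \<open>u \<noteq> 0\<close> \<open>u \<noteq> 1\<close> in auto)
    qed
    finally show "(\<Sum>z\<in>pverts G. laplacian G wt u z * opinion P z) = 0" .
  qed (use v dF AF lap in \<open>auto simp: F_def verts\<close>)
qed

lemma sum_pairs: "(\<Sum>v<2 * J + 2. f v) = f 0 + f 1 + (\<Sum>j=1..J. f (2 * j) + f (2 * j + 1))" for f :: "nat \<Rightarrow> real"
  by (induction J) (simp_all add: numeral_2_eq_2)

text \<open>A chosen candidate is itself a leader with opinion 1, and its follower adds
  \<open>w j / D\<close>. This makes \<open>(D + w j) / D\<close> per chosen item and 0 for the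
  others.\<close>

lemma average_opinion_items:
  assumes P: "P \<subseteq> {1..J}"
  shows "average_opinion G wt {0, 1} ((\<lambda>j. 2 * j) ` P) =
    real (\<Sum>j\<in>P. D + w j) / real (D * (2 * J + 2))"
proof -
  let ?P = "(\<lambda>j. 2 * j) ` P"
  have sub: "?P \<subseteq> (\<lambda>j. 2 * j) ` {1..J}" using P by blast
  have mem: "2 * j \<in> ?P \<longleftrightarrow> j \<in> P" for j by auto
  have odd: "2 * j + 1 \<notin> ?P" for j by (auto; presburger)
  have o0: "opinion ?P 0 = 0" "opinion ?P 1 = 0" using P by (auto simp: opinion_def)
  have "(\<Sum>v\<in>pverts G. steady_state G wt {0, 1} ?P v) = (\<Sum>v<2 * J + 2. opinion ?P v)"
    using steady_state_opinion[OF sub] by (simp add: verts)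
  also have "\<dots> = (\<Sum>j=1..J. if j \<in> P then 1 + real (w j) / real D else 0)"
  proof -
    have e: "opinion ?P (2 * j) = (if j \<in> P then 1 else 0)"
      "opinion ?P (2 * j + 1) = (if j \<in> P then real (w j) / real D else 0)" for j
      using odd[of j] mem[of j] by (simp_all add: opinion_def)
    show ?thesis unfolding sum_pairs o0 e by (simp, intro sum.cong) auto
  qed
  also have "\<dots> = (\<Sum>j\<in>{1..J} \<inter> P. 1 + real (w j) / real D)"
    by (simp add: sum.inter_restrict)
  also have "{1..J} \<inter> P = P" using P by blast
  also have "(\<Sum>j\<in>P. 1 + real (w j) / real D) = (\<Sum>j\<in>P. real (D + w j) / real D)"
    using D_pos by (intro sum.cong) (auto simp: add_divide_distrib)
  also have "\<dots> = real (\<Sum>j\<in>P. D + w j) / real D"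
    by (simp add: sum_divide_distrib)
  finally have "(\<Sum>v\<in>pverts G. steady_state G wt {0, 1} ?P v) = real (\<Sum>j\<in>P. D + w j) / real D" .
  moreover have "card (pverts G) = 2 * J + 2" by (simp add: verts)
  ultimately show ?thesis
    unfolding average_opinion_def by (simp only: of_nat_mult divide_divide_eq_left)
qed

section \<open>Validity of the instance and the oracle's answer\<close>

lemma G_fin: "pair_fin_digraph G"
proof -
  have keys: "parcs G \<subseteq> {..<2 * J + 2} \<times> {..<2 * J + 2}"
    using items_edges_keys[of w c J] by (auto simp: G_def ld_graph_def I_def items_data_def)
  moreover have "finite (parcs G)" by (simp add: G_def ld_graph_def)
  ultimately show ?thesis
    by unfold_locales (auto simp: verts)
qed

lemma G_strongly_connected: "strongly_connected (with_proj G)"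
proof -
  interpret pair_fin_digraph G by (rule G_fin)
  have arc: "u \<rightarrow>\<^sup>*\<^bsub>with_proj G\<^esub> v" if "((u, v), a) \<in> set (ld_edges I)" for u v a
  proof -
    have "(u, v) \<in> parcs G" using that by (force simp: G_def ld_graph_def)
    then show ?thesis by (intro reachable_adjI) simp
  qed
  have 1: "1 \<rightarrow>\<^sup>*\<^bsub>with_proj G\<^esub> 0" by (rule arc[of _ _ "(1, 1)"]) (simp add: edge_iff)
  have to0: "(2 * j) \<rightarrow>\<^sup>*\<^bsub>with_proj G\<^esub> 0" "(2 * j + 1) \<rightarrow>\<^sup>*\<^bsub>with_proj G\<^esub> 0"
    and from0: "0 \<rightarrow>\<^sup>*\<^bsub>with_proj G\<^esub> (2 * j + 1)"
    and foll: "(2 * j + 1) \<rightarrow>\<^sup>*\<^bsub>with_proj G\<^esub> (2 * j)" "(2 * j + 1) \<rightarrow>\<^sup>*\<^bsub>with_proj G\<^esub> 1" if "1 \<le> j" "j \<le> J" for j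
    by (rule arc, use that in \<open>force simp: edge_iff item_edges_def\<close>)+
  have A: "v \<rightarrow>\<^sup>*\<^bsub>with_proj G\<^esub> 0" if "v \<in> pverts G" for v
    using that 1 to0 by (cases rule: vertex_cases) (auto simp: verts)
  have B: "0 \<rightarrow>\<^sup>*\<^bsub>with_proj G\<^esub> v" if "v \<in> pverts G" for v
    using that
  proof (cases rule: vertex_cases)
    case 2
    then show ?thesis using reachable_trans[OF from0[of 1] foll(2)[of 1]] J by simp
  next
    case (3 j)
    then show ?thesis using reachable_trans[OF from0[of j] foll(1)[of j]] by simp
  qed (use from0 in \<open>auto simp: verts\<close>)
  show ?thesis
    unfolding strongly_connected_def
  proof (intro conjI ballI)
    have "0 \<in> verts (with_proj G)" by (simp add: verts)
    then show "verts (with_proj G) \<noteq> {}" by blast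
    show "u \<rightarrow>\<^sup>*\<^bsub>with_proj G\<^esub> v" if "u \<in> verts (with_proj G)" "v \<in> verts (with_proj G)" for u v
      using reachable_trans[OF A B] that by simp
  qed
qed

lemma I_valid:
  assumes num: "num \<le> D * (2 * J + 2)"
  shows "ld_valid I"
proof -
  have D: "0 < D" using D_pos by simp
  have "0 < real (D * (2 * J + 2))" using D by (simp only: of_nat_0_less_iff) simp
  moreover have "real num \<le> real (D * (2 * J + 2))" using num by (simp only: of_nat_le_iff)
  ultimately have "fraction_value (ld_target I) \<le> 1"
    unfolding fraction_value_def I_sel fst_conv snd_conv by (simp only: divide_le_eq_1_pos)
  moreover have "0 \<le> fraction_value (ld_target I)" by (simp add: fraction_value_def)
  moreover have "\<forall>e\<in>parcs G. wt e > 0"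
  proof
    fix e assume "e \<in> parcs G"
    then obtain u v a where e: "e = (u, v)" "(e, a) \<in> set (ld_edges I)"
      by (cases e) (force simp: G_def ld_graph_def)
    then have "wt e = fraction_value a" using edges_distinct by (simp add: ld_weight_def)
    moreover have "fraction_value a > 0"
      using e(2) w unfolding edge_iff by (auto simp: item_edges_def fraction_value_def)
    ultimately show "wt e > 0" by simp
  qed
  moreover have "\<forall>(e, a)\<in>set (ld_edges I). snd a > 0"
    by (auto simp: edge_iff item_edges_def)
  moreover have "distinct (ld_candidates I)" "distinct (ld_zero_leaders I)"
    by (auto simp: I_def items_data_def distinct_map inj_on_def)
  moreover have "card ((\<lambda>j. 2 * j) ` {1..J}) = J"
    by (subst card_image) (auto simp: inj_on_def)
  ultimately show ?thesis
    unfolding ld_valid_def leader_selection_instance_def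
    using edges_distinct D J G_fin G_strongly_connected
    by (auto simp: I_sel G_def[symmetric] verts)
qed

text \<open>
  Item 1 is the only one of odd weight, and with it the target is missed by exactly 1. So the
  optimal sets avoid item 1 iff the target is attained.
\<close>

theorem item_1_answer:
  assumes num: "num \<le> D * (2 * J + 2)" "even num" "even D"
    and par: "odd (w 1)" "\<And>j. 2 \<le> j \<Longrightarrow> j \<le> J \<Longrightarrow> even (w j)"
    and fallback: "P0 \<subseteq> {1..J}" "(\<Sum>j\<in>P0. D + w j) = num + 1"
    and sol: "solves Orc absolute_leader_selection"
  shows "2 < length (Orc (ld_encode I))"
    and "Orc (ld_encode I) ! 2 \<longleftrightarrow> \<not> (\<exists>P. P \<subseteq> {2..J} \<and> (\<Sum>j\<in>P. D + w j) = num)"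
proof -
  let ?Q = "(\<lambda>j. 2 * j) ` {1..J}"
  define val where "val P = (\<Sum>j\<in>P. D + w j)" for P
  define err where "err P = \<bar>int (val P) - int num\<bar>" for P
  define f where "f P = \<bar>average_opinion G wt {0, 1} P - fraction_value (ld_target I)\<bar>" for P
  have "0 < D * (2 * J + 2)" using D_pos by simp
  then have D: "0 < real (D * (2 * J + 2))" by (simp only: of_nat_0_less_iff)
  have f: "f ((\<lambda>j. 2 * j) ` P) = real_of_int (err P) / real (D * (2 * J + 2))" if "P \<subseteq> {1..J}" for P
  proof -
    have "f ((\<lambda>j. 2 * j) ` P) = \<bar>(real (val P) - real num) / real (D * (2 * J + 2))\<bar>"
      unfolding f_def average_opinion_items[OF that] val_def
      by (simp add: I_sel fraction_value_def diff_divide_distrib)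
    also have "\<dots> = \<bar>real (val P) - real num\<bar> / real (D * (2 * J + 2))"
      using D by (simp add: abs_divide)
    also have "\<bar>real (val P) - real num\<bar> = real_of_int (err P)" by (simp add: err_def)
    finally show ?thesis .
  qed
  have cond: "P \<subseteq> set (ld_candidates I) \<and> card P \<le> ld_budget I \<longleftrightarrow> P \<subseteq> ?Q" for P
  proof -
    have "card ?Q = J" by (subst card_image) (auto simp: inj_on_def)
    then show ?thesis using card_mono[of ?Q P] by (auto simp: I_sel)
  qed
  have sol_iff: "leader_selection_solution (ld_graph I) wt (set (ld_zero_leaders I))
      (fraction_value (ld_target I)) (set (ld_candidates I)) (ld_budget I) S1 \<longleftrightarrow>
      is_arg_min f (\<lambda>P. P \<subseteq> ?Q) S1" for S1
    unfolding leader_selection_solution_def cond by (simp add: f_def[abs_def] I_sel(1) G_def)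
  have "\<exists>S1. is_arg_min f (\<lambda>P. P \<subseteq> ?Q) S1"
  proof -
    have "finite (Pow ?Q)" "Pow ?Q \<noteq> {}" by auto
    from ex_is_arg_min_if_finite[OF this, of f] show ?thesis by (simp add: Pow_def)
  qed
  then obtain S where "absolute_leader_selection (ld_encode I) (encode_vertex_set (ld_nodes I) S)"
    unfolding absolute_leader_selection_def using sol_iff I_valid[OF num(1)] by blast
  then have "absolute_leader_selection (ld_encode I) (Orc (ld_encode I))"
    using sol unfolding solves_def by blast
  then obtain S1 where S1: "is_arg_min f (\<lambda>P. P \<subseteq> ?Q) S1"
    and Orc: "Orc (ld_encode I) = encode_vertex_set (2 * J + 2) S1"
    unfolding absolute_leader_selection_def ld_encode_inject using sol_iff I_sel(4) by auto
  show "2 < length (Orc (ld_encode I))" using J by (simp add: Orc encode_vertex_set_def)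
  \<comment> \<open>The answer is a characteristic vector over all vertices, and vertex 2 is the
    candidate of item 1.\<close>
  have ans: "Orc (ld_encode I) ! 2 \<longleftrightarrow> 2 \<in> S1" using J by (simp add: Orc encode_vertex_set_def del: upt_Suc) (simp only: numeral_2_eq_2)
  obtain P1 where P1: "P1 \<subseteq> {1..J}" "S1 = (\<lambda>j. 2 * j) ` P1"
    using S1 unfolding is_arg_min_def by (auto simp: subset_image_iff)
  have min: "err P1 \<le> err P" if "P \<subseteq> {1..J}" for P
  proof -
    have "\<not> f ((\<lambda>j. 2 * j) ` P) < f S1"
      using S1 that unfolding is_arg_min_def by blast
    then have le: "real_of_int (err P1) / real (D * (2 * J + 2)) \<le> real_of_int (err P) / real (D * (2 * J + 2))"
      unfolding f[OF that] P1(2) f[OF P1(1)] by (simp only: not_less)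
    have "a / C \<le> b / C \<Longrightarrow> 0 < C \<Longrightarrow> a \<le> b" for a b C :: real
      by (simp add: divide_le_cancel)
    from this[OF le D] show ?thesis by (simp only: of_int_le_iff)
  qed
  have mem: "2 \<in> S1 \<longleftrightarrow> 1 \<in> P1" by (auto simp: P1(2))
  have ev: "even (val P)" if "P \<subseteq> {2..J}" for P
    unfolding val_def using that num(3) par(2) by (intro dvd_sum) auto
  have od: "odd (val P)" if "P \<subseteq> {1..J}" "1 \<in> P" for P
  proof -
    have "finite P" using that finite_subset by blast
    then have "val P = (D + w 1) + val (P - {1})"
      unfolding val_def using that(2) by (simp add: sum.remove)
    moreover have "even (val (P - {1}))" using that by (intro ev) force
    ultimately show ?thesis using num(3) par(1) by simp
  qed
  show "Orc (ld_encode I) ! 2 \<longleftrightarrow> \<not> (\<exists>P. P \<subseteq> {2..J} \<and> (\<Sum>j\<in>P. D + w j) = num)"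
  proof (cases "\<exists>P. P \<subseteq> {2..J} \<and> (\<Sum>j\<in>P. D + w j) = num")
    case True
    then obtain P where P: "P \<subseteq> {2..J}" "val P = num" by (auto simp: val_def)
    have "err P = 0" using P(2) by (simp add: err_def)
    moreover have "P \<subseteq> {1..J}" using P(1) by force
    ultimately have "err P1 = 0" using min[of P] by (simp add: err_def)
    then have "val P1 = num" by (simp add: err_def)
    then have "1 \<notin> P1" using od[OF P1(1)] num(2) by auto
    then show ?thesis using ans mem True by blast
  next
    case False
    have "1 \<in> P1"
    proof (rule ccontr)
      assume n: "1 \<notin> P1"
      have P2: "P1 \<subseteq> {2..J}"
      proof
        fix j assume "j \<in> P1"
        then have "j \<noteq> 1" "1 \<le> j" "j \<le> J" using n P1(1) by auto
        then show "j \<in> {2..J}" by simp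
      qed
      have "val P1 \<noteq> num" using False P2 by (auto simp: val_def)
      moreover have "even (val P1)" using ev[OF P2] .
      \<comment> \<open>By parity a set without item 1 that misses the target misses it by at least
        2, whereas \<open>P0\<close> misses it by 1.\<close>
      ultimately have "err P1 \<ge> 2" using num(2) unfolding err_def by presburger
      moreover have "err P0 = 1" using fallback(2) by (simp add: err_def val_def)
      ultimately show False using min[OF fallback(1)] by simp
    qed
    then show ?thesis using ans mem False by blast
  qed
qed

end


section \<open>Tilings as subset sums\<close>

lemma digits_less:
  fixes Q :: nat
  assumes "\<And>g. g < M \<Longrightarrow> a g < Q"
  shows "(\<Sum>g<M. a g * Q ^ g) < Q ^ M"
  using assms
proof (induction M)
  case (Suc M)
  have "(\<Sum>g<M. a g * Q ^ g) < Q ^ M" using Suc by simp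
  moreover have "Suc (a M) * Q ^ M \<le> Q * Q ^ M" using Suc.prems[of M] by (intro mult_right_mono) auto
  ultimately show ?case by simp
qed simp

text \<open>\<open>X\<close> and \<open>Y\<close> are arbitrary parts above the \<open>M\<close>
  digits; they will collect the multiples of \<open>Q ^ M\<close> that items and target carry
  besides their digits.\<close>

lemma digits_inj:
  fixes Q :: nat
  assumes "\<And>g. g < M \<Longrightarrow> a g < Q" "\<And>g. g < M \<Longrightarrow> b g < Q"
    and "(\<Sum>g<M. a g * Q ^ g) + X * Q ^ M = (\<Sum>g<M. b g * Q ^ g) + Y * Q ^ M"
  shows "(\<forall>g<M. a g = b g) \<and> X = Y"
  using assms
proof (induction M arbitrary: X Y)
  case (Suc M)
  have eq: "(\<Sum>g<M. a g * Q ^ g) + (a M + X * Q) * Q ^ M = (\<Sum>g<M. b g * Q ^ g) + (b M + Y * Q) * Q ^ M"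
    using Suc.prems(3) by (simp add: algebra_simps)
  have IH: "(\<forall>g<M. a g = b g) \<and> a M + X * Q = b M + Y * Q"
    using Suc.IH[OF _ _ eq] Suc.prems(1,2) by simp
  have lt: "a M < Q" "b M < Q" using Suc.prems by auto
  have "(a M + X * Q) mod Q = (b M + Y * Q) mod Q" using IH by simp
  then have "a M = b M" using lt by simp
  moreover from this have "X * Q = Y * Q" using IH by simp
  then have "X = Y" using lt by simp
  ultimately show ?case using IH by (auto simp: less_Suc_eq)
qed simp

lemma sum_if_shift:
  fixes U :: "nat \<Rightarrow> nat"
  shows "(\<Sum>i<N. if g = i + s then U i else 0) = (if s \<le> g \<and> g < N + s then U (g - s) else 0)"
proof (cases "s \<le> g \<and> g < N + s")
  case True
  then have "(\<Sum>i<N. if g = i + s then U i else 0) = (\<Sum>i<N. if i = g - s then U i else 0)"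
    by (intro sum.cong) auto
  also have "\<dots> = U (g - s)"
  proof -
    have "g - s < N" using True by linarith
    then show ?thesis by simp
  qed
  finally show ?thesis using True by simp
qed (auto intro!: sum.neutral)

text \<open>
  Group \<open>g\<close> of the digits of a number consists of a placement digit, a digit for the horizontal
  edge to the left of cell \<open>g\<close> and a digit for the vertical edge below cell \<open>g\<close>. A tile adds a
  label to an edge from one side and the complement to \<open>L\<close> of a label from the other side. So two
  adjacent tiles agree on their edge iff its digit adds up to \<open>L\<close>.
\<close>

locale tile_digits =
  fixes \<Theta> :: "(nat, nat) tile list" and zt :: "(nat, nat) tile" and L m e W N :: nat
    and lo hi :: "nat \<Rightarrow> nat"
  assumes bounded: "\<And>t. t \<in> insert zt (set \<Theta>) \<Longrightarrow> left t \<le> L \<and> right t \<le> L \<and> bottom t \<le> L \<and> top t \<le> L"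
    and e: "e \<le> L" and lo: "\<And>c. lo c \<le> L" and hi: "\<And>c. hi c \<le> L"
    and W: "2 \<le> W" "W \<le> N" and base: "2 * (length \<Theta> + 1) * (L + 2) < 2 ^ m"
    and tiles_nonempty: "\<Theta> \<noteq> []"
begin

definition B :: nat where "B = 2 ^ m"
definition block :: "nat \<Rightarrow> nat \<Rightarrow> nat \<Rightarrow> nat" where "block p h v = p + B * (h + B * v)"
definition Q :: nat where "Q = B ^ 3"

definition tile_block :: "nat \<Rightarrow> (nat, nat) tile \<Rightarrow> nat \<Rightarrow> nat" where
  "tile_block i t g = (if g = i then block 2 (left t) (bottom t) else 0) +
     (if g = i + 1 then block 0 (L - right t) 0 else 0) + (if g = i + W then block 0 0 (L - top t) else 0)"

definition tile_number :: "nat \<Rightarrow> (nat, nat) tile \<Rightarrow> nat" where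
  "tile_number i t = (\<Sum>g<N + W. tile_block i t g * Q ^ g)"

text \<open>The horizontal edges form one chain through all rows, so only the two ends of the chain
  carry the border label \<open>e\<close>. Group \<open>N\<close> has no cell and receives only the
  complement from the last cell.\<close>

definition goal_edge :: "nat \<Rightarrow> nat" where
  "goal_edge g = (if g = 0 then e else if g < N then L else if g = N then L - e else 0)"

definition goal_vert :: "nat \<Rightarrow> nat" where
  "goal_vert g = (if g < W then lo g else if g < N then L else L - hi (g - N))"

definition goal_block :: "nat \<Rightarrow> nat" where
  "goal_block g = block (if g < N then 2 else 0) (goal_edge g) (goal_vert g)"

definition goal :: nat where
  "goal = (\<Sum>g<N + W. goal_block g * Q ^ g)"

text \<open>An edge digit collects labels from two cells. Even with all tiles chosen at both of them
  it stays below \<open>B\<close>, so no selection whatsoever produces a carry.\<close>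

lemma B_gt: "2 * length \<Theta> * L + 2 * length \<Theta> < B" "2 * L + 4 < B" "1 < B"
proof -
  have *: "2 * length \<Theta> * L + 4 * length \<Theta> + 2 * L + 4 < B"
    using base by (simp add: B_def algebra_simps)
  then show "2 * length \<Theta> * L + 2 * length \<Theta> < B" "2 * L + 4 < B" "1 < B" by linarith+
qed

lemma block_add: "block a b c + block a' b' c' = block (a + a') (b + b') (c + c')"
  by (simp add: block_def algebra_simps)

lemma block_0 [simp]: "block 0 0 0 = 0"
  by (simp add: block_def)

lemma block_sum: "(\<Sum>k\<in>C. block (a k) (b k) (c k)) = block (\<Sum>k\<in>C. a k) (\<Sum>k\<in>C. b k) (\<Sum>k\<in>C. c k)"
  by (induction C rule: infinite_finite_induct) (simp_all add: block_add)

lemma block_inj: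
  assumes "block a b c = block a' b' c'" "a < B" "a' < B" "b < B" "b' < B"
  shows "a = a' \<and> b = b' \<and> c = c'"
proof -
  have "block a b c mod B = a" using assms(2) by (simp add: block_def)
  moreover have "block a' b' c' mod B = a'" using assms(3) by (simp add: block_def)
  ultimately have a: "a = a'" using assms(1) by simp
  then have bc: "b + B * c = b' + B * c'" using assms B_gt(3) by (simp add: block_def)
  have "(b + B * c) mod B = b" using assms(4) by simp
  moreover have "(b' + B * c') mod B = b'" using assms(5) by simp
  ultimately have "b = b'" using bc by simp
  then show ?thesis using a bc B_gt(3) by simp
qed

lemma block_less:
  assumes "a < B" "b < B" "c < B"
  shows "block a b c < Q"
proof -
  have 1: "h + B * k < B * X" if "h < B" "k < X" for h k X
  proof -
    have "h + B * k < B * Suc k" using that by simp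
    also have "\<dots> \<le> B * X" using that by (intro mult_le_mono2) simp
    finally show ?thesis .
  qed
  have "a + B * (b + B * c) < B * (B * B)"
    by (rule 1[OF assms(1) 1[OF assms(2,3)]])
  then show ?thesis by (simp add: block_def Q_def power3_eq_cube mult.assoc)
qed

lemma column_sum:
  assumes g: "g < N + W"
  shows "(\<Sum>i<N. \<Sum>k\<in>C i. tile_block i (f i k) g) =
    block (if g < N then 2 * card (C g) else 0)
      ((if g < N then \<Sum>k\<in>C g. left (f g k) else 0) +
       (if 1 \<le> g \<and> g < N + 1 then \<Sum>k\<in>C (g - 1). L - right (f (g - 1) k) else 0))
      ((if g < N then \<Sum>k\<in>C g. bottom (f g k) else 0) +
       (if W \<le> g then \<Sum>k\<in>C (g - W). L - top (f (g - W) k) else 0))"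
proof -
  have "(\<Sum>i<N. \<Sum>k\<in>C i. tile_block i (f i k) g) =
    (\<Sum>i<N. (if g = i + 0 then \<Sum>k\<in>C i. block 2 (left (f i k)) (bottom (f i k)) else 0) +
      (if g = i + 1 then \<Sum>k\<in>C i. block 0 (L - right (f i k)) 0 else 0) +
      (if g = i + W then \<Sum>k\<in>C i. block 0 0 (L - top (f i k)) else 0))"
    using W by (intro sum.cong refl) (auto simp: tile_block_def)
  also have "\<dots> = (if g < N then block (2 * card (C g)) (\<Sum>k\<in>C g. left (f g k)) (\<Sum>k\<in>C g. bottom (f g k)) else 0) +
      (if 1 \<le> g \<and> g < N + 1 then block 0 (\<Sum>k\<in>C (g - 1). L - right (f (g - 1) k)) 0 else 0) +
      (if W \<le> g then block 0 0 (\<Sum>k\<in>C (g - W). L - top (f (g - W) k)) else 0)"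
    unfolding sum.distrib sum_if_shift using g by (simp add: block_sum mult.commute)
  also have "\<dots> = block (if g < N then 2 * card (C g) else 0)
      ((if g < N then \<Sum>k\<in>C g. left (f g k) else 0) +
       (if 1 \<le> g \<and> g < N + 1 then \<Sum>k\<in>C (g - 1). L - right (f (g - 1) k) else 0))
      ((if g < N then \<Sum>k\<in>C g. bottom (f g k) else 0) +
       (if W \<le> g then \<Sum>k\<in>C (g - W). L - top (f (g - W) k) else 0))"
    by (simp add: block_add)
  finally show ?thesis .
qed

lemma numbers_sum:
  "(\<Sum>i<N. \<Sum>k\<in>C i. tile_number i (f i k)) = (\<Sum>g<N + W. (\<Sum>i<N. \<Sum>k\<in>C i. tile_block i (f i k) g) * Q ^ g)"
proof -
  have "(\<Sum>i<N. \<Sum>k\<in>C i. tile_number i (f i k)) =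
      (\<Sum>i<N. \<Sum>g<N + W. \<Sum>k\<in>C i. tile_block i (f i k) g * Q ^ g)"
    unfolding tile_number_def by (intro sum.cong refl sum.swap)
  also have "\<dots> = (\<Sum>g<N + W. \<Sum>i<N. \<Sum>k\<in>C i. tile_block i (f i k) g * Q ^ g)"
    by (rule sum.swap)
  finally show ?thesis by (simp add: sum_distrib_right)
qed

lemma tiling_goal:
  assumes til: "tiling W N e lo hi \<tau>"
    and bd: "\<And>i. i < N \<Longrightarrow> left (\<tau> i) \<le> L \<and> bottom (\<tau> i) \<le> L"
  shows "(\<Sum>i<N. tile_number i (\<tau> i)) = goal"
proof -
  have "(\<Sum>i<N. tile_number i (\<tau> i)) = (\<Sum>g<N + W. (\<Sum>i<N. \<Sum>k\<in>{0::nat}. tile_block i (\<tau> i) g) * Q ^ g)"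
    using numbers_sum[where C = "\<lambda>_. {0::nat}" and f = "\<lambda>i _. \<tau> i"] by simp
  also have "\<dots> = goal"
    unfolding goal_def
  proof (intro sum.cong refl arg_cong2[of _ _ _ _ "(*)"])
    fix g assume "g \<in> {..<N + W}"
    then have g: "g < N + W" by simp
    have 1: "(if g < N then left (\<tau> g) else 0) + (if 1 \<le> g \<and> g < N + 1 then L - right (\<tau> (g - 1)) else 0) = goal_edge g"
    proof -
      have "right (\<tau> (g - 1)) = left (\<tau> g)" if "1 \<le> g" "g < N"
        using til that by (auto simp: tiling_def dest: spec[of _ "g - 1"])
      moreover have "left (\<tau> 0) = e" "right (\<tau> (N - 1)) = e" using til by (auto simp: tiling_def)
      ultimately show ?thesis using bd[of g] W by (auto simp: goal_edge_def)
    qed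
    have 2: "(if g < N then bottom (\<tau> g) else 0) + (if W \<le> g then L - top (\<tau> (g - W)) else 0) = goal_vert g"
    proof -
      have "top (\<tau> (g - W)) = bottom (\<tau> g)" if "W \<le> g" "g < N"
        using til that by (auto simp: tiling_def dest: spec[of _ "g - W"])
      moreover have "bottom (\<tau> g) = lo g" if "g < W" using til that by (simp add: tiling_def)
      moreover have "top (\<tau> (g - W)) = hi (g - N)" if "N \<le> g"
      proof -
        have "g - N < W" using g that by linarith
        then have "top (\<tau> (N - W + (g - N))) = hi (g - N)" using til unfolding tiling_def by blast
        moreover have "N - W + (g - N) = g - W" using that W by simp
        ultimately show ?thesis by simp
      qed
      ultimately show ?thesis using bd[of g] W by (auto simp: goal_vert_def)
    qed
    show "(\<Sum>i<N. \<Sum>k\<in>{0::nat}. tile_block i (\<tau> i) g) = goal_block g"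
      unfolding column_sum[OF g] goal_block_def 1[symmetric] 2[symmetric] by simp
  qed
  finally show ?thesis .
qed

text \<open>\<open>C i\<close> is an arbitrary set of tiles at cell \<open>i\<close>. Without
  carries the equation splits into digits: the placement digits leave exactly one tile per cell, and
  then the edge digits compare its labels with those of its neighbours and of the border.\<close>

lemma selection_tiling:
  assumes C: "\<And>i. i < N \<Longrightarrow> C i \<subseteq> {..<length \<Theta>}"
    and eq: "(\<Sum>i<N. \<Sum>k\<in>C i. tile_number i (\<Theta> ! k)) + X * Q ^ (N + W) = goal + Y * Q ^ (N + W)"
  obtains \<tau> where "tiling W N e lo hi \<tau>" "\<And>i. i < N \<Longrightarrow> \<tau> i \<in> set \<Theta>"
proof -
  let ?K = "length \<Theta>"
  define a1 where "a1 g = (if g < N then 2 * card (C g) else 0)" for g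
  define a2 where "a2 g = (if g < N then \<Sum>k\<in>C g. left (\<Theta> ! k) else 0) +
       (if 1 \<le> g \<and> g < N + 1 then \<Sum>k\<in>C (g - 1). L - right (\<Theta> ! k) else 0)" for g
  define a3 where "a3 g = (if g < N then \<Sum>k\<in>C g. bottom (\<Theta> ! k) else 0) +
       (if W \<le> g then \<Sum>k\<in>C (g - W). L - top (\<Theta> ! k) else 0)" for g
  have cardC: "card (C i) \<le> ?K" if "i < N" for i
    using card_mono[OF _ C[OF that]] by simp
  have sumC: "(\<Sum>k\<in>C i. h k) \<le> ?K * L" if i: "i < N" and h: "\<And>k. k < ?K \<Longrightarrow> h k \<le> L" for i h
  proof -
    have "(\<Sum>k\<in>C i. h k) \<le> of_nat (card (C i)) * L"
      using C[OF i] h by (intro sum_bounded_above) auto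
    also have "\<dots> \<le> ?K * L" using cardC[OF i] by simp
    finally show ?thesis .
  qed
  have lab: "left (\<Theta> ! k) \<le> L" "right (\<Theta> ! k) \<le> L" "bottom (\<Theta> ! k) \<le> L" "top (\<Theta> ! k) \<le> L" if "k < ?K" for k
    using bounded[of "\<Theta> ! k"] that by auto
  have bnd: "a1 g < B" "a2 g < B" "a3 g < B" if g: "g < N + W" for g
  proof -
    show "a1 g < B" using cardC[of g] B_gt(1,3) by (auto simp: a1_def)
    have "(if g < N then \<Sum>k\<in>C g. left (\<Theta> ! k) else 0) \<le> ?K * L"
      "(if 1 \<le> g \<and> g < N + 1 then \<Sum>k\<in>C (g - 1). L - right (\<Theta> ! k) else 0) \<le> ?K * L"
      "(if g < N then \<Sum>k\<in>C g. bottom (\<Theta> ! k) else 0) \<le> ?K * L"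
      "(if W \<le> g then \<Sum>k\<in>C (g - W). L - top (\<Theta> ! k) else 0) \<le> ?K * L"
      using g lab by (auto intro!: sumC)
    then show "a2 g < B" "a3 g < B" using B_gt(1) by (simp_all add: a2_def a3_def)
  qed
  have gl: "goal_edge g \<le> L" "goal_vert g \<le> L" for g
    using e lo hi by (auto simp: goal_edge_def goal_vert_def)
  have gB: "goal_edge g < B" "goal_vert g < B" for g
    using gl[of g] B_gt(2) by linarith+
  have "(\<Sum>g<N + W. block (a1 g) (a2 g) (a3 g) * Q ^ g) + X * Q ^ (N + W) =
    (\<Sum>g<N + W. goal_block g * Q ^ g) + Y * Q ^ (N + W)"
    using eq unfolding numbers_sum goal_def by (simp add: column_sum a1_def a2_def a3_def)
  moreover have "block (a1 g) (a2 g) (a3 g) < Q" if "g < N + W" for g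
    using block_less[OF bnd[OF that]] .
  moreover have "goal_block g < Q" for g
    unfolding goal_block_def by (rule block_less[OF _ gB]) (use B_gt(2) in auto)
  ultimately have "\<forall>g<N + W. block (a1 g) (a2 g) (a3 g) = goal_block g"
    using digits_inj[of "N + W" "\<lambda>g. block (a1 g) (a2 g) (a3 g)" Q goal_block X Y] by blast
  then have col: "a1 g = (if g < N then 2 else 0)" "a2 g = goal_edge g" "a3 g = goal_vert g" if "g < N + W" for g
    using block_inj[of "a1 g" "a2 g" "a3 g" "if g < N then 2 else 0" "goal_edge g" "goal_vert g"]
      bnd[OF that] gB[of g] B_gt(2) that by (auto simp: goal_block_def)
  have "\<exists>k. C g = {k}" if "g < N" for g
    using col(1)[of g] that by (auto simp: a1_def card_1_singleton_iff)
  then obtain \<kappa> where \<kappa>: "\<And>g. g < N \<Longrightarrow> C g = {\<kappa> g}" by metis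
  define \<tau> where "\<tau> i = \<Theta> ! \<kappa> i" for i
  have kK: "\<kappa> i < ?K" if "i < N" for i using C[OF that] \<kappa>[OF that] by simp
  have lt: "left (\<tau> i) \<le> L" "right (\<tau> i) \<le> L" "bottom (\<tau> i) \<le> L" "top (\<tau> i) \<le> L" if "i < N" for i
    using lab[OF kK[OF that]] by (simp_all add: \<tau>_def)
  have A2: "(if g < N then left (\<tau> g) else 0) + (if 1 \<le> g \<and> g < N + 1 then L - right (\<tau> (g - 1)) else 0) = goal_edge g"
    if "g < N + W" for g
    using col(2)[OF that] \<kappa>[of g] \<kappa>[of "g - 1"] that by (auto simp: a2_def \<tau>_def split: if_splits)
  have A3: "(if g < N then bottom (\<tau> g) else 0) + (if W \<le> g then L - top (\<tau> (g - W)) else 0) = goal_vert g"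
    if "g < N + W" for g
    using col(3)[OF that] \<kappa>[of g] \<kappa>[of "g - W"] that by (auto simp: a3_def \<tau>_def split: if_splits)
  have "tiling W N e lo hi \<tau>"
    unfolding tiling_def
  proof (intro conjI allI impI)
    show "left (\<tau> 0) = e" using A2[of 0] W by (simp add: goal_edge_def)
    show "right (\<tau> (N - 1)) = e" using A2[of N] W lt(2)[of "N - 1"] e by (simp add: goal_edge_def)
    show "right (\<tau> i) = left (\<tau> (Suc i))" if "Suc i < N" for i
      using A2[of "Suc i"] that lt(2)[of i] lt(1)[of "Suc i"] by (simp add: goal_edge_def)
    show "bottom (\<tau> c) = lo c" if "c < W" for c
      using A3[of c] that W by (simp add: goal_vert_def)
    show "top (\<tau> i) = bottom (\<tau> (i + W))" if "i + W < N" for i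
      using A3[of "i + W"] that lt(4)[of i] lt(3)[of "i + W"] by (simp add: goal_vert_def)
    show "top (\<tau> (N - W + c)) = hi c" if "c < W" for c
    proof -
      have eq: "N + c - W = N - W + c" using W by simp
      have "N - W + c < N" using that W by linarith
      from lt(4)[OF this] A3[of "N + c"] that W hi[of c] show ?thesis unfolding goal_vert_def eq by simp
    qed
  qed
  moreover have "\<tau> i \<in> set \<Theta>" if "i < N" for i using kK[OF that] by (simp add: \<tau>_def)
  ultimately show thesis by (rule that)
qed

section \<open>Items as pairs of a cell and a tile\<close>

definition items :: nat where "items = 1 + N * length \<Theta>"

definition item_number :: "nat \<Rightarrow> nat" where
  "item_number j = (if j = 1 then 1 + tile_number 0 zt
     else tile_number ((j - 2) div length \<Theta>) (\<Theta> ! ((j - 2) mod length \<Theta>)))"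

definition item_index :: "nat \<Rightarrow> nat \<Rightarrow> nat" where
  "item_index i k = 2 + i * length \<Theta> + k"

lemma item_number_index: "k < length \<Theta> \<Longrightarrow> item_number (item_index i k) = tile_number i (\<Theta> ! k)"
  using tiles_nonempty by (simp add: item_number_def item_index_def)

lemma item_index_inj:
  assumes "k < length \<Theta>" "k' < length \<Theta>" "item_index i k = item_index i' k'"
  shows "i = i' \<and> k = k'"
proof -
  have "(i * length \<Theta> + k) div length \<Theta> = i"
    if "k < length \<Theta>" for i k using that tiles_nonempty by simp
  from this[OF assms(1), of i] this[OF assms(2), of i']
  have "(i * length \<Theta> + k) div length \<Theta> = i" "(i' * length \<Theta> + k') div length \<Theta> = i'" .
  moreover have "i * length \<Theta> + k = i' * length \<Theta> + k'" using assms(3) by (simp add: item_index_def)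
  ultimately have "i = i'" by metis
  then show ?thesis using assms(3) by (simp add: item_index_def)
qed

lemma item_index_range: "i < N \<Longrightarrow> k < length \<Theta> \<Longrightarrow> item_index i k \<in> {2..items}"
  using cell_index[of i N k "length \<Theta>"] by (simp add: item_index_def items_def)

lemma item_index_surj:
  assumes "j \<in> {2..items}"
  obtains i k where "i < N" "k < length \<Theta>" "j = item_index i k"
proof -
  have K: "0 < length \<Theta>" using tiles_nonempty by simp
  have "j - 2 < N * length \<Theta>" using assms by (auto simp: items_def)
  then have "(j - 2) div length \<Theta> < N" "(j - 2) mod length \<Theta> < length \<Theta>"
    using K by (auto simp: less_mult_imp_div_less)
  moreover have "j = item_index ((j - 2) div length \<Theta>) ((j - 2) mod length \<Theta>)"
  proof -
    have "item_index ((j - 2) div length \<Theta>) ((j - 2) mod length \<Theta>) = 2 + (j - 2)"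
      by (simp add: item_index_def)
    moreover have "2 + (j - 2) = j" using assms by auto
    ultimately show ?thesis by simp
  qed
  ultimately show thesis by (rule that)
qed

text \<open>The constant 5 is the degree \<open>4 * Q ^ (N + W)\<close> plus the leading power in a
  weight, and a tiling uses one item per cell, hence \<open>5 * N\<close>. Conversely the size of
  \<open>P\<close> is not fixed in advance: only the digits below \<open>Q ^ (N + W)\<close> are
  compared, and the placement digits force one item per cell.\<close>

lemma target_iff:
  "(\<exists>P. P \<subseteq> {2..items} \<and> (\<Sum>j\<in>P. 5 * Q ^ (N + W) + item_number j) = goal + 5 * N * Q ^ (N + W)) \<longleftrightarrow>
    (\<exists>\<tau>. tiling W N e lo hi \<tau> \<and> (\<forall>i<N. \<tau> i \<in> set \<Theta>))"
proof
  assume "\<exists>P. P \<subseteq> {2..items} \<and> (\<Sum>j\<in>P. 5 * Q ^ (N + W) + item_number j) = goal + 5 * N * Q ^ (N + W)"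
  then obtain P where P: "P \<subseteq> {2..items}"
    and s: "(\<Sum>j\<in>P. 5 * Q ^ (N + W) + item_number j) = goal + 5 * N * Q ^ (N + W)" by blast
  define C where "C i = {k. k < length \<Theta> \<and> item_index i k \<in> P}" for i
  have fin: "finite (C i)" for i by (simp add: C_def)
  have "P = (\<lambda>(i, k). item_index i k) ` Sigma {..<N} C"
  proof
    show "P \<subseteq> (\<lambda>(i, k). item_index i k) ` Sigma {..<N} C"
    proof
      fix j assume j: "j \<in> P"
      then obtain i k where "i < N" "k < length \<Theta>" "j = item_index i k"
        using item_index_surj P by blast
      then show "j \<in> (\<lambda>(i, k). item_index i k) ` Sigma {..<N} C"
        using j by (intro image_eqI[of _ _ "(i, k)"]) (auto simp: C_def)
    qed
  qed (auto simp: C_def)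
  moreover have "inj_on (\<lambda>(i, k). item_index i k) (Sigma {..<N} C)"
    by (auto simp: inj_on_def C_def dest: item_index_inj)
  ultimately have "sum item_number P = (\<Sum>(i, k)\<in>Sigma {..<N} C. item_number (item_index i k))"
    by (simp add: sum.reindex case_prod_unfold)
  also have "\<dots> = (\<Sum>i<N. \<Sum>k\<in>C i. item_number (item_index i k))"
    using fin by (simp add: sum.Sigma)
  also have "\<dots> = (\<Sum>i<N. \<Sum>k\<in>C i. tile_number i (\<Theta> ! k))"
    by (intro sum.cong refl) (simp add: C_def item_number_index)
  finally have "(\<Sum>i<N. \<Sum>k\<in>C i. tile_number i (\<Theta> ! k)) + (5 * card P) * Q ^ (N + W) = goal + (5 * N) * Q ^ (N + W)"
    using s by (simp add: sum.distrib)
  from selection_tiling[OF _ this] show "\<exists>\<tau>. tiling W N e lo hi \<tau> \<and> (\<forall>i<N. \<tau> i \<in> set \<Theta>)"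
    by (auto simp: C_def)
next
  assume "\<exists>\<tau>. tiling W N e lo hi \<tau> \<and> (\<forall>i<N. \<tau> i \<in> set \<Theta>)"
  then obtain \<tau> where til: "tiling W N e lo hi \<tau>" and mem: "\<And>i. i < N \<Longrightarrow> \<tau> i \<in> set \<Theta>" by blast
  have "\<exists>k. i < N \<longrightarrow> k < length \<Theta> \<and> \<Theta> ! k = \<tau> i" for i
    using mem[of i] by (auto simp: in_set_conv_nth)
  then obtain \<kappa> where \<kappa>: "\<And>i. i < N \<Longrightarrow> \<kappa> i < length \<Theta> \<and> \<Theta> ! \<kappa> i = \<tau> i" by metis
  define P where "P = (\<lambda>i. item_index i (\<kappa> i)) ` {..<N}"
  have inj: "inj_on (\<lambda>i. item_index i (\<kappa> i)) {..<N}"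
  proof (rule inj_onI)
    fix i i' assume "i \<in> {..<N}" "i' \<in> {..<N}" "item_index i (\<kappa> i) = item_index i' (\<kappa> i')"
    then show "i = i'" using item_index_inj[of "\<kappa> i" "\<kappa> i'" i i'] \<kappa>[of i] \<kappa>[of i'] by auto
  qed
  have "(\<Sum>j\<in>P. 5 * Q ^ (N + W) + item_number j) = (\<Sum>i<N. 5 * Q ^ (N + W) + item_number (item_index i (\<kappa> i)))"
    unfolding P_def by (simp add: sum.reindex[OF inj])
  also have "\<dots> = (\<Sum>i<N. tile_number i (\<tau> i)) + 5 * N * Q ^ (N + W)"
    using \<kappa> by (simp add: sum.distrib item_number_index)
  also have "(\<Sum>i<N. tile_number i (\<tau> i)) = goal"
    using tiling_goal[OF til] mem bounded by blast
  finally show "\<exists>P. P \<subseteq> {2..items} \<and> (\<Sum>j\<in>P. 5 * Q ^ (N + W) + item_number j) = goal + 5 * N * Q ^ (N + W)"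
    using \<kappa> item_index_range by (intro exI[of _ P]) (auto simp: P_def)
qed

text \<open>Item 1 takes the place of an ordinary item at cell 0, so the sum is that of a tiling
  plus the 1 by which item 1 is raised.\<close>

lemma fallback:
  assumes til: "tiling W N e lo hi \<tau>" and z: "\<tau> 0 = zt" and mem: "\<And>i. 0 < i \<Longrightarrow> i < N \<Longrightarrow> \<tau> i \<in> set \<Theta>"
  shows "\<exists>P. P \<subseteq> {1..items} \<and> (\<Sum>j\<in>P. 5 * Q ^ (N + W) + item_number j) = goal + 5 * N * Q ^ (N + W) + 1"
proof -
  have "\<exists>k. 0 < i \<and> i < N \<longrightarrow> k < length \<Theta> \<and> \<Theta> ! k = \<tau> i" for i
    using mem[of i] by (auto simp: in_set_conv_nth)
  then obtain \<kappa> where \<kappa>: "\<And>i. 0 < i \<Longrightarrow> i < N \<Longrightarrow> \<kappa> i < length \<Theta> \<and> \<Theta> ! \<kappa> i = \<tau> i" by metis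
  define P where "P = (\<lambda>i. item_index i (\<kappa> i)) ` {1..<N}"
  have inj: "inj_on (\<lambda>i. item_index i (\<kappa> i)) {1..<N}"
  proof (rule inj_onI)
    fix i i' assume "i \<in> {1..<N}" "i' \<in> {1..<N}" "item_index i (\<kappa> i) = item_index i' (\<kappa> i')"
    then show "i = i'" using item_index_inj[of "\<kappa> i" "\<kappa> i'" i i'] \<kappa>[of i] \<kappa>[of i'] by auto
  qed
  have N: "{..<N} = insert 0 {1..<N}" using W by auto
  have "1 \<notin> P" by (auto simp: P_def item_index_def)
  moreover have "finite P" by (simp add: P_def)
  moreover have "(\<Sum>j\<in>P. 5 * Q ^ (N + W) + item_number j) =
      (\<Sum>i=1..<N. 5 * Q ^ (N + W) + item_number (item_index i (\<kappa> i)))"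
    unfolding P_def by (rule sum.reindex[OF inj, unfolded o_def])
  ultimately have "(\<Sum>j\<in>insert 1 P. 5 * Q ^ (N + W) + item_number j) =
      5 * Q ^ (N + W) + item_number 1 + (\<Sum>i=1..<N. 5 * Q ^ (N + W) + item_number (item_index i (\<kappa> i)))"
    by simp
  also have "(\<Sum>i=1..<N. 5 * Q ^ (N + W) + item_number (item_index i (\<kappa> i))) =
      (\<Sum>i=1..<N. 5 * Q ^ (N + W) + tile_number i (\<tau> i))"
    using \<kappa> by (intro sum.cong) (auto simp: item_number_index)
  also have "5 * Q ^ (N + W) + item_number 1 + \<dots> = (\<Sum>i<N. 5 * Q ^ (N + W) + tile_number i (\<tau> i)) + 1"
    unfolding N by (simp add: item_number_def z)
  also have "\<dots> = (\<Sum>i<N. tile_number i (\<tau> i)) + 5 * N * Q ^ (N + W) + 1"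
    by (simp add: sum.distrib)
  also have "(\<Sum>i<N. tile_number i (\<tau> i)) = goal"
  proof (rule tiling_goal[OF til])
    show "left (\<tau> i) \<le> L \<and> bottom (\<tau> i) \<le> L" if "i < N" for i
      using bounded[of "\<tau> i"] mem[of i] z that by (cases "i = 0") auto
  qed
  finally have "(\<Sum>j\<in>insert 1 P. 5 * Q ^ (N + W) + item_number j) = goal + 5 * N * Q ^ (N + W) + 1" .
  moreover have "P \<subseteq> {2..items}"
    unfolding P_def
  proof (rule image_subsetI)
    fix i assume "i \<in> {1..<N}"
    then show "item_index i (\<kappa> i) \<in> {2..items}" using item_index_range[of i "\<kappa> i"] \<kappa>[of i] by auto
  qed
  then have "insert 1 P \<subseteq> {1..items}" by (auto simp: items_def)
  ultimately show ?thesis by blast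
qed

section \<open>Parity and size of the numbers\<close>

lemma B_even: "even B"
proof -
  have "m \<noteq> 0"
  proof
    assume "m = 0"
    then have "B = 1" unfolding B_def by simp
    then show False using B_gt(3) by simp
  qed
  then show ?thesis by (simp add: B_def)
qed

lemma block_even: "even p \<Longrightarrow> even (block p h v)"
  using B_even by (simp add: block_def)

lemma sum_digits_parity:
  assumes "0 < M"
  shows "even (\<Sum>g<M. a g * Q ^ g) \<longleftrightarrow> even (a 0)"
proof -
  have "{..<M} = insert 0 {1..<M}" using assms by auto
  moreover have "even (\<Sum>g=1..<M. a g * Q ^ g)"
    using B_even by (intro dvd_sum) (simp add: Q_def)
  ultimately show ?thesis by simp
qed

lemma tile_number_even: "even (tile_number i t)"
  unfolding tile_number_def using W by (subst sum_digits_parity) (auto simp: tile_block_def block_even)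

lemma goal_even: "even goal"
  unfolding goal_def using W by (subst sum_digits_parity) (auto simp: goal_block_def block_even)

lemma tile_block_less:
  assumes "t \<in> insert zt (set \<Theta>)"
  shows "tile_block i t g + 1 < Q"
proof -
  have "tile_block i t g + 1 = block ((if g = i then 2 else 0) + 1)
      ((if g = i then left t else 0) + (if g = i + 1 then L - right t else 0))
      ((if g = i then bottom t else 0) + (if g = i + W then L - top t else 0))"
    using W by (auto simp: tile_block_def block_def algebra_simps)
  also have "\<dots> < Q"
    using bounded[OF assms] B_gt(2) W by (intro block_less) auto
  finally show ?thesis .
qed

lemma item_number_less: "1 \<le> j \<Longrightarrow> j \<le> items \<Longrightarrow> item_number j < Q ^ (N + W)"
proof (cases "j = 1")
  case True
  \<comment> \<open>The 1 by which item 1 is raised goes into the lowest digit group, where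
    \<open>tile_block_less\<close> leaves room for it.\<close>
  let ?a = "(tile_block 0 zt)(0 := tile_block 0 zt 0 + 1)"
  have NW: "{..<N + W} = insert 0 {1..<N + W}" using W by auto
  have "item_number j = (\<Sum>g<N + W. ?a g * Q ^ g)"
    unfolding NW by (simp add: True item_number_def tile_number_def NW[symmetric]) (simp add: NW)
  also have "\<dots> < Q ^ (N + W)"
    using tile_block_less[of zt 0] by (intro digits_less) (auto intro: Suc_lessD)
  finally show ?thesis .
next
  case False
  assume "1 \<le> j" "j \<le> items"
  with False obtain i k where ik: "i < N" "k < length \<Theta>" "j = item_index i k"
    using item_index_surj[of j] by auto
  have "tile_number i (\<Theta> ! k) < Q ^ (N + W)"
    unfolding tile_number_def using tile_block_less[of "\<Theta> ! k" i] ik(2)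
    by (intro digits_less) (auto intro: Suc_lessD)
  then show ?thesis using ik by (simp add: item_number_index)
qed

lemma goal_less: "goal < Q ^ (N + W)"
proof -
  have "goal_edge g \<le> L" "goal_vert g \<le> L" for g
    using e lo hi by (auto simp: goal_edge_def goal_vert_def)
  then show ?thesis
    unfolding goal_def goal_block_def using B_gt(2)
    by (intro digits_less block_less) (auto intro: le_less_trans[of _ L])
qed

end


section \<open>Generating the instance\<close>

fun word :: "nat \<Rightarrow> nat \<Rightarrow> bool list" where
  "word 0 n = []"
| "word (Suc m) n = odd n # word m (n div 2)"

fun bits_value :: "bool list \<Rightarrow> nat" where
  "bits_value [] = 0"
| "bits_value (b # bs) = of_bool b + 2 * bits_value bs"

lemma length_word [simp]: "length (word m n) = m"
  by (induction m arbitrary: n) auto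

lemma bits_value_word: "n < 2 ^ m \<Longrightarrow> bits_value (word m n) = n"
proof (induction m arbitrary: n)
  case (Suc m)
  then have "bits_value (word m (n div 2)) = n div 2" by simp
  then show ?case by (simp add: of_bool_odd_eq_mod_2)
qed simp

lemma bits_value_append: "bits_value (xs @ ys) = bits_value xs + 2 ^ length xs * bits_value ys"
  by (induction xs) (auto simp: algebra_simps)

text \<open>Subtraction from \<open>2 ^ length bs - 1\<close> is bitwise negation, so padding
  weights can be written without any borrowing.\<close>

lemma bits_value_Not: "bits_value (map Not bs) + bits_value bs + 1 = 2 ^ length bs"
  by (induction bs) auto

text \<open>\<open>binary\<close> lists low bits first and has no leading zeros, so a word of fixed
  width is reproduced literally only below a positive top part \<open>n\<close>.\<close>

lemma binary_bits_value: "0 < n \<Longrightarrow> binary (bits_value bs + 2 ^ length bs * n) = bs @ binary n"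
proof (induction bs)
  case (Cons b bs)
  define v where "v = bits_value bs + 2 ^ length bs * n"
  have v: "bits_value (b # bs) + 2 ^ length (b # bs) * n = of_bool b + 2 * v"
    by (simp add: v_def algebra_simps)
  have "0 < v" using Cons.prems by (simp add: v_def)
  then have "binary (of_bool b + 2 * v) = b # binary v"
    by (subst binary_Cons) auto
  moreover have "binary v = bs @ binary n" using Cons by (simp add: v_def)
  ultimately show ?case unfolding v by simp
qed simp

lemma binary_1: "binary 1 = [True]" and binary_2: "binary 2 = [False, True]"
  by (simp_all add: binary_Cons binary_eq_Nil_iff)

definition bit_items :: "bool list \<Rightarrow> bool list" where
  "bit_items bs = concat (map (\<lambda>b. [True, b]) bs)"

lemma bit_items_append [simp]: "bit_items (xs @ ys) = bit_items xs @ bit_items ys"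
  by (simp add: bit_items_def)

lemma bit_items_concat: "bit_items (concat xs) = concat (map bit_items xs)"
  by (induction xs) (auto simp: bit_items_def)

lemma encode_nat_items: "encode_nat n = bit_items (binary n) @ [False]"
  by (simp add: encode_nat_def encode_list_def bit_items_def)

lemma binary_items_eq: "binary_items n = bit_items (binary n)"
  by (simp add: binary_items_def bit_items_def)

lemma concat_map_concat: "concat (map f (concat (map g xs))) = concat (map (\<lambda>j. concat (map f (g j))) xs)"
  by (induction xs) auto

lemma concat_map_seg:
  "concat (map f [0..<a + b]) = concat (map f [0..<a]) @ concat (map (\<lambda>i. f (a + i)) [0..<b])"
proof -
  have "[0..<a + b] = [0..<a] @ map (\<lambda>i. a + i) [0..<b]"
    by (rule nth_equalityI) (auto simp: nth_append)
  then show ?thesis by (simp add: o_def)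
qed

lemma length_concat_upt: "length (concat (map f [0..<n])) = (\<Sum>i<n. length (f i))"
  by (induction n) auto

lemma upt_blocks: "concat (map (\<lambda>i. map (\<lambda>k. s + i * K + k) [0..<K]) [0..<n]) = [s..<s + n * (K :: nat)]"
proof (induction n)
  case (Suc n)
  have "map (\<lambda>k. s + n * K + k) [0..<K] = [s + n * K..<s + n * K + K]"
    by (rule nth_equalityI) auto
  then have "concat (map (\<lambda>i. map (\<lambda>k. s + i * K + k) [0..<K]) [0..<Suc n]) =
      [s..<s + n * K] @ [s + n * K..<s + n * K + K]"
    using Suc by simp
  also have "\<dots> = [s..<s + n * K + K]"
    by (rule upt_add_eq_append[symmetric]) simp
  finally show ?case by (simp add: ac_simps)
qed simp

abbreviation put :: "bool list \<Rightarrow> gen" where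
  "put bs \<equiv> Emit (bit_items bs)"

abbreviation tick :: gen where
  "tick \<equiv> Emit [True]"

fun seqs :: "gen list \<Rightarrow> gen" where
  "seqs [] = Emit []"
| "seqs (g # gs) = g \<triangleright> seqs gs"

lemma sem_seqs: "sem x d (seqs gs) E = concat (map (\<lambda>g. sem x d g E) gs)"
  by (induction gs) auto

lemma scoped_seqs: "scoped d (seqs gs) \<longleftrightarrow> (\<forall>g\<in>set gs. scoped d g)"
  by (induction gs) auto

lemma sem_For_put: "sem x d (For v (put bs)) E = bit_items (concat (replicate (E v) bs))"
  by (simp add: bit_items_concat map_replicate_const)

lemma length_sem_For_Emit: "length (sem x d (For v (Emit bs)) E) = E v * length bs"
  by (simp add: length_concat_upt)

text \<open>Horner's rule on lengths: the value of the polynomial is the length of the output, which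
  \<open>Bind\<close> turns into a variable.\<close>

fun poly_gen :: "nat \<Rightarrow> nat list \<Rightarrow> gen" where
  "poly_gen v [] = Emit []"
| "poly_gen v (a # as) = Emit (replicate a True) \<triangleright> For v (poly_gen v as)"

lemma length_sem_poly_gen: "v < d \<Longrightarrow> length (sem x d (poly_gen v as) E) = poly (Poly as) (E v)"
  by (induction as arbitrary: d E) (simp_all add: length_concat_upt)

lemma scoped_poly_gen: "v < d \<Longrightarrow> scoped d (poly_gen v as)"
  by (induction as arbitrary: d) auto

text \<open>Nothing fixed here depends on the input: tiles, label codes and digit width come from
  the language alone, so they may occur as constants in the generators.\<close>

locale reduction =
  fixes p r :: "nat poly" and \<Theta> :: "(nat, nat) tile list" and zt :: "(nat, nat) tile"
    and L m e :: nat and lbl :: "vlabel \<Rightarrow> nat"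
  assumes digits: "\<And>x. tile_digits \<Theta> zt L m e (row_width p r x) (row_count p r x * row_width p r x)
    (\<lambda>c. lbl (edge_label (row_width p r x) (input_row p r x) c))
    (\<lambda>c. lbl (edge_label (row_width p r x) (\<lambda>_. Done) c))"
begin

definition group :: "nat \<Rightarrow> nat \<Rightarrow> nat \<Rightarrow> bool list" where
  "group a h v = word m a @ word m h @ word m v"

definition flip :: "bool \<Rightarrow> bool list \<Rightarrow> bool list" where
  "flip f bs = (if f then map Not bs else bs)"

text \<open>Variable 9 is the cell \<open>i\<close>, variable 10 the number of cells after it,
  variable 4 the row width minus 2. Read from the low end, the tile fills the groups
  \<open>i\<close>, \<open>i + 1\<close> and \<open>i + row_width p r x\<close>, and zero groups
  fill the gaps. The final bits form the top part: 1 for a weight, 2 for a padding weight.\<close>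

definition weight_gen :: "bool \<Rightarrow> nat \<Rightarrow> (nat, nat) tile \<Rightarrow> gen" where
  "weight_gen f a t =
     For 9 (put (flip f (group 0 0 0))) \<triangleright> put (flip f (group a (left t) (bottom t))) \<triangleright>
     put (flip f (group 0 (L - right t) 0)) \<triangleright> For 4 (put (flip f (group 0 0 0))) \<triangleright>
     put (flip f (group 0 0 (L - top t))) \<triangleright> For 10 (put (flip f (group 0 0 0))) \<triangleright>
     put (if f then [False, True] else [True]) \<triangleright> Emit [False]"

text \<open>Low bits come first, so the pair \<open>True, False\<close> in front of the digits of
  \<open>j\<close> doubles \<open>j\<close>. The numbering of vertices by \<open>2 * j\<close> and
  \<open>2 * j + 1\<close> makes this possible.\<close>

definition candidate_gen :: gen where
  "candidate_gen = Emit [True, False] \<triangleright> Bin 11 \<triangleright> Emit [False]"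

definition follower_gen :: gen where
  "follower_gen = Emit [True, True] \<triangleright> Bin 11 \<triangleright> Emit [False]"

definition edges_gen :: "nat \<Rightarrow> (nat, nat) tile \<Rightarrow> gen" where
  "edges_gen a t =
     tick \<triangleright> candidate_gen \<triangleright> Emit (encode_nat 0 @ encode_nat 1 @ encode_nat 1) \<triangleright>
     tick \<triangleright> follower_gen \<triangleright> candidate_gen \<triangleright> weight_gen False a t \<triangleright> Emit (encode_nat 1) \<triangleright>
     tick \<triangleright> follower_gen \<triangleright> Emit (encode_nat 0) \<triangleright> weight_gen True a t \<triangleright> Emit (encode_nat 1) \<triangleright>
     tick \<triangleright> follower_gen \<triangleright> Emit (encode_nat 1 @ encode_nat 1 @ encode_nat 1) \<triangleright>
     tick \<triangleright> Emit (encode_nat 0) \<triangleright> follower_gen \<triangleright> Emit (encode_nat 1 @ encode_nat 1)"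

text \<open>The index of an item is produced as the length of a string and becomes variable 11. The
  raised item is emitted once, at cell 0, with placement digit 3: the usual 2 plus the extra
  1.\<close>

definition item_loop :: "(nat \<Rightarrow> (nat, nat) tile \<Rightarrow> gen) \<Rightarrow> gen" where
  "item_loop body = For 5
     (IfZero 9 (Bind tick (body 3 zt)) (Emit []) \<triangleright>
      seqs (map (\<lambda>k. Bind (Emit (replicate (2 + k) True) \<triangleright> For 9 (Emit (replicate (length \<Theta>) True)))
        (body 2 (\<Theta> ! k))) [0..<length \<Theta>]))"

definition lower_label :: "bool \<Rightarrow> bool \<Rightarrow> nat \<Rightarrow> bool \<Rightarrow> bool \<Rightarrow> bool list" where
  "lower_label fst_col lst_col a f o' =
     group 2 (if fst_col then e else L) (lbl ((fst_col, lst_col), Init a f o'))"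

definition column_gen :: "bool \<Rightarrow> nat \<Rightarrow> gen" where
  "column_gen f v = IfZero v
     (IfSymbol v (put (lower_label False False 0 f True)) (put (lower_label False False 1 f True))
       (put (lower_label False False 2 f True)))
     (IfSymbol v (put (lower_label False False 0 f False)) (put (lower_label False False 1 f False))
       (put (lower_label False False 2 f False)))"

text \<open>The groups from the low end: the first column, blank columns left of tape cell 0,
  certificate columns, columns to their right that may still show input, the last column; then the
  cells above the lower row, whose edges are all inner; then the groups beyond the last cell, which
  hold the upper border.\<close>

definition goal_gen :: gen where
  "goal_gen =
     put (lower_label True False 0 False False) \<triangleright>
     For 3 (put (lower_label False False 0 False False)) \<triangleright>
     For 1 (column_gen True 9) \<triangleright>
     For 3 (Bind (For 1 tick \<triangleright> For 9 tick) (column_gen False 11)) \<triangleright>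
     put (lower_label False True 0 False False) \<triangleright>
     For 8 (put (group 2 L L)) \<triangleright>
     put (group 0 (L - e) (L - lbl ((True, False), Done))) \<triangleright>
     For 4 (put (group 0 0 (L - lbl ((False, False), Done)))) \<triangleright>
     put (group 0 0 (L - lbl ((False, True), Done)))"

text \<open>The denominator is \<open>8 * Q ^ (N + W) * (items + 1)\<close>: the degree contributes
  the factor 4 and the number of vertices another 2, which together become three zero bits. Both
  numbers of the fraction end in the digits of a counter, \<open>5 * N\<close> in variable 7 and
  \<open>items + 1\<close> in variable 6.\<close>

definition target_gen :: gen where
  "target_gen = goal_gen \<triangleright> Bin 7 \<triangleright> Emit [False] \<triangleright>
     For 5 (put (group 0 0 0)) \<triangleright> For 4 (put (group 0 0 0)) \<triangleright> put (group 0 0 0) \<triangleright> put (group 0 0 0) \<triangleright>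
     put [False, False, False] \<triangleright> Bin 6 \<triangleright> Emit [False]"

definition instance_gen :: gen where
  "instance_gen = Emit [True, False] \<triangleright> Bin 6 \<triangleright> Emit [False] \<triangleright>
     Emit ([True] @ encode_nat 1 @ encode_nat 0 @ encode_nat 1 @ encode_nat 1) \<triangleright>
     item_loop edges_gen \<triangleright> Emit [False] \<triangleright>
     Emit (encode_list encode_nat [0, 1]) \<triangleright> target_gen \<triangleright>
     item_loop (\<lambda>_ _. tick \<triangleright> candidate_gen) \<triangleright> Emit [False] \<triangleright>
     Bind (tick \<triangleright> For 5 (Emit (replicate (length \<Theta>) True))) (Bin 9 \<triangleright> Emit [False])"

text \<open>Generators cannot subtract. The row width minus 2 is therefore built as the sum that it
  is, and the cells above the first row are counted by a loop over all rows that emits nothing at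
  index 0.\<close>

definition reduction_gen :: gen where
  "reduction_gen =
     Bind EmitInput (Bind (poly_gen 0 (coeffs p)) (Bind (For 0 tick \<triangleright> For 1 tick)
     (Bind (poly_gen 2 (coeffs r) \<triangleright> For 2 tick \<triangleright> Emit [True, True])
     (Bind (For 3 tick \<triangleright> For 3 tick \<triangleright> For 1 tick)
     (Bind (For 3 (For 4 tick \<triangleright> Emit [True, True]))
     (Bind (For 5 (Emit (replicate (length \<Theta>) True)) \<triangleright> Emit [True, True])
     (Bind (For 5 (Emit (replicate 5 True)))
     (Bind (For 3 (IfZero 9 (Emit []) (For 4 tick \<triangleright> Emit [True, True]))) instance_gen))))))))"

lemma scoped_reduction_gen: "scoped 0 reduction_gen"
  by (simp add: reduction_gen_def instance_gen_def target_gen_def goal_gen_def column_gen_def item_loop_def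
      edges_gen_def follower_gen_def candidate_gen_def weight_gen_def scoped_seqs scoped_poly_gen)

end

section \<open>Output of the generators on a fixed input\<close>

locale reduction_at = reduction + fixes x :: "bool list"
begin

abbreviation "Z \<equiv> row_count p r x"
abbreviation "Wd \<equiv> row_width p r x"
abbreviation "Nc \<equiv> row_count p r x * row_width p r x"
abbreviation "Pn \<equiv> poly p (length x)"

sublocale tile_digits \<Theta> zt L m e Wd Nc
  "\<lambda>c. lbl (edge_label Wd (input_row p r x) c)" "\<lambda>c. lbl (edge_label Wd (\<lambda>_. Done) c)"
  by (rule digits)

definition "env E \<longleftrightarrow> E 1 = Pn \<and> E 3 = Z \<and> E 4 = Wd - 2 \<and> E 5 = Nc \<and> E 6 = items + 1 \<and>
  E 7 = 5 * Nc \<and> E (8::nat) = (Z - 1) * Wd"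

lemma Wd: "Wd = 2 * Z + Pn + 2"
  by (simp add: row_width_def)

lemma Z2: "2 \<le> Z" "length x + Pn < Z"
  by (simp_all add: row_count_def)

lemma sem_reduction_gen:
  obtains E where "env E" "sem x 0 reduction_gen (\<lambda>_. 0) = sem x 9 instance_gen E"
proof -
  have sumZ: "(\<Sum>i<Z. if i = 0 then 0 else Wd) = (Z - 1) * Wd"
  proof -
    have "{..<Z} = insert 0 {1..<Z}" using Z2 by auto
    then show ?thesis by simp
  qed
  have W2: "Suc (Suc (Wd - 2)) = Wd" using W by simp
  have pg: "length (sem x d (poly_gen v (coeffs q)) E') = poly q (E' v)" if "v < d" for d v q E'
    using length_sem_poly_gen[OF that, of x "coeffs q" E'] by simp
  define E1 :: "nat \<Rightarrow> nat" where "E1 = (\<lambda>_. 0)(0 := length x)"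
  define E2 where "E2 = E1(1 := Pn)"
  define E3 where "E3 = E2(2 := length x + Pn)"
  define E4 where "E4 = E3(3 := Z)"
  define E5 where "E5 = E4(4 := Wd - 2)"
  define E6 where "E6 = E5(5 := Nc)"
  define E7 where "E7 = E6(6 := items + 1)"
  define E8 where "E8 = E7(7 := 5 * Nc)"
  define E where "E = E8(8 := (Z - 1) * Wd)"
  note Es = E1_def E2_def E3_def E4_def E5_def E6_def E7_def E8_def E_def
  have "sem x 0 (Bind EmitInput g) (\<lambda>_. 0) = sem x 1 g E1" for g
    by (simp add: E1_def)
  moreover have "sem x 1 (Bind (poly_gen 0 (coeffs p)) g) E1 = sem x 2 g E2" for g
  proof -
    have "length (sem x 2 (poly_gen 0 (coeffs p)) E1) = Pn" by (simp add: pg E1_def)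
    then show ?thesis by (simp add: E2_def numeral_2_eq_2)
  qed
  moreover have "sem x 2 (Bind (For 0 tick \<triangleright> For 1 tick) g) E2 = sem x 3 g E3" for g
    by (simp add: length_concat_upt E3_def) (simp add: E1_def E2_def)
  moreover have "sem x 3 (Bind (poly_gen 2 (coeffs r) \<triangleright> For 2 tick \<triangleright> Emit [True, True]) g) E3 = sem x 4 g E4" for g
  proof -
    have "length (sem x 4 (poly_gen 2 (coeffs r) \<triangleright> For 2 tick \<triangleright> Emit [True, True]) E3) = Z"
      by (simp add: pg length_concat_upt row_count_def) (simp add: E3_def)
    then show ?thesis by (simp add: E4_def)
  qed
  moreover have "sem x 4 (Bind (For 3 tick \<triangleright> For 3 tick \<triangleright> For 1 tick) g) E4 = sem x 5 g E5" for g
  proof -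
    have "length (sem x 5 (For 3 tick \<triangleright> For 3 tick \<triangleright> For 1 tick) E4) = Wd - 2"
      by (simp add: length_concat_upt) (simp add: E4_def E3_def E2_def Wd)
    then show ?thesis by (simp add: E5_def)
  qed
  moreover have "sem x 5 (Bind (For 3 (For 4 tick \<triangleright> Emit [True, True])) g) E5 = sem x 6 g E6" for g
  proof -
    have "length (sem x 6 (For 3 (For 4 tick \<triangleright> Emit [True, True])) E5) = Nc"
    proof -
      have "Z + (Z + Z * (Wd - 2)) = Z * Suc (Suc (Wd - 2))" by simp
      then have "Z + (Z + Z * (Wd - 2)) = Nc" unfolding W2 .
      then show ?thesis by (simp add: length_concat_upt) (simp add: E5_def E4_def)
    qed
    then show ?thesis by (simp add: E6_def)
  qed
  moreover have "sem x 6 (Bind (For 5 (Emit (replicate (length \<Theta>) True)) \<triangleright> Emit [True, True]) g) E6 = sem x 7 g E7" for g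
  proof -
    have "length (sem x 7 (For 5 (Emit (replicate (length \<Theta>) True)) \<triangleright> Emit [True, True]) E6) = items + 1"
      by (simp add: length_concat_upt items_def) (simp add: E6_def)
    then show ?thesis by (simp add: E7_def)
  qed
  moreover have "sem x 7 (Bind (For 5 (Emit (replicate 5 True))) g) E7 = sem x 8 g E8" for g
  proof -
    have "length (sem x 8 (For 5 (Emit (replicate 5 True))) E7) = 5 * Nc"
      by (simp add: length_concat_upt) (simp add: E7_def E6_def)
    then show ?thesis by (simp add: E8_def)
  qed
  moreover have "sem x 8 (Bind (For 3 (IfZero 9 (Emit []) (For 4 tick \<triangleright> Emit [True, True]))) g) E8 = sem x 9 g E" for g
  proof -
    have v: "E8 3 = Z" "E8 4 = Wd - 2" by (simp_all add: Es)
    have "length (sem x 9 (For 3 (IfZero 9 (Emit []) (For 4 tick \<triangleright> Emit [True, True]))) E8) =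
        (\<Sum>i<Z. if i = 0 then 0 else Wd)"
      using W2 by (simp add: length_concat_upt v if_distrib[of length] cong: if_cong)
    then show ?thesis by (simp add: E_def sumZ)
  qed
  ultimately have "sem x 0 reduction_gen (\<lambda>_. 0) = sem x 9 instance_gen E"
    unfolding reduction_gen_def by (simp only:)
  then show thesis using that[of E] by (simp add: env_def Es)
qed

lemma length_group [simp]: "length (group a h v) = 3 * m"
  by (simp add: group_def)

lemma Q_power: "Q = 2 ^ (3 * m)"
  by (simp add: Q_def B_def power_mult[symmetric] mult.commute)

lemma bits_value_group:
  assumes "a < B" "h < B" "v < B"
  shows "bits_value (group a h v) = block a h v"
  using assms by (simp add: group_def bits_value_append bits_value_word block_def B_def)

lemma length_groups: "length (concat (map (\<lambda>g. group (a g) (h g) (v g)) [0..<n])) = 3 * m * n"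
  by (induction n) simp_all

lemma bits_value_groups:
  "bits_value (concat (map (\<lambda>g. group (a g) (h g) (v g)) [0..<n])) = (\<Sum>g<n. bits_value (group (a g) (h g) (v g)) * Q ^ g)"
proof (induction n)
  case (Suc n)
  have "2 ^ (3 * m * n) = Q ^ n" by (simp add: Q_power power_mult)
  then show ?case using Suc by (simp add: bits_value_append length_groups del: length_concat)
qed simp

lemma zero_groups:
  "bits_value (concat (replicate n (group 0 0 0))) = 0" "length (concat (replicate n (group 0 0 0))) = 3 * m * n"
proof -
  have "0 < B" using B_gt(3) by simp
  then have "bits_value (group 0 0 0) = 0" by (simp add: bits_value_group)
  then show "bits_value (concat (replicate n (group 0 0 0))) = 0"
    by (induction n) (simp_all add: bits_value_append)
  show "length (concat (replicate n (group 0 0 0))) = 3 * m * n"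
    by (induction n) simp_all
qed

definition number_bits :: "nat \<Rightarrow> nat \<Rightarrow> (nat, nat) tile \<Rightarrow> bool list" where
  "number_bits i a t = concat (replicate i (group 0 0 0)) @ group a (left t) (bottom t) @
     group 0 (L - right t) 0 @ concat (replicate (Wd - 2) (group 0 0 0)) @ group 0 0 (L - top t) @
     concat (replicate (Nc - Suc i) (group 0 0 0))"

lemma tile_number_eq:
  assumes "i < Nc"
  shows "tile_number i t = block 2 (left t) (bottom t) * Q ^ i + block 0 (L - right t) 0 * Q ^ (i + 1) +
    block 0 0 (L - top t) * Q ^ (i + Wd)"
proof -
  have d: "(\<Sum>g<Nc + Wd. (if g = k then y else 0) * Q ^ g) = y * Q ^ k" if "k < Nc + Wd" for k y
  proof -
    have "(\<Sum>g<Nc + Wd. (if g = k then y else 0) * Q ^ g) = (\<Sum>g<Nc + Wd. if g = k then y * Q ^ g else 0)"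
      by (intro sum.cong) auto
    then show ?thesis using that by simp
  qed
  show ?thesis
    unfolding tile_number_def tile_block_def distrib_right sum.distrib
    using assms W by (simp only: d)
qed

text \<open>The digit \<open>a\<close> stands where \<open>tile_number\<close> has a 2; the equation
  is additive to avoid truncated subtraction. For \<open>a = 3\<close> and \<open>i = 0\<close> it
  yields the tile number plus 1.\<close>

lemma number_bits_value:
  assumes i: "i < Nc" and a: "a < B" and t: "t \<in> insert zt (set \<Theta>)"
  shows "bits_value (number_bits i a t) + 2 * Q ^ i = tile_number i t + a * Q ^ i"
    and "2 ^ length (number_bits i a t) = Q ^ (Nc + Wd)"
proof -
  have lb: "left t < B" "right t < B" "bottom t < B" "top t < B" "0 < B" "L - right t < B" "L - top t < B"
    using bounded[OF t] B_gt(2) by auto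
  have len: "2 ^ (3 * m * n) = Q ^ n" for n by (simp add: Q_power power_mult)
  have len1: "2 ^ (3 * m) = Q" by (simp add: Q_power)
  have "bits_value (number_bits i a t) =
    Q ^ i * (block a (left t) (bottom t) + Q * (block 0 (L - right t) 0 + Q * (Q ^ (Wd - 2) * block 0 0 (L - top t))))"
    by (simp only: number_bits_def bits_value_append zero_groups bits_value_group[OF a lb(1,3)]
        bits_value_group[OF lb(5,6,5)] bits_value_group[OF lb(5,5,7)] length_group len len1 add_0 mult_0_right add_0_right)
  also have "\<dots> = block a (left t) (bottom t) * Q ^ i + block 0 (L - right t) 0 * Q ^ (i + 1) +
      block 0 0 (L - top t) * (Q ^ i * Q * Q * Q ^ (Wd - 2))"
    by (simp add: algebra_simps)
  also have "Q ^ i * Q * Q * Q ^ (Wd - 2) = Q ^ (i + Wd)"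
  proof -
    have "i + Wd = i + 1 + 1 + (Wd - 2)" using W(1) by simp
    then show ?thesis by (simp only: power_add power_one_right)
  qed
  finally have "bits_value (number_bits i a t) + 2 * Q ^ i = block a (left t) (bottom t) * Q ^ i + 2 * Q ^ i +
      block 0 (L - right t) 0 * Q ^ (i + 1) + block 0 0 (L - top t) * Q ^ (i + Wd)" by simp
  also have "block a (left t) (bottom t) * Q ^ i + 2 * Q ^ i = block 2 (left t) (bottom t) * Q ^ i + a * Q ^ i"
    by (simp add: block_def algebra_simps)
  finally show "bits_value (number_bits i a t) + 2 * Q ^ i = tile_number i t + a * Q ^ i"
    unfolding tile_number_eq[OF i] by simp
  have "length (number_bits i a t) = 3 * m * (i + 1 + 1 + (Wd - 2) + 1 + (Nc - Suc i))"
    by (simp add: number_bits_def zero_groups algebra_simps)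
  also have "i + 1 + 1 + (Wd - 2) + 1 + (Nc - Suc i) = Nc + Wd" using i W(1) by simp
  finally show "2 ^ length (number_bits i a t) = Q ^ (Nc + Wd)" by (simp only: len)
qed

definition item_at :: "nat \<Rightarrow> nat \<Rightarrow> (nat, nat) tile \<Rightarrow> nat \<Rightarrow> bool" where
  "item_at i a t j \<longleftrightarrow> i < Nc \<and> (j = 1 \<and> i = 0 \<and> a = 3 \<and> t = zt \<or>
     (\<exists>k<length \<Theta>. j = item_index i k \<and> a = 2 \<and> t = \<Theta> ! k))"

text \<open>The leading power puts a top bit at the same place in all weights, so binary notation
  keeps the leading zeros of the item number.\<close>

definition item_weight :: "nat \<Rightarrow> nat" where
  "item_weight j = Q ^ (Nc + Wd) + item_number j"

text \<open>Removing the weight from \<open>4 * Q ^ (Nc + Wd) - 1\<close> leaves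
  \<open>2 * Q ^ (Nc + Wd)\<close> plus the bitwise complement of the item number, and the missing 1
  is the unit edge of the follower.\<close>

definition item_rest :: "nat \<Rightarrow> nat" where
  "item_rest j = 4 * Q ^ (Nc + Wd) - 1 - item_weight j"

lemma item_at_bits:
  assumes "item_at i a t j"
  shows "bits_value (number_bits i a t) = item_number j" "2 ^ length (number_bits i a t) = Q ^ (Nc + Wd)"
proof -
  have i: "i < Nc" and a: "a < B" and t: "t \<in> insert zt (set \<Theta>)"
    using assms B_gt(2) by (auto simp: item_at_def)
  note v = number_bits_value[OF this]
  show "2 ^ length (number_bits i a t) = Q ^ (Nc + Wd)" by (rule v(2))
  show "bits_value (number_bits i a t) = item_number j"
    using v(1) assms by (auto simp: item_at_def item_number_index) (auto simp: item_number_def)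
qed

lemma binary_item_weight:
  assumes "item_at i a t j"
  shows "binary (item_weight j) = number_bits i a t @ [True]"
proof -
  have "item_weight j = bits_value (number_bits i a t) + 2 ^ length (number_bits i a t) * 1"
    unfolding item_at_bits[OF assms] by (simp add: item_weight_def)
  then show ?thesis by (simp only: binary_bits_value[of 1] binary_1 zero_less_one)
qed

lemma binary_item_rest:
  assumes "item_at i a t j"
  shows "binary (item_rest j) = map Not (number_bits i a t) @ [False, True]"
proof -
  have "bits_value (map Not (number_bits i a t)) + item_number j + 1 = Q ^ (Nc + Wd)"
    using bits_value_Not[of "number_bits i a t"] unfolding item_at_bits[OF assms] .
  then have "item_rest j = bits_value (map Not (number_bits i a t)) + Q ^ (Nc + Wd) * 2"
    by (simp add: item_rest_def item_weight_def)
  also have "Q ^ (Nc + Wd) = 2 ^ length (map Not (number_bits i a t))"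
    unfolding length_map item_at_bits[OF assms] ..
  finally show ?thesis by (simp only: binary_bits_value[of 2] binary_2 zero_less_numeral)
qed

lemma flip_concat: "flip f (concat xs) = concat (map (flip f) xs)"
  by (induction xs) (auto simp: flip_def)

lemma flip_append: "flip f (xs @ ys) = flip f xs @ flip f ys"
  by (simp add: flip_def)

lemma sem_weight_gen:
  assumes E: "E 9 = i" "E 10 = Nc - Suc i" "E 4 = Wd - 2"
  shows "sem x d (weight_gen f a t) E =
    bit_items (flip f (number_bits i a t) @ (if f then [False, True] else [True])) @ [False]"
  by (simp add: weight_gen_def sem_For_put E number_bits_def flip_append flip_concat del: sem.simps(3))

lemma sem_weight_gen_item:
  assumes "item_at i a t j" "E 9 = i" "E 10 = Nc - Suc i" "E 4 = Wd - 2"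
  shows "sem x d (weight_gen False a t) E = encode_nat (item_weight j)"
    and "sem x d (weight_gen True a t) E = encode_nat (item_rest j)"
  unfolding encode_nat_items binary_item_weight[OF assms(1)] binary_item_rest[OF assms(1)]
    sem_weight_gen[OF assms(2-4)]
  by (simp_all add: flip_def)

lemma binary_even: "0 < j \<Longrightarrow> binary (2 * j) = False # binary j"
  and binary_odd: "binary (2 * j + 1) = True # binary j"
  by (simp_all add: binary_Cons)

lemma sem_vertex_gens:
  assumes "E 11 = j" "0 < j"
  shows "sem x d candidate_gen E = encode_nat (2 * j)" "sem x d follower_gen E = encode_nat (2 * j + 1)"
proof -
  have "bit_items (b # bs) = [True, b] @ bit_items bs" for b bs by (simp add: bit_items_def)
  then show "sem x d candidate_gen E = encode_nat (2 * j)" "sem x d follower_gen E = encode_nat (2 * j + 1)"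
    unfolding encode_nat_items binary_even[OF assms(2)] binary_odd
    using assms(1) by (simp_all add: candidate_gen_def follower_gen_def binary_items_eq)
qed

abbreviation encode_edge :: "(nat \<times> nat) \<times> fraction \<Rightarrow> bool list" where
  "encode_edge \<equiv> encode_pair encode_nat_pair encode_nat_pair"

lemma sem_edges_gen:
  assumes "item_at i a t j" "E 9 = i" "E 10 = Nc - Suc i" "E 4 = Wd - 2" "E 11 = j"
  shows "sem x d (edges_gen a t) E = concat (map (\<lambda>y. True # encode_edge y) (item_edges item_weight item_rest j))"
proof -
  have j: "0 < j" using assms(1) by (auto simp: item_at_def item_index_def)
  show ?thesis
    by (simp add: edges_gen_def sem_vertex_gens[where E = E, OF assms(5) j] sem_weight_gen_item[where E = E, OF assms(1-4)]
        item_edges_def encode_pair_def)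
qed

lemma sem_item_loop:
  assumes E: "env E"
    and body: "\<And>i a t j. item_at i a t j \<Longrightarrow>
      sem x 12 (body a t) (E(9 := i, 10 := Nc - Suc i, 11 := j)) = f j"
  shows "sem x 9 (item_loop body) E = concat (map f [1..<Suc items])"
proof -
  define G where "G i = (if i = 0 then f 1 else []) @ concat (map (\<lambda>k. f (item_index i k)) [0..<length \<Theta>])" for i
  have G: "sem x 11 (IfZero 9 (Bind tick (body 3 zt)) (Emit []) \<triangleright>
      seqs (map (\<lambda>k. Bind (Emit (replicate (2 + k) True) \<triangleright> For 9 (Emit (replicate (length \<Theta>) True)))
        (body 2 (\<Theta> ! k))) [0..<length \<Theta>])) (E(9 := i, 10 := Nc - Suc i)) = G i" if i: "i < Nc" for i
  proof -
    have 1: "sem x 11 (Bind tick (body 3 zt)) (E(9 := i, 10 := Nc - Suc i)) = f 1" if "i = 0"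
      using body[of i 3 zt 1] i that by (simp add: item_at_def)
    have 2: "sem x 11 (Bind (Emit (replicate (2 + k) True) \<triangleright> For 9 (Emit (replicate (length \<Theta>) True)))
        (body 2 (\<Theta> ! k))) (E(9 := i, 10 := Nc - Suc i)) = f (item_index i k)" if k: "k < length \<Theta>" for k
    proof -
      have "length (sem x 12 (Emit (replicate (2 + k) True) \<triangleright> For 9 (Emit (replicate (length \<Theta>) True)))
          (E(9 := i, 10 := Nc - Suc i))) = item_index i k"
        using length_sem_For_Emit[of x 12 9 "replicate (length \<Theta>) True" "E(9 := i, 10 := Nc - Suc i)"]
        by (simp add: item_index_def del: sem.simps(3))
      moreover have "item_at i 2 (\<Theta> ! k) (item_index i k)" using i k by (auto simp: item_at_def)
      ultimately show ?thesis using body by (simp del: sem.simps(1-3))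
    qed
    have "concat (map (\<lambda>g. sem x 11 g (E(9 := i, 10 := Nc - Suc i)))
        (map (\<lambda>k. Bind (Emit (replicate (2 + k) True) \<triangleright> For 9 (Emit (replicate (length \<Theta>) True)))
        (body 2 (\<Theta> ! k))) [0..<length \<Theta>])) = concat (map (\<lambda>k. f (item_index i k)) [0..<length \<Theta>])"
      unfolding map_map o_def using 2 by (intro arg_cong[of _ _ concat] map_cong) auto
    then show ?thesis using 1 by (simp add: G_def sem_seqs del: sem.simps(4))
  qed
  have "sem x 9 (item_loop body) E = concat (map G [0..<Nc])"
    unfolding item_loop_def sem.simps(3) using E G
    by (intro arg_cong[of _ _ concat] map_cong) (auto simp: env_def numeral_eq_Suc)
  also have "\<dots> = f 1 @ concat (map (\<lambda>i. concat (map (\<lambda>k. f (item_index i k)) [0..<length \<Theta>])) [0..<Nc])"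
  proof -
    have "0 < Nc" using W by simp
    then have u: "[0..<Nc] = 0 # [1..<Nc]" by (simp add: upt_conv_Cons)
    have "concat (map G [1..<Nc]) = concat (map (\<lambda>i. concat (map (\<lambda>k. f (item_index i k)) [0..<length \<Theta>])) [1..<Nc])"
      by (intro arg_cong[of _ _ concat] map_cong) (auto simp: G_def)
    then show ?thesis unfolding u by (simp add: G_def)
  qed
  also have "concat (map (\<lambda>i. concat (map (\<lambda>k. f (item_index i k)) [0..<length \<Theta>])) [0..<Nc]) =
      concat (map f (concat (map (\<lambda>i. map (\<lambda>k. 2 + i * length \<Theta> + k) [0..<length \<Theta>]) [0..<Nc])))"
    by (simp add: concat_map_concat item_index_def o_def)
  also have "concat (map (\<lambda>i. map (\<lambda>k. 2 + i * length \<Theta> + k) [0..<length \<Theta>]) [0..<Nc]) = [2..<Suc items]"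
    unfolding upt_blocks by (simp add: items_def)
  also have "f 1 @ concat (map f [2..<Suc items]) = concat (map f [1..<Suc items])"
  proof -
    have "[1..<Suc items] = 1 # [Suc 1..<Suc items]" by (rule upt_conv_Cons) (simp add: items_def)
    then show ?thesis by (simp only: list.map concat.simps numeral_2_eq_2 One_nat_def)
  qed
  finally show ?thesis .
qed

definition goal_bits :: "bool list" where
  "goal_bits = concat (map (\<lambda>g. group (if g < Nc then 2 else 0) (goal_edge g) (goal_vert g)) [0..<Nc + Wd])"

lemma goal_bits: "bits_value goal_bits = goal" "2 ^ length goal_bits = Q ^ (Nc + Wd)"
proof -
  have gl: "goal_edge g \<le> L" "goal_vert g \<le> L" for g
    using e lo hi by (auto simp: goal_edge_def goal_vert_def)
  have gb: "goal_edge g < B" "goal_vert g < B" for g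
    using gl[of g] B_gt(2) by linarith+
  have "bits_value (group (if g < Nc then 2 else 0) (goal_edge g) (goal_vert g)) = goal_block g" for g
    unfolding goal_block_def by (rule bits_value_group[OF _ gb]) (use B_gt(2) in auto)
  then show "bits_value goal_bits = goal"
    unfolding goal_bits_def goal_def by (simp add: bits_value_groups)
  show "2 ^ length goal_bits = Q ^ (Nc + Wd)"
    unfolding goal_bits_def length_groups by (simp add: Q_power power_mult)
qed

lemma sem_column_gen:
  "sem x d (column_gen f v) E = bit_items (lower_label False False (input_symbol x (E v)) f (E v = 0))"
proof -
  have "input_symbol x (E v) = 0 \<or> input_symbol x (E v) = 1 \<or> input_symbol x (E v) = 2"
    using input_symbol_less[of x "E v"] by linarith
  then show ?thesis by (elim disjE) (auto simp: column_gen_def)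
qed

lemma sem_goal_gen:
  assumes E: "env E"
  shows "sem x 9 goal_gen E = bit_items goal_bits"
proof -
  define f where "f g = group (if g < Nc then 2 else 0) (goal_edge g) (goal_vert g)" for g
  have total: "Nc + Wd = 1 + Z + Pn + Z + 1 + (Z - 1) * Wd + 1 + (Wd - 2) + 1"
  proof -
    have "Z * Wd = Wd + (Z - 1) * Wd" using Z2(1) by (cases Z) auto
    then show ?thesis using Wd by simp
  qed
  have N: "Nc = 1 + Z + Pn + Z + 1 + (Z - 1) * Wd"
  proof -
    have "Z * Wd = Wd + (Z - 1) * Wd" using Z2(1) by (cases Z) auto
    then show ?thesis using Wd by simp
  qed
  have WN: "Wd \<le> Nc" using Z2(1) by simp
  have low: "f g = lower_label (g = 0) (Suc g = Wd) (fst (string_tape x) (int g - int (Suc Z)))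
      (Suc Z \<le> g \<and> g < Suc Z + Pn) (g = Suc Z)" if "g < Wd" for g
  proof -
    have "goal_vert g = lbl (edge_label Wd (input_row p r x) g)" using that by (simp add: goal_vert_def)
    moreover have "g < Nc" using that WN by (rule less_le_trans)
    ultimately have "f g = group 2 (if g = 0 then e else L) (lbl (edge_label Wd (input_row p r x) g))"
      by (simp add: f_def goal_edge_def)
    then show ?thesis
      by (simp only: lower_label_def edge_label_def input_row_def input_cell_def)
  qed
  have sym: "fst (string_tape x) (int k) = input_symbol x k" for k
    by (simp add: string_tape_def input_symbol_def)
  have neg: "fst (string_tape x) (int g - int (Suc Z)) = 0" if "g \<le> Z" for g
    using that by (simp add: string_tape_def)
  have p1: "f 0 = lower_label True False 0 False False"
    using low[of 0] neg[of 0] Wd Z2 by simp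
  have p2: "f (1 + i) = lower_label False False 0 False False" if "i < Z" for i
    using low[of "1 + i"] neg[of "1 + i"] that Wd by simp
  have p3: "f (1 + Z + i) = lower_label False False (input_symbol x i) True (i = 0)" if "i < Pn" for i
  proof -
    have "int (1 + Z + i) - int (Suc Z) = int i" by simp
    then show ?thesis using low[of "1 + Z + i"] sym[of i] that Wd by simp
  qed
  \<comment> \<open>If \<open>Pn = 0\<close>, the start column falls into this stretch, hence the
    flag \<open>Pn + i = 0\<close>.\<close>
  have p4: "f (1 + Z + Pn + i) = lower_label False False (input_symbol x (Pn + i)) False (Pn + i = 0)" if "i < Z" for i
  proof -
    have "int (1 + Z + Pn + i) - int (Suc Z) = int (Pn + i)" by simp
    then show ?thesis using low[of "1 + Z + Pn + i"] sym[of "Pn + i"] that Wd by simp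
  qed
  \<comment> \<open>The last column shows tape cell \<open>Pn + Z\<close>, which the choice of
    \<open>row_count\<close> puts past the end of the input.\<close>
  have p5: "f (1 + Z + Pn + Z) = lower_label False True 0 False False"
  proof -
    have "int (1 + Z + Pn + Z) - int (Suc Z) = int (Pn + Z)" by simp
    moreover have "input_symbol x (Pn + Z) = 0" using Z2(2) by (simp add: input_symbol_def)
    ultimately show ?thesis using low[of "1 + Z + Pn + Z"] sym[of "Pn + Z"] Wd Z2(1) by (simp add: add.commute)
  qed
  have p6: "f (1 + Z + Pn + Z + 1 + i) = group 2 L L" if "i < (Z - 1) * Wd" for i
  proof -
    have "1 + Z + Pn + Z + 1 + i < Nc" using that N by simp
    moreover have "\<not> 1 + Z + Pn + Z + 1 + i < Wd" "1 + Z + Pn + Z + 1 + i \<noteq> 0" using Wd by linarith+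
    ultimately show ?thesis by (simp only: f_def goal_edge_def goal_vert_def if_True if_False)
  qed
  have hiW: "goal_vert (Nc + i) = L - lbl (edge_label Wd (\<lambda>_. Done) i)" for i
  proof -
    have "\<not> Nc + i < Wd" "\<not> Nc + i < Nc" "Nc + i - Nc = i" using WN by linarith+
    then show ?thesis by (simp only: goal_vert_def if_False)
  qed
  have p7: "f Nc = group 0 (L - e) (L - lbl ((True, False), Done))"
    using hiW[of 0] W by (simp add: f_def goal_edge_def edge_label_def)
  have p8: "f (Nc + 1 + i) = group 0 0 (L - lbl ((False, False), Done))" if "i < Wd - 2" for i
  proof -
    have "Suc (Suc i) \<noteq> Wd" using that by linarith
    then show ?thesis using hiW[of "1 + i"] by (simp add: f_def goal_edge_def edge_label_def)
  qed
  have p9: "f (Nc + 1 + (Wd - 2)) = group 0 0 (L - lbl ((False, True), Done))"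
  proof -
    have "Suc (Suc (Wd - 2)) = Wd" using W(1) by linarith
    then have "edge_label Wd (\<lambda>_. Done) (Suc (Wd - 2)) = ((False, True), Done)"
      by (simp add: edge_label_def)
    moreover have "f (Nc + Suc i) = group 0 0 (goal_vert (Nc + Suc i))" for i
      by (simp add: f_def goal_edge_def)
    ultimately have "f (Nc + Suc (Wd - 2)) = group 0 0 (L - lbl ((False, True), Done))"
      by (simp only: hiW)
    then show ?thesis by (simp only: add.assoc plus_1_eq_Suc)
  qed
  have rep: "concat (map (\<lambda>i. h i) [0..<n]) = concat (replicate n c)" if "\<And>i. i < n \<Longrightarrow> h i = c" for h n and c :: "bool list"
  proof -
    have "map h [0..<n] = replicate n c" using that by (intro nth_equalityI) auto
    then show ?thesis by simp
  qed
  have m2: "concat (map (\<lambda>i. f (1 + i)) [0..<Z]) = concat (replicate Z (lower_label False False 0 False False))"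
    by (rule rep) (rule p2)
  have m3: "concat (map (\<lambda>i. f (1 + Z + i)) [0..<Pn]) =
      concat (map (\<lambda>i. lower_label False False (input_symbol x i) True (i = 0)) [0..<Pn])"
    using p3 by (intro arg_cong[of _ _ concat] map_cong refl) auto
  have m4: "concat (map (\<lambda>i. f (1 + Z + Pn + i)) [0..<Z]) =
      concat (map (\<lambda>i. lower_label False False (input_symbol x (Pn + i)) False (Pn + i = 0)) [0..<Z])"
    using p4 by (intro arg_cong[of _ _ concat] map_cong refl) auto
  have m6: "concat (map (\<lambda>i. f (1 + Z + Pn + Z + 1 + i)) [0..<(Z - 1) * Wd]) =
      concat (replicate ((Z - 1) * Wd) (group 2 L L))"
    by (rule rep) (rule p6)
  have m8: "concat (map (\<lambda>i. f (Nc + 1 + i)) [0..<Wd - 2]) =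
      concat (replicate (Wd - 2) (group 0 0 (L - lbl ((False, False), Done))))"
    by (rule rep) (rule p8)
  have "goal_bits = concat (map f [0..<1 + Z + Pn + Z + 1 + (Z - 1) * Wd + 1 + (Wd - 2) + 1])"
    unfolding goal_bits_def f_def total ..
  also have "\<dots> = f 0 @ concat (map (\<lambda>i. f (1 + i)) [0..<Z]) @ concat (map (\<lambda>i. f (1 + Z + i)) [0..<Pn]) @
      concat (map (\<lambda>i. f (1 + Z + Pn + i)) [0..<Z]) @ f (1 + Z + Pn + Z) @
      concat (map (\<lambda>i. f (1 + Z + Pn + Z + 1 + i)) [0..<(Z - 1) * Wd]) @ f Nc @
      concat (map (\<lambda>i. f (Nc + 1 + i)) [0..<Wd - 2]) @ f (Nc + 1 + (Wd - 2))"
    unfolding concat_map_seg N by simp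
  also have "\<dots> = lower_label True False 0 False False @
      concat (replicate Z (lower_label False False 0 False False)) @
      concat (map (\<lambda>i. lower_label False False (input_symbol x i) True (i = 0)) [0..<Pn]) @
      concat (map (\<lambda>i. lower_label False False (input_symbol x (Pn + i)) False (Pn + i = 0)) [0..<Z]) @
      lower_label False True 0 False False @ concat (replicate ((Z - 1) * Wd) (group 2 L L)) @
      group 0 (L - e) (L - lbl ((True, False), Done)) @
      concat (replicate (Wd - 2) (group 0 0 (L - lbl ((False, False), Done)))) @
      group 0 0 (L - lbl ((False, True), Done))"
    unfolding p1 p5 p7 p9 m2 m3 m4 m6 m8 ..
  finally have gb: "goal_bits = \<dots>" .
  have c3: "sem x 9 (For 1 (column_gen True 9)) E =
      bit_items (concat (map (\<lambda>i. lower_label False False (input_symbol x i) True (i = 0)) [0..<Pn]))"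
    using E unfolding sem.simps(3) sem_column_gen bit_items_concat map_map o_def
    by (simp add: env_def)
  have c4: "sem x 9 (For 3 (Bind (For 1 tick \<triangleright> For 9 tick) (column_gen False 11))) E =
      bit_items (concat (map (\<lambda>i. lower_label False False (input_symbol x (Pn + i)) False (Pn + i = 0)) [0..<Z]))"
  proof -
    have "length (sem x d (For 1 tick \<triangleright> For 9 tick) E') = E' 1 + E' 9" for d E'
      by (simp add: length_sem_For_Emit del: sem.simps(3))
    then show ?thesis
      using E unfolding sem.simps(3,4) sem_column_gen bit_items_concat map_map o_def
      by (simp add: env_def)
  qed
  have "E 3 = Z" "E 4 = Wd - 2" "E 8 = (Z - 1) * Wd" using E by (simp_all add: env_def)
  then show ?thesis
    unfolding gb goal_gen_def sem.simps(1,2) c3 c4 sem_For_put by simp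
qed

definition target_num :: nat where
  "target_num = goal + 5 * Nc * Q ^ (Nc + Wd)"

lemma sem_target_gen:
  assumes E: "env E"
  shows "sem x 9 target_gen E = encode_nat_pair (target_num, 4 * Q ^ (Nc + Wd) * (2 * items + 2))"
proof -
  have N: "0 < Nc" using W by simp
  have "binary target_num = goal_bits @ binary (5 * Nc)"
  proof -
    have "target_num = bits_value goal_bits + 2 ^ length goal_bits * (5 * Nc)"
      unfolding goal_bits target_num_def by simp
    then show ?thesis using N by (simp only: binary_bits_value[of "5 * Nc"] nat_0_less_mult_iff zero_less_numeral simp_thms)
  qed
  moreover have "binary (4 * Q ^ (Nc + Wd) * (2 * items + 2)) =
      concat (replicate Nc (group 0 0 0)) @ concat (replicate (Wd - 2) (group 0 0 0)) @ group 0 0 0 @ group 0 0 0 @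
      [False, False, False] @ binary (items + 1)"
  proof -
    let ?zs = "concat (replicate (Nc + Wd) (group 0 0 0)) @ [False, False, False]"
    have "2 ^ length ?zs = 8 * Q ^ (Nc + Wd)"
      by (simp add: zero_groups power_add Q_power power_mult[symmetric] distrib_left del: length_concat)
    moreover have "bits_value ?zs = 0" by (simp add: bits_value_append zero_groups)
    ultimately have "4 * Q ^ (Nc + Wd) * (2 * items + 2) = bits_value ?zs + 2 ^ length ?zs * (items + 1)"
      by simp
    then have "binary (4 * Q ^ (Nc + Wd) * (2 * items + 2)) = ?zs @ binary (items + 1)"
      by (simp only: binary_bits_value[of "items + 1"] add_gr_0 zero_less_one simp_thms)
    moreover have "Nc + Wd = Nc + ((Wd - 2) + (1 + 1))" using W by simp
    then have "concat (replicate (Nc + Wd) (group 0 0 0)) = concat (replicate Nc (group 0 0 0)) @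
        concat (replicate (Wd - 2) (group 0 0 0)) @ group 0 0 0 @ group 0 0 0"
      by (simp only: replicate_add concat_append) simp
    ultimately show ?thesis by simp
  qed
  moreover have "E 4 = Wd - 2" "E 5 = Nc" "E 6 = items + 1" "E 7 = 5 * Nc" using E by (simp_all add: env_def)
  ultimately show ?thesis
    unfolding target_gen_def sem.simps(1,2,5) sem_goal_gen[OF E] sem_For_put binary_items_eq
    by (simp add: encode_pair_def encode_nat_items bit_items_def)
qed

theorem sem_reduction_gen_encode:
  "sem x 0 reduction_gen (\<lambda>_. 0) =
    ld_encode (items_data items item_weight item_rest target_num (4 * Q ^ (Nc + Wd) * (2 * items + 2)))"
proof -
  obtain E where E: "env E" and s: "sem x 0 reduction_gen (\<lambda>_. 0) = sem x 9 instance_gen E"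
    by (rule sem_reduction_gen)
  have e1: "sem x 9 (item_loop edges_gen) E =
      concat (map (\<lambda>j. concat (map (\<lambda>y. True # encode_edge y) (item_edges item_weight item_rest j))) [1..<Suc items])"
    using E by (intro sem_item_loop[OF E] sem_edges_gen) (auto simp: env_def)
  have e2: "sem x 9 (item_loop (\<lambda>_ _. tick \<triangleright> candidate_gen)) E = concat (map (\<lambda>j. True # encode_nat (2 * j)) [1..<Suc items])"
  proof (rule sem_item_loop[OF E])
    fix i a t j assume "item_at i a t j"
    then have "0 < j" by (auto simp: item_at_def item_index_def)
    then show "sem x 12 (tick \<triangleright> candidate_gen) (E(9 := i, 10 := Nc - Suc i, 11 := j)) = True # encode_nat (2 * j)"
      by (simp add: sem_vertex_gens)
  qed
  have e3: "sem x 9 (Bind (tick \<triangleright> For 5 (Emit (replicate (length \<Theta>) True))) (Bin 9 \<triangleright> Emit [False])) E = encode_nat items"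
  proof -
    have "length (sem x 10 (tick \<triangleright> For 5 (Emit (replicate (length \<Theta>) True))) E) = items"
      using E length_sem_For_Emit[of x 10 5 "replicate (length \<Theta>) True" E]
      by (simp add: env_def items_def del: sem.simps(3))
    moreover have "sem x 10 (Bin 9 \<triangleright> Emit [False]) (E(9 := items)) = encode_nat items"
      by (simp add: binary_items_eq encode_nat_items)
    ultimately show ?thesis by (simp del: sem.simps(2,3))
  qed
  have e4: "[True, False] @ binary_items (E 6) @ [False] = encode_nat (2 * items + 2)"
  proof -
    have "2 * items + 2 = 2 * (items + 1)" by simp
    then have "binary (2 * items + 2) = False # binary (items + 1)" by (simp only: binary_even add_gr_0 zero_less_one simp_thms)
    moreover have "E 6 = items + 1" using E by (simp add: env_def)
    ultimately show ?thesis by (simp add: encode_nat_items binary_items_eq bit_items_def)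
  qed
  have "sem x 9 instance_gen E = encode_nat (2 * items + 2) @
      [True] @ encode_nat 1 @ encode_nat 0 @ encode_nat 1 @ encode_nat 1 @
      concat (map (\<lambda>j. concat (map (\<lambda>y. True # encode_edge y) (item_edges item_weight item_rest j))) [1..<Suc items]) @ [False] @
      encode_list encode_nat [0, 1] @ encode_nat_pair (target_num, 4 * Q ^ (Nc + Wd) * (2 * items + 2)) @
      concat (map (\<lambda>j. True # encode_nat (2 * j)) [1..<Suc items]) @ [False] @ encode_nat items"
    unfolding instance_gen_def sem.simps(1,2,5) e1 e2 e3 e4[symmetric] sem_target_gen[OF E] by simp
  also have "\<dots> = ld_encode (items_data items item_weight item_rest target_num (4 * Q ^ (Nc + Wd) * (2 * items + 2)))"
    unfolding ld_encode_def items_data_def leader_data.simps encode_list_def[of encode_edge] list.map concat.simps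
      concat_map_concat
    by (simp add: encode_list_def encode_pair_def o_def del: upt_Suc)
  finally show ?thesis using s by simp
qed

end


section \<open>The reduction\<close>

lemma cell_in_cells: "input_row p r x c \<in> cells V" "Done \<in> cells V"
proof -
  have "fst (string_tape x) i \<le> 2" for i by (simp add: string_tape_def)
  then show "input_row p r x c \<in> cells V" by (simp add: input_row_def input_cell_def cells_def)
qed (simp add: cells_def)

section \<open>Relabelling tiles by numbers\<close>

definition map_tile :: "('h \<Rightarrow> 'h2) \<Rightarrow> ('v \<Rightarrow> 'v2) \<Rightarrow> ('h, 'v) tile \<Rightarrow> ('h2, 'v2) tile" where
  "map_tile f g t = (f (left t), f (right t), g (bottom t), g (top t))"

lemma map_tile_sel [simp]:
  "left (map_tile f g t) = f (left t)" "right (map_tile f g t) = f (right t)"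
  "bottom (map_tile f g t) = g (bottom t)" "top (map_tile f g t) = g (top t)"
  by (simp_all add: map_tile_def tile_sel)

lemma tiling_map:
  assumes "tiling W N e lo hi \<tau>"
  shows "tiling W N (f e) (\<lambda>c. g (lo c)) (\<lambda>c. g (hi c)) (\<lambda>i. map_tile f g (\<tau> i))"
  using assms by (simp add: tiling_def)

text \<open>Only labels that occur have to be told apart: the codes must be bounded by some
  \<open>L\<close>, which no injection on an infinite label type allows. The border labels are among
  those that occur.\<close>

lemma tiling_map_iff:
  assumes f: "inj_on f H" and g: "inj_on g Vs"
    and e: "e \<in> H" and lo: "\<And>c. c < W \<Longrightarrow> lo c \<in> Vs" and hi: "\<And>c. c < W \<Longrightarrow> hi c \<in> Vs"
    and T: "\<And>t. t \<in> T \<Longrightarrow> left t \<in> H \<and> right t \<in> H \<and> bottom t \<in> Vs \<and> top t \<in> Vs"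
    and W: "0 < W" "W \<le> N"
  shows "(\<exists>\<tau>. tiling W N (f e) (\<lambda>c. g (lo c)) (\<lambda>c. g (hi c)) \<tau> \<and> (\<forall>i<N. \<tau> i \<in> map_tile f g ` T)) \<longleftrightarrow>
    (\<exists>\<tau>. tiling W N e lo hi \<tau> \<and> (\<forall>i<N. \<tau> i \<in> T))"
proof
  assume "\<exists>\<tau>. tiling W N (f e) (\<lambda>c. g (lo c)) (\<lambda>c. g (hi c)) \<tau> \<and> (\<forall>i<N. \<tau> i \<in> map_tile f g ` T)"
  then obtain \<tau> where til: "tiling W N (f e) (\<lambda>c. g (lo c)) (\<lambda>c. g (hi c)) \<tau>"
    and mem: "\<forall>i<N. \<exists>t. t \<in> T \<and> \<tau> i = map_tile f g t" by blast
  from mem obtain \<rho> where \<rho>: "\<And>i. i < N \<Longrightarrow> \<rho> i \<in> T" "\<And>i. i < N \<Longrightarrow> \<tau> i = map_tile f g (\<rho> i)" by metis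
  note fD = inj_onD[OF f] and gD = inj_onD[OF g]
  have "tiling W N e lo hi \<rho>"
    unfolding tiling_def
  proof (intro conjI allI impI)
    show "left (\<rho> 0) = e"
      using til \<rho>[of 0] T[of "\<rho> 0"] e W by (intro fD) (auto simp: tiling_def)
    show "right (\<rho> (N - 1)) = e"
      using til \<rho>[of "N - 1"] T[of "\<rho> (N - 1)"] e W by (intro fD) (auto simp: tiling_def)
    show "right (\<rho> i) = left (\<rho> (Suc i))" if "Suc i < N" for i
    proof (rule fD)
      show "f (right (\<rho> i)) = f (left (\<rho> (Suc i)))"
        using til that \<rho>(2)[of i] \<rho>(2)[of "Suc i"] unfolding tiling_def by fastforce
      show "right (\<rho> i) \<in> H" "left (\<rho> (Suc i)) \<in> H"
        using T \<rho>(1)[of i] \<rho>(1)[of "Suc i"] that by auto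
    qed
    show "bottom (\<rho> c) = lo c" if "c < W" for c
      using til that \<rho>[of c] T[of "\<rho> c"] lo[OF that] W by (intro gD) (auto simp: tiling_def)
    show "top (\<rho> i) = bottom (\<rho> (i + W))" if "i + W < N" for i
    proof (rule gD)
      show "g (top (\<rho> i)) = g (bottom (\<rho> (i + W)))"
        using til that \<rho>(2)[of i] \<rho>(2)[of "i + W"] unfolding tiling_def by fastforce
      show "top (\<rho> i) \<in> Vs" "bottom (\<rho> (i + W)) \<in> Vs"
        using T \<rho>(1)[of i] \<rho>(1)[of "i + W"] that by auto
    qed
    show "top (\<rho> (N - W + c)) = hi c" if "c < W" for c
    proof -
      have "N - W + c < N" using that W by simp
      then show ?thesis
        using til that \<rho>[of "N - W + c"] T[of "\<rho> (N - W + c)"] hi[OF that]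
        by (intro gD) (auto simp: tiling_def)
    qed
  qed
  with \<rho>(1) show "\<exists>\<tau>. tiling W N e lo hi \<tau> \<and> (\<forall>i<N. \<tau> i \<in> T)" by blast
next
  assume "\<exists>\<tau>. tiling W N e lo hi \<tau> \<and> (\<forall>i<N. \<tau> i \<in> T)"
  then obtain \<tau> where "tiling W N e lo hi \<tau>" "\<forall>i<N. \<tau> i \<in> T" by blast
  then show "\<exists>\<tau>. tiling W N (f e) (\<lambda>c. g (lo c)) (\<lambda>c. g (hi c)) \<tau> \<and> (\<forall>i<N. \<tau> i \<in> map_tile f g ` T)"
    by (intro exI[of _ "\<lambda>i. map_tile f g (\<tau> i)"]) (auto intro: tiling_map)
qed

lemma bottom_mk_tile [simp]: "bottom (mk_tile s zl z zr) = ((zl = None, zr = None), fst z)"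
  and top_mk_tile [simp]: "top (mk_tile s zl z zr) = ((zl = None, zr = None), snd z)"
  by (simp_all add: mk_tile_def tile_sel)

lemma tiles_vertical:
  assumes "t \<in> insert give_up_tile (tiles V)"
  shows "bottom t \<in> UNIV \<times> cells V \<and> top t \<in> UNIV \<times> cells V"
  using assms by (auto simp: give_up_tile_def tiles_def slots_def cells_def)

context reduction_at
begin

lemma item_sum: "4 * Q ^ (Nc + Wd) + item_weight j = 5 * Q ^ (Nc + Wd) + item_number j"
  by (simp add: item_weight_def)

lemma answer:
  assumes fb: "tiling Wd Nc e (\<lambda>c. lbl (edge_label Wd (input_row p r x) c))
      (\<lambda>c. lbl (edge_label Wd (\<lambda>_. Done) c)) \<tau>" "\<tau> 0 = zt" "\<And>i. 0 < i \<Longrightarrow> i < Nc \<Longrightarrow> \<tau> i \<in> set \<Theta>"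
    and sol: "solves Orc absolute_leader_selection"
  defines "y \<equiv> Orc (sem x 0 reduction_gen (\<lambda>_. 0))"
  shows "2 < length y" and "y ! 2 \<longleftrightarrow> \<not> (\<exists>\<tau>. tiling Wd Nc e (\<lambda>c. lbl (edge_label Wd (input_row p r x) c))
      (\<lambda>c. lbl (edge_label Wd (\<lambda>_. Done) c)) \<tau> \<and> (\<forall>i<Nc. \<tau> i \<in> set \<Theta>))"
proof -
  let ?D = "4 * Q ^ (Nc + Wd)"
  have "even Q" using B_even by (simp add: Q_def)
  then have evQ: "even (Q ^ (Nc + Wd))" using W by simp
  interpret item_system items item_weight item_rest ?D target_num
  proof
    show "1 \<le> items" by (simp add: items_def)
    fix j assume "1 \<le> j" "j \<le> items"
    then show "0 < item_weight j \<and> 0 < item_rest j \<and> item_weight j + item_rest j + 1 = ?D"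
      using item_number_less[of j] unfolding item_weight_def item_rest_def by linarith
  qed
  have Ieq: "ld_encode I = sem x 0 reduction_gen (\<lambda>_. 0)"
    unfolding I_def sem_reduction_gen_encode ..
  obtain P0 where P0: "P0 \<subseteq> {1..items}" "(\<Sum>j\<in>P0. 5 * Q ^ (Nc + Wd) + item_number j) = target_num + 1"
    using fallback[OF fb] unfolding target_num_def by blast
  \<comment> \<open>This gives \<alpha> \<le> 1: the numerator is below
    \<open>(5 * Nc + 1) * Q ^ (Nc + Wd)\<close>, and the denominator is
    \<open>8 * (items + 1) * Q ^ (Nc + Wd)\<close>.\<close>
  have "Nc \<le> items"
  proof -
    have "1 \<le> length \<Theta>" using tiles_nonempty by (simp add: Suc_le_eq)
    then have "Nc * 1 \<le> Nc * length \<Theta>" by (rule mult_le_mono2)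
    then show ?thesis unfolding items_def by linarith
  qed
  then have "(1 + 5 * Nc) * Q ^ (Nc + Wd) \<le> (8 * items + 8) * Q ^ (Nc + Wd)"
    by (intro mult_le_mono1) simp
  then have n1: "target_num \<le> ?D * (2 * items + 2)"
    using goal_less by (simp add: target_num_def algebra_simps)
  have n2: "even target_num" using goal_even evQ by (simp add: target_num_def)
  have n3: "even ?D" by simp
  have n4: "odd (item_weight 1)"
    using evQ tile_number_even by (simp add: item_weight_def item_number_def)
  have n5: "even (item_weight j)" if "2 \<le> j" "j \<le> items" for j
  proof -
    have "j \<in> {2..items}" using that by simp
    then obtain i k where "i < Nc" "k < length \<Theta>" "j = item_index i k"
      by (rule item_index_surj)
    then show ?thesis using evQ tile_number_even by (simp add: item_weight_def item_number_index)
  qed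
  note ans = item_1_answer[OF n1 n2 n3 n4 n5 P0(1) _ sol, unfolded item_sum Ieq, OF _ _ P0(2)]
  show "2 < length y" using ans(1) unfolding y_def by blast
  show "y ! 2 \<longleftrightarrow> \<not> (\<exists>\<tau>. tiling Wd Nc e (\<lambda>c. lbl (edge_label Wd (input_row p r x) c))
      (\<lambda>c. lbl (edge_label Wd (\<lambda>_. Done) c)) \<tau> \<and> (\<forall>i<Nc. \<tau> i \<in> set \<Theta>))"
    unfolding target_iff[symmetric] using ans(2) unfolding y_def target_num_def by blast
qed

end

theorem mainTheorem6:
  shows "NP_hard absolute_leader_selection"
  unfolding NP_hard_def
proof (intro allI impI)
  fix A assume "in_NP A"
  then obtain V p r where
    acc: "\<And>x. x \<in> A \<longleftrightarrow> (\<exists>\<tau>. run_tiling p r x \<tau> \<and> (\<forall>i<row_count p r x * row_width p r x. \<tau> i \<in> tiles V))"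
    and fb: "\<And>x. \<exists>\<tau>. run_tiling p r x \<tau> \<and> \<tau> 0 = give_up_tile \<and>
       (\<forall>i<row_count p r x * row_width p r x. 0 < i \<longrightarrow> \<tau> i \<in> tiles V)"
    by (rule in_NP_tiling) (rule that)
  let ?T = "insert give_up_tile (tiles V)"
  let ?H = "insert None (left ` ?T \<union> right ` ?T)"
  let ?Vs = "(UNIV :: (bool \<times> bool) set) \<times> cells V"
  have finT: "finite ?T" by (simp add: finite_tiles)
  then have finH: "finite ?H" by blast
  have finV: "finite ?Vs" by (simp add: finite_cells)
  obtain hc :: "hlabel \<Rightarrow> nat" and n1 where hc: "inj_on hc ?H"
    using finite_imp_inj_to_nat_seg[OF finH] by blast
  obtain lbl :: "vlabel \<Rightarrow> nat" and n2 where lbl: "inj_on lbl ?Vs"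
    using finite_imp_inj_to_nat_seg[OF finV] by blast
  define L where "L = Max (hc ` ?H \<union> lbl ` ?Vs)"
  have fin: "finite (hc ` ?H \<union> lbl ` ?Vs)" using finH finV by blast
  have hL: "hc h \<le> L" if "h \<in> ?H" for h
    unfolding L_def using that fin by (intro Max_ge) blast+
  have vL: "lbl v \<le> L" if "v \<in> ?Vs" for v
    unfolding L_def using that fin by (intro Max_ge) blast+
  obtain ts where ts: "set ts = tiles V" using finite_list[OF finite_tiles] by blast
  define \<Theta> where "\<Theta> = map (map_tile hc lbl) ts"
  have set\<Theta>: "set \<Theta> = map_tile hc lbl ` tiles V" by (simp add: \<Theta>_def ts)
  \<comment> \<open>Every \<open>m\<close> with this number below \<open>2 ^ m\<close> would do; the
    number itself is such an \<open>m\<close>.\<close>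
  define m where "m = 2 * (length \<Theta> + 1) * (L + 2)"
  have W2: "2 \<le> row_width p r x" and WN: "row_width p r x \<le> row_count p r x * row_width p r x"
    and N2: "1 < row_count p r x * row_width p r x" for x
  proof -
    have 1: "2 \<le> row_width p r x" "2 \<le> row_count p r x" by (simp_all add: row_width_def row_count_def)
    then have "1 * row_width p r x \<le> row_count p r x * row_width p r x" by (intro mult_le_mono1) simp
    with 1 show "2 \<le> row_width p r x" "row_width p r x \<le> row_count p r x * row_width p r x"
      "1 < row_count p r x * row_width p r x" by linarith+
  qed
  \<comment> \<open>The fallback tiling has a second cell, and that cell carries an ordinary
    tile.\<close>
  have "tiles V \<noteq> {}" using fb[of "[]"] N2[of "[]"] by force
  then have ne: "\<Theta> \<noteq> []" using ts by (auto simp: \<Theta>_def)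
  have input_label: "edge_label w (input_row p r x) c \<in> ?Vs" and done_label: "edge_label w (\<lambda>_. Done) c \<in> ?Vs" for w x c
    by (simp_all add: edge_label_def cell_in_cells)
  have T: "left t \<in> ?H \<and> right t \<in> ?H \<and> bottom t \<in> ?Vs \<and> top t \<in> ?Vs" if "t \<in> ?T" for t
    using that tiles_vertical[OF that] by blast
  interpret reduction p r \<Theta> "map_tile hc lbl give_up_tile" L m "hc None" lbl
  proof (rule reduction.intro)
    fix x
    show "tile_digits \<Theta> (map_tile hc lbl give_up_tile) L m (hc None) (row_width p r x)
        (row_count p r x * row_width p r x)
        (\<lambda>c. lbl (edge_label (row_width p r x) (input_row p r x) c))
        (\<lambda>c. lbl (edge_label (row_width p r x) (\<lambda>_. Done) c))"
    proof
      fix t assume "t \<in> insert (map_tile hc lbl give_up_tile) (set \<Theta>)"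
      then obtain t' where t': "t' \<in> ?T" "t = map_tile hc lbl t'" unfolding set\<Theta> by blast
      then show "left t \<le> L \<and> right t \<le> L \<and> bottom t \<le> L \<and> top t \<le> L"
        using T[OF t'(1)] by (simp add: hL vL del: insert_iff)
    next
      show "2 * (length \<Theta> + 1) * (L + 2) < 2 ^ m" unfolding m_def by (rule less_exp)
    next
      show "hc None \<le> L" by (rule hL) simp
    qed (rule vL input_label done_label W2 WN ne)+
  qed
  have "2 < length (Orc (sem x 0 reduction_gen (\<lambda>_. 0))) \<and> (Orc (sem x 0 reduction_gen (\<lambda>_. 0)) ! 2 \<longleftrightarrow> x \<notin> A)"
    if sol: "solves Orc absolute_leader_selection" for Orc x
  proof -
    interpret reduction_at p r \<Theta> "map_tile hc lbl give_up_tile" L m "hc None" lbl x ..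
    obtain \<tau> where til: "run_tiling p r x \<tau>" and t0: "\<tau> 0 = give_up_tile"
      and mem: "\<And>i. i < Nc \<Longrightarrow> 0 < i \<Longrightarrow> \<tau> i \<in> tiles V" using fb[of x] by blast
    have "map_tile hc lbl (\<tau> 0) = map_tile hc lbl give_up_tile"
      "\<And>i. 0 < i \<Longrightarrow> i < Nc \<Longrightarrow> map_tile hc lbl (\<tau> i) \<in> set \<Theta>"
      using t0 mem by (auto simp: set\<Theta>)
    note ans = answer[OF tiling_map[OF til[unfolded run_tiling_def]] this sol]
    have "x \<in> A \<longleftrightarrow> (\<exists>\<tau>. tiling Wd Nc (hc None) (\<lambda>c. lbl (edge_label Wd (input_row p r x) c))
      (\<lambda>c. lbl (edge_label Wd (\<lambda>_. Done) c)) \<tau> \<and> (\<forall>i<Nc. \<tau> i \<in> set \<Theta>))"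
      unfolding acc run_tiling_def set\<Theta>
    proof (rule tiling_map_iff[OF hc lbl, symmetric])
      show "0 < Wd" "Wd \<le> Nc" using W2[of x] WN[of x] by simp_all
      show "None \<in> ?H" by simp
      show "left t \<in> ?H \<and> right t \<in> ?H \<and> bottom t \<in> ?Vs \<and> top t \<in> ?Vs" if "t \<in> tiles V" for t
        by (rule T) (rule insertI2[OF that])
    qed (rule input_label done_label)+
    with ans show ?thesis by blast
  qed
  then show "poly_turing_reducible A absolute_leader_selection"
    by (rule poly_turing_reducible_gen[OF scoped_reduction_gen])
qed

end
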